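(* Let $(\mathcal{A},\phi,\omega)$ be an iteratable, primitive and expanding pseudo-substitution rule of $\mathbb{R}^d$ of FLC which has a repetitive, non-periodic and FLC fixed point $\mathcal{T}$. Assume that $\phi$ is diagonalizable over $\mathbb{C}$, that all the eigenvalues of $\phi$ are algebraic conjugates of the same multiplicity, and that the spectrum $\operatorname{sp}(\phi)$ is a Pisot family. Then for any $R_0>0$, any $\varepsilon>0$ and any finite subset $F\subset B(0,\frac{1}{8R_0})$, there are $m\in\mathbb{Z}_{>0}$, a finite subset $F'$ of $\mathbb{R}^d\setminus\{0\}$, and a map $x_a\colon\Pi_{\mathcal{T},\mathcal{A}}\to\mathbb{R}^d$ for each $a\in F'$, such that the following two conditions hold: (1) for each $a\in F'$, $\mathcal{P}_1,\mathcal{P}_2\in\Pi_{\mathcal{T},\mathcal{A}}$, $y\in\operatorname{Ker}\chi_a$ and $z\in B(0,R_0)$, the set of tiles $$(\mathcal{P}_1+x_a(\mathcal{P}_1))\cup\Bigl(\mathcal{P}_2+x_a(\mathcal{P}_2)+\phi^{-m}\bigl(\tfrac{1}{2\|a\|^2}a+y+z\bigr)\Bigr)$$ is not $\mathcal{T}$-legal; (2) $F$ and $F'$ are $\varepsilon$-close.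
   Context: Fix an integer $d\ge 1$; $\|\cdot\|$ is the Euclidean norm, $\langle\cdot,\cdot\rangle$ the standard inner product, and $B(x,r)$ the open ball in $\mathbb{R}^d$. A tile is a nonempty bounded open subset of $\mathbb{R}^d$. A patch is a set $\mathcal{P}$ of tiles such that $S\cap T=\emptyset$ for distinct $S,T\in\mathcal{P}$; its support is $\operatorname{supp}\mathcal{P}=\overline{\bigcup_{T\in\mathcal{P}}T}$; a tiling is a patch with support $\mathbb{R}^d$. For a set of tiles $\mathcal{P}$ and $x\in\mathbb{R}^d$, $\mathcal{P}+x=\{T+x\mid T\in\mathcal{P}\}$. For a patch $\mathcal{P}$ and $S\subset\mathbb{R}^d$, $\mathcal{P}\cap S=\{T\in\mathcal{P}\mid T\subset S\}$. A set of tiles $\mathcal{Q}$ (e.g. a patch) is $\mathcal{T}$-legal if $\mathcal{Q}+x\subset\mathcal{T}$ for some $x\in\mathbb{R}^d$. $\mathcal{T}$ is non-periodic if $\mathcal{T}+x=\mathcal{T}$ only for $x=0$. A tiling $\mathcal{T}$ has FLC (finite local complexity) if for every $R>0$ the set $\{\mathcal{T}\cap B(x,R)\mid x\in\mathbb{R}^d\}$ is finite modulo translation. $\mathcal{T}$ is repetitive if for every finite patch $\mathcal{P}\subset\mathcal{T}$ the set $\{x\in\mathbb{R}^d\mid\mathcal{P}+x\subset\mathcal{T}\}$ is relatively dense, i.e. there is $R>0$ such that it meets every ball $B(y,R)$, $y\in\mathbb{R}^d$. A pseudo-substitution rule of $\mathbb{R}^d$ is a triple $(\mathcal{A},\phi,\omega)$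 where $\mathcal{A}$ is a finite set of tiles (as a set of proto-tiles: $0\in P$ for each $P\in\mathcal{A}$, and no two distinct elements of $\mathcal{A}$ are translates of each other), $\phi\colon\mathbb{R}^d\to\mathbb{R}^d$ is an expansive linear map (all eigenvalues lie outside the closed unit disk), and $\omega$ assigns to each $P\in\mathcal{A}$ a finite patch consisting of translates of elements of $\mathcal{A}$. One sets $\omega(P+x)=\omega(P)+\phi(x)$ for $P\in\mathcal{A}$, $x\in\mathbb{R}^d$, and $\omega(\mathcal{P})=\bigcup_{T\in\mathcal{P}}\omega(T)$ for a set $\mathcal{P}$ of translates of elements of $\mathcal{A}$. The rule is: - iteratable if $\omega^n(P)$ is a patch for all $P\in\mathcal{A}$, $n\in\mathbb{Z}_{>0}$; - primitive if there is $K\in\mathbb{Z}_{>0}$ such that for all $P,P'\in\mathcal{A}$ there is $x\in\mathbb{R}^d$ with $P'+x\in\omega^K(P)$; - expanding if there are positive numbers $(r_m)$, $P\in\mathcal{A}$, $x\in\mathbb{R}^d$ and $n\in\mathbb{Z}_{>0}$ with $P+x\in\omega^n(P+x)$, $(P+x)+B(0,r_m)\subset\operatorname{supp}\omega^{nm}(P+x)$ for all $m\in\mathbb{Z}_{>0}$, and $\lim_m r_m=\infty$; - of FLC if for every $R>0$ the set $\{\omega^n(P)\cap B(x,R)\mid P\in\mathcal{A},n\in\mathbb{Z}_{>0},x\in\mathbb{R}^d\}$ is finite modulo translation. A fixed point is a tiling $\mathcal{T}$ consisting of translates of elements of $\mathcal{A}$ with $\omega(\mathcal{T})=\mathcal{T}$.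 $\Pi_{\mathcal{T},\mathcal{A}}$ is the set of all $\mathcal{T}$-legal patches $\mathcal{P}$ that contain at least one element of $\mathcal{A}$ (i.e. $\mathcal{P}\cap\mathcal{A}\ne\emptyset$ as sets of tiles). A finite set $S$ of algebraic integers forms a Pisot family if for every $\lambda\in S$ and every algebraic conjugate $\lambda'$ of $\lambda$ with $\lambda'\notin S$ one has $|\lambda'|<1$. For $a\in\mathbb{R}^d$, $\chi_a(x)=e^{2\pi i\langle a,x\rangle}$, so $\operatorname{Ker}\chi_a=\{x\mid\langle a,x\rangle\in\mathbb{Z}\}$. Finite sets $F,F'\subset\mathbb{R}^d$ are $\varepsilon$-close if for every $x\in F$ there is a unique $y\in F'$ with $\|x-y\|<\varepsilon$, and for every $y\in F'$ there is a unique $x\in F$ with $\|x-y\|<\varepsilon$.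
   Formalization: In (2), F and F' are ε-close is claimed only when distinct points of F are more than ε apart; for arbitrary ε, F and F' are δ-close for some 0<δ≤ε, since for F={-u,0,u}, 0<|u|<ε in dimension 1, no F' is ε-close to F. *)

theory Defs
  imports "HOL-Analysis.Analysis" "HOL-Computational_Algebra.Computational_Algebra"
begin

section \<open>Tiles, patches and tilings\<close>

type_synonym 'n point_set = "(real ^ 'n) set"
type_synonym 'n tile_set = "(real ^ 'n) set set"

definition is_tile :: "'n::finite point_set \<Rightarrow> bool" where
  "is_tile T \<longleftrightarrow> T \<noteq> {} \<and> bounded T \<and> open T"

definition is_patch :: "'n::finite tile_set \<Rightarrow> bool" where
  "is_patch \<P> \<longleftrightarrow> (\<forall>T\<in>\<P>. is_tile T) \<and> (\<forall>S\<in>\<P>. \<forall>T\<in>\<P>. S \<noteq> T \<longrightarrow> S \<inter> T = {})"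

definition supp :: "'n::finite tile_set \<Rightarrow> 'n point_set" where
  "supp \<P> = closure (\<Union>\<P>)"

definition is_tiling :: "'n::finite tile_set \<Rightarrow> bool" where
  "is_tiling \<T> \<longleftrightarrow> is_patch \<T> \<and> supp \<T> = UNIV"

definition shift_tile :: "'n::finite point_set \<Rightarrow> real ^ 'n \<Rightarrow> 'n point_set"
    (infixl \<open>+\<^sub>t\<close> 65) where
  "T +\<^sub>t x = (\<lambda>u. u + x) ` T"

definition shift_tiles :: "'n::finite tile_set \<Rightarrow> real ^ 'n \<Rightarrow> 'n tile_set"
    (infixl \<open>+\<^sub>p\<close> 65) where
  "\<P> +\<^sub>p x = (\<lambda>T. T +\<^sub>t x) ` \<P>"

definition restrict_to :: "'n::finite tile_set \<Rightarrow> 'n point_set \<Rightarrow> 'n tile_set"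
    (infixl \<open>\<sqinter>\<^sub>p\<close> 70) where
  "\<P> \<sqinter>\<^sub>p S = {T \<in> \<P>. T \<subseteq> S}"

definition legal :: "'n::finite tile_set \<Rightarrow> 'n tile_set \<Rightarrow> bool" where
  "legal \<T> \<Q> \<longleftrightarrow> (\<exists>x. \<Q> +\<^sub>p x \<subseteq> \<T>)"

definition non_periodic :: "'n::finite tile_set \<Rightarrow> bool" where
  "non_periodic \<T> \<longleftrightarrow> (\<forall>x. \<T> +\<^sub>p x = \<T> \<longrightarrow> x = 0)"

definition finite_mod_translation :: "'n::finite tile_set set \<Rightarrow> bool" where
  "finite_mod_translation X \<longleftrightarrow>
     (\<exists>Y. finite Y \<and> Y \<subseteq> X \<and> (\<forall>\<P>\<in>X. \<exists>\<Q>\<in>Y. \<exists>x. \<P> = \<Q> +\<^sub>p x))"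

definition tiling_FLC :: "'n::finite tile_set \<Rightarrow> bool" where
  "tiling_FLC \<T> \<longleftrightarrow> (\<forall>R>0. finite_mod_translation {\<T> \<sqinter>\<^sub>p ball x R | x. True})"

definition relatively_dense :: "(real ^ 'n::finite) set \<Rightarrow> bool" where
  "relatively_dense D \<longleftrightarrow> (\<exists>R>0. \<forall>y. D \<inter> ball y R \<noteq> {})"

definition repetitive :: "'n::finite tile_set \<Rightarrow> bool" where
  "repetitive \<T> \<longleftrightarrow>
     (\<forall>\<P>. finite \<P> \<and> is_patch \<P> \<and> \<P> \<subseteq> \<T> \<longrightarrow> relatively_dense {x. \<P> +\<^sub>p x \<subseteq> \<T>})"


section \<open>Spectral notions for a linear map on Euclidean space\<close>

definition complex_matrix :: "(real ^ 'n::finite \<Rightarrow> real ^ 'n) \<Rightarrow> complex ^ 'n ^ 'n" where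
  "complex_matrix \<phi> = map_matrix complex_of_real (matrix \<phi>)"

definition spectrum :: "(real ^ 'n::finite \<Rightarrow> real ^ 'n) \<Rightarrow> complex set" where
  "spectrum \<phi> = {\<mu>. \<exists>v. v \<noteq> 0 \<and> complex_matrix \<phi> *v v = \<mu> *s v}"

definition charpoly :: "(real ^ 'n::finite \<Rightarrow> real ^ 'n) \<Rightarrow> complex poly" where
  "charpoly \<phi> = det (mat [:0, 1:] - map_matrix (\<lambda>c. [:c:]) (complex_matrix \<phi>))"

definition eigen_multiplicity :: "(real ^ 'n::finite \<Rightarrow> real ^ 'n) \<Rightarrow> complex \<Rightarrow> nat" where
  "eigen_multiplicity \<phi> \<mu> = order \<mu> (charpoly \<phi>)"

definition diagonalizable_over_complex :: "(real ^ 'n::finite \<Rightarrow> real ^ 'n) \<Rightarrow> bool" where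
  "diagonalizable_over_complex \<phi> \<longleftrightarrow>
     (\<exists>U D :: complex ^ 'n ^ 'n. invertible U \<and> (\<forall>i j. i \<noteq> j \<longrightarrow> D $ i $ j = 0) \<and>
        complex_matrix \<phi> = U ** D ** matrix_inv U)"

definition expansive :: "(real ^ 'n::finite \<Rightarrow> real ^ 'n) \<Rightarrow> bool" where
  "expansive \<phi> \<longleftrightarrow> linear \<phi> \<and> (\<forall>\<mu>\<in>spectrum \<phi>. norm \<mu> > 1)"

text \<open>An irreducible rational polynomial vanishing at an algebraic number is its minimal
  polynomial up to a nonzero constant.\<close>

definition algebraic_conjugates :: "complex \<Rightarrow> complex \<Rightarrow> bool" where
  "algebraic_conjugates \<mu> \<nu> \<longleftrightarrow>
     (\<exists>p :: rat poly. irreducible p \<and> poly (map_poly of_rat p) \<mu> = 0 \<and> poly (map_poly of_rat p) \<nu> = 0)"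

definition Pisot_family :: "complex set \<Rightarrow> bool" where
  "Pisot_family S \<longleftrightarrow> finite S \<and> (\<forall>\<mu>\<in>S. algebraic_int \<mu>) \<and>
     (\<forall>\<mu>\<in>S. \<forall>\<nu>. algebraic_conjugates \<mu> \<nu> \<and> \<nu> \<notin> S \<longrightarrow> norm \<nu> < 1)"


section \<open>Pseudo-substitution rules\<close>

definition proto_tiles :: "'n::finite tile_set \<Rightarrow> bool" where
  "proto_tiles \<A> \<longleftrightarrow> finite \<A> \<and> (\<forall>P\<in>\<A>. is_tile P \<and> 0 \<in> P) \<and>
     (\<forall>P\<in>\<A>. \<forall>Q\<in>\<A>. \<forall>x. Q = P +\<^sub>t x \<longrightarrow> Q = P)"

definition translates :: "'n::finite tile_set \<Rightarrow> 'n tile_set" where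
  "translates \<A> = {P +\<^sub>t x | P x. P \<in> \<A>}"

text \<open>Only the values of \<open>\<omega>\<close> on \<open>\<A>\<close> are relevant.\<close>

definition pseudo_substitution ::
    "'n::finite tile_set \<Rightarrow> (real ^ 'n \<Rightarrow> real ^ 'n) \<Rightarrow> ('n point_set \<Rightarrow> 'n tile_set) \<Rightarrow> bool" where
  "pseudo_substitution \<A> \<phi> \<omega> \<longleftrightarrow> proto_tiles \<A> \<and> expansive \<phi> \<and>
     (\<forall>P\<in>\<A>. finite (\<omega> P) \<and> is_patch (\<omega> P) \<and> \<omega> P \<subseteq> translates \<A>)"

text \<open>The extension of \<open>\<omega>\<close> to sets of translates of proto-tiles. A translate \<open>P + x\<close> determines
  \<open>P \<in> \<A>\<close> and \<open>x\<close>, so this does encode \<open>\<omega>(P + x) = \<omega>(P) + \<phi>(x)\<close>; see \<open>subst_tile\<close> below.\<close>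

definition subst ::
    "'n::finite tile_set \<Rightarrow> (real ^ 'n \<Rightarrow> real ^ 'n) \<Rightarrow> ('n point_set \<Rightarrow> 'n tile_set)
      \<Rightarrow> 'n tile_set \<Rightarrow> 'n tile_set" where
  "subst \<A> \<phi> \<omega> \<P> = \<Union>{\<omega> P +\<^sub>p \<phi> x | P x. P \<in> \<A> \<and> P +\<^sub>t x \<in> \<P>}"

abbreviation subst_iter ::
    "'n::finite tile_set \<Rightarrow> (real ^ 'n \<Rightarrow> real ^ 'n) \<Rightarrow> ('n point_set \<Rightarrow> 'n tile_set)
      \<Rightarrow> nat \<Rightarrow> 'n point_set \<Rightarrow> 'n tile_set" where
  "subst_iter \<A> \<phi> \<omega> n T \<equiv> (subst \<A> \<phi> \<omega> ^^ n) {T}"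

lemma shift_bounded_eq_zero:
  assumes "bounded T" "T \<noteq> {}" "T +\<^sub>t v = T"
  shows "v = 0"
proof (rule ccontr)
  assume v: "v \<noteq> 0"
  obtain t where t: "t \<in> T" using assms(2) by blast
  have step: "u + v \<in> T" if "u \<in> T" for u
    using that assms(3) unfolding shift_tile_def by blast
  have mem: "t + real k *\<^sub>R v \<in> T" for k
  proof (induction k)
    case (Suc k)
    show ?case using step[OF Suc] by (simp add: algebra_simps)
  qed (use t in simp)
  obtain B where B: "\<And>u. u \<in> T \<Longrightarrow> norm u \<le> B"
    using assms(1) unfolding bounded_iff by blast
  obtain k :: nat where k: "(B + norm t) / norm v < real k"
    using reals_Archimedean2 by blast
  have "norm (real k *\<^sub>R v) \<le> norm (t + real k *\<^sub>R v) + norm t"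
    by (metis add_diff_cancel_left' norm_triangle_ineq4 add.commute)
  also have "\<dots> \<le> B + norm t" using B[OF mem] by simp
  finally show False using k v by (simp add: field_simps)
qed

lemma subst_tile:
  assumes "proto_tiles \<A>" "P \<in> \<A>"
  shows "subst \<A> \<phi> \<omega> {P +\<^sub>t x} = \<omega> P +\<^sub>p \<phi> x"
proof -
  have "Q = P \<and> y = x" if Q: "Q \<in> \<A>" and eq: "Q +\<^sub>t y = P +\<^sub>t x" for Q y
  proof -
    have *: "Q = P +\<^sub>t (x - y)"
    proof -
      have "Q = (\<lambda>u. u - y) ` (Q +\<^sub>t y)" by (simp add: shift_tile_def image_image)
      also have "\<dots> = P +\<^sub>t (x - y)" unfolding eq by (simp add: shift_tile_def image_image algebra_simps)
      finally show ?thesis .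
    qed
    hence "Q = P" using assms Q unfolding proto_tiles_def by blast
    moreover have "x - y = 0"
      using shift_bounded_eq_zero[of P "x - y"] * \<open>Q = P\<close> assms
      by (auto simp: proto_tiles_def is_tile_def)
    ultimately show ?thesis by simp
  qed
  hence "{\<omega> Q +\<^sub>p \<phi> y | Q y. Q \<in> \<A> \<and> Q +\<^sub>t y \<in> {P +\<^sub>t x}} = {\<omega> P +\<^sub>p \<phi> x}"
    using assms(2) by auto
  thus ?thesis by (simp add: subst_def)
qed

lemma subst_eq_Union: "subst \<A> \<phi> \<omega> \<P> = (\<Union>T\<in>\<P>. subst \<A> \<phi> \<omega> {T})"
  unfolding subst_def by blast

definition iteratable ::
    "'n::finite tile_set \<Rightarrow> (real ^ 'n \<Rightarrow> real ^ 'n) \<Rightarrow> ('n point_set \<Rightarrow> 'n tile_set) \<Rightarrow> bool" where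
  "iteratable \<A> \<phi> \<omega> \<longleftrightarrow> (\<forall>P\<in>\<A>. \<forall>n>0. is_patch (subst_iter \<A> \<phi> \<omega> n P))"

definition primitive_rule ::
    "'n::finite tile_set \<Rightarrow> (real ^ 'n \<Rightarrow> real ^ 'n) \<Rightarrow> ('n point_set \<Rightarrow> 'n tile_set) \<Rightarrow> bool" where
  "primitive_rule \<A> \<phi> \<omega> \<longleftrightarrow>
     (\<exists>K>0. \<forall>P\<in>\<A>. \<forall>P'\<in>\<A>. \<exists>x. P' +\<^sub>t x \<in> subst_iter \<A> \<phi> \<omega> K P)"

definition expanding_rule ::
    "'n::finite tile_set \<Rightarrow> (real ^ 'n \<Rightarrow> real ^ 'n) \<Rightarrow> ('n point_set \<Rightarrow> 'n tile_set) \<Rightarrow> bool" where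
  "expanding_rule \<A> \<phi> \<omega> \<longleftrightarrow>
     (\<exists>r :: nat \<Rightarrow> real. \<exists>P\<in>\<A>. \<exists>x. \<exists>n>0.
        (\<forall>m>0. r m > 0) \<and>
        P +\<^sub>t x \<in> subst_iter \<A> \<phi> \<omega> n (P +\<^sub>t x) \<and>
        (\<forall>m>0. {u + v | u v. u \<in> P +\<^sub>t x \<and> v \<in> ball 0 (r m)}
                  \<subseteq> supp (subst_iter \<A> \<phi> \<omega> (n * m) (P +\<^sub>t x))) \<and>
        filterlim r at_top sequentially)"

definition rule_FLC ::
    "'n::finite tile_set \<Rightarrow> (real ^ 'n \<Rightarrow> real ^ 'n) \<Rightarrow> ('n point_set \<Rightarrow> 'n tile_set) \<Rightarrow> bool" where
  "rule_FLC \<A> \<phi> \<omega> \<longleftrightarrow>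
     (\<forall>R>0. finite_mod_translation {subst_iter \<A> \<phi> \<omega> n P \<sqinter>\<^sub>p ball x R | P n x. P \<in> \<A> \<and> n > 0})"

definition fixed_point ::
    "'n::finite tile_set \<Rightarrow> (real ^ 'n \<Rightarrow> real ^ 'n) \<Rightarrow> ('n point_set \<Rightarrow> 'n tile_set)
      \<Rightarrow> 'n tile_set \<Rightarrow> bool" where
  "fixed_point \<A> \<phi> \<omega> \<T> \<longleftrightarrow> is_tiling \<T> \<and> \<T> \<subseteq> translates \<A> \<and> subst \<A> \<phi> \<omega> \<T> = \<T>"


section \<open>Legal patches, characters and closeness of finite sets\<close>

definition legal_patches :: "'n::finite tile_set \<Rightarrow> 'n tile_set \<Rightarrow> 'n tile_set set" (\<open>\<Pi>\<^sub>p\<close>) where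
  "\<Pi>\<^sub>p \<T> \<A> = {\<P>. is_patch \<P> \<and> legal \<T> \<P> \<and> \<P> \<inter> \<A> \<noteq> {}}"

definition character :: "real ^ 'n::finite \<Rightarrow> real ^ 'n \<Rightarrow> complex" where
  "character a x = exp (2 * complex_of_real pi * \<i> * complex_of_real (a \<bullet> x))"

definition Ker_character :: "real ^ 'n::finite \<Rightarrow> (real ^ 'n) set" where
  "Ker_character a = {x. character a x = 1}"

lemma Ker_character_iff: "x \<in> Ker_character a \<longleftrightarrow> a \<bullet> x \<in> \<int>"
proof -
  have "character a x = exp (2 * of_real pi * \<i> * of_real (a \<bullet> x)) " by (simp add: character_def)
  hence "character a x = 1 \<longleftrightarrow> (\<exists>n::int. 2 * pi * (a \<bullet> x) = of_int (2 * n) * pi)"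
    by (simp add: exp_eq_1)
  also have "\<dots> \<longleftrightarrow> (\<exists>n::int. a \<bullet> x = of_int n)"
    by (auto simp: field_simps)
  also have "\<dots> \<longleftrightarrow> a \<bullet> x \<in> \<int>" by (auto elim: Ints_cases)
  finally show ?thesis by (simp add: Ker_character_def)
qed

text \<open>Pitfall: for \<open>\<epsilon>\<close> large compared with the distances between the points of \<open>F\<close>, it may
  happen that no \<open>F'\<close> at all is \<open>\<epsilon>\<close>-close to \<open>F\<close>; see \<open>no_eps_close\<close> below. An assertion for
  all \<open>\<epsilon> > 0\<close> is therefore only possible at some scale \<open>\<delta> \<le> \<epsilon>\<close>, with \<open>\<epsilon>\<close> itself being attained
  when the points of \<open>F\<close> are more than \<open>\<epsilon>\<close> apart.\<close>

definition eps_close :: "real \<Rightarrow> (real ^ 'n::finite) set \<Rightarrow> (real ^ 'n) set \<Rightarrow> bool" where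
  "eps_close \<epsilon> F F' \<longleftrightarrow>
     (\<forall>x\<in>F. \<exists>!y. y \<in> F' \<and> norm (x - y) < \<epsilon>) \<and> (\<forall>y\<in>F'. \<exists>!x. x \<in> F \<and> norm (x - y) < \<epsilon>)"

lemma no_eps_close:
  fixes u :: "real ^ 1"
  assumes "u \<noteq> 0" "norm u < \<epsilon>"
  shows "\<not> eps_close \<epsilon> {- u, 0, u} F'"
proof
  assume e: "eps_close \<epsilon> {- u, 0, u} F'"
  then obtain y where y: "y \<in> F'" "norm y < \<epsilon>"
    unfolding eps_close_def by (metis diff_0 insertI1 insert_commute norm_minus_cancel)
  have u1: "\<exists>!x. x \<in> {- u, 0, u} \<and> norm (x - y) < \<epsilon>" using e y(1) unfolding eps_close_def by blast
  have n: "norm v = \<bar>v $ 1\<bar>" for v :: "real ^ 1" by (simp add: norm_real)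
  have "norm (u - y) < \<epsilon> \<or> norm (- u - y) < \<epsilon>"
    using y(2) assms(2) unfolding n by (simp add: abs_if split: if_splits)
  moreover have "norm (0 - y) < \<epsilon>" using y(2) by simp
  ultimately show False using u1 assms(1) by (metis insertI1 insert_commute neg_equal_0_iff_equal)
qed

end

theory Submission
  imports Defs
    "HOL-Library.Function_Algebras"
begin

text \<open>
  Every tile \<open>P + x\<close> of \<open>\<T>\<close> gets a control point \<open>c P + x\<close>, where the vectors \<open>c P\<close> are chosen so
  that the set \<open>D\<close> of all control points satisfies \<open>\<phi> D \<subseteq> D\<close> (\<open>control_points\<close>).  A vector \<open>a\<close> is
  called an asymptotic character if \<open>a \<bullet> \<phi>^m \<xi>\<close> tends to the integers as \<open>m\<close> grows, uniformly in
  \<open>\<xi> \<in> D - D\<close>.  If \<open>x_a(\<P>) = - c P\<close> for some proto-tile \<open>P \<in> \<P>\<close>, then legality of the forbidden union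
  makes \<open>\<phi>^(-m) (a / (2 \<bar>a\<bar>^2) + y + z)\<close> a difference \<open>\<xi>\<close> of control points.  Pairing \<open>\<phi>^m \<xi>\<close> with
  \<open>a\<close> gives a half-integer plus \<open>a \<bullet> z\<close>, and \<open>\<bar>a \<bullet> z\<bar> < 1/4\<close>; for an asymptotic character and large
  \<open>m\<close> the same number lies within \<open>1/4\<close> of an integer, which is absurd (\<open>half_integer_gap\<close>).  Hence it
  suffices that asymptotic characters are dense in \<open>\<real>^d\<close> (\<open>dense_characters\<close>).  They form a group that
  is stable under the inverse transpose of \<open>\<phi>\<close>, which is contracting, so it suffices that they span
  \<open>\<real>^d\<close> (\<open>spanning_characters\<close>).

  The rational span \<open>V\<close> of \<open>D - D\<close> is finite-dimensional over the rationals, and the common minimal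
  polynomial \<open>p\<close> of the eigenvalues of \<open>\<phi>\<close> annihilates \<open>\<phi>\<close> on \<open>V\<close>.  Hence a rational coordinate \<open>w\<close>
  on \<open>V\<close>, scaled so as to be integral on \<open>D - D\<close>, is a sum of complex components \<open>w_\<nu>\<close>, one for each
  root \<open>\<nu>\<close> of \<open>p\<close>, with \<open>w_\<nu> \<circ> \<phi> = \<nu> w_\<nu>\<close>.  By the Pisot property a root that is not an eigenvalue
  has modulus less than 1, and its component is bounded on \<open>D - D\<close> (\<open>bounded_if_contracted\<close>), so that
  it decays along \<open>\<phi>^m \<xi>\<close>.  If the components for the eigenvalues are restrictions of real-linear maps
  on \<open>\<real>^d\<close>, then the real part of their sum is a linear form whose value at \<open>\<phi>^m \<xi>\<close> is an integer up
  to an error that tends to 0, that is, an asymptotic character; and such characters span because the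
  coordinates reproduce the vectors.

  It remains to see that the components for the eigenvalues are linear (\<open>components_linear\<close>).
  For an eigenvalue \<open>\<mu>\<close> of largest modulus this is rigidity: every additive map \<open>g\<close> on \<open>D - D\<close> with
  \<open>g \<circ> \<phi> = \<mu> g\<close> is linear (\<open>rigidity\<close>, \<open>dominant_cocycle_linear\<close>).  The reason is that a pair of
  points on which \<open>g\<close> has almost the largest possible slope forces \<open>g\<close> to be almost linear on a
  large ball around the midpoint; since \<open>\<phi>^n\<close> and \<open>\<mu>^n\<close> grow at the same rate, scaling down keeps this
  almost-linearity, and repetitivity copies it to every finite part of \<open>D\<close>.  For the other eigenvalues
  the multiplicities enter.  The components of the basis coordinates for a root \<open>\<nu>\<close> form an idempotent
  matrix, whose rank equals its trace; the trace is a rational expression in \<open>\<nu>\<close>, and hence is the same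
  integer for all roots (\<open>trace_conjugate\<close>).  For the dominant eigenvalue, by rigidity, it is the
  multiplicity of that eigenvalue in \<open>\<phi>\<close>.  All eigenvalues have the same multiplicity, so for each of
  them the linear eigenforms of \<open>\<phi>\<close> are already numerous enough to span all components.
\<close>

section \<open>Delone sets invariant under an expanding linear map\<close>

lemma linear_funpow:
  fixes f :: "'a::real_vector \<Rightarrow> 'a"
  shows "linear f \<Longrightarrow> linear (f ^^ n)"
proof (induction n)
  case 0 show ?case by (rule linearI) simp_all
next
  case (Suc n) show ?case
    unfolding funpow.simps(2) by (rule linear_compose[OF Suc.IH[OF Suc.prems] Suc.prems])
qed

text \<open>
  Distances to a far point are linear up to a second-order error.  This is what makes a function of
  extremal slope along a segment differentiable in the middle of the segment.
\<close>
lemma norm_add_le_second_order: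
  fixes u v :: "'a::real_inner"
  assumes "norm u = 1" "t > 0"
  shows "norm (t *\<^sub>R u + v) \<le> t + u \<bullet> v + (norm v)\<^sup>2 / (2 * t)"
proof -
  define A where "A = t + u \<bullet> v + (norm v)\<^sup>2 / (2 * t)"
  have uu: "u \<bullet> u = 1" using assms(1) by (simp add: dot_square_norm)
  have eq: "(norm (t *\<^sub>R u + v))\<^sup>2 = 2 * t * A - t\<^sup>2"
    unfolding power2_norm_eq_inner A_def using assms(2) uu
    by (simp add: inner_add_left inner_add_right field_simps inner_commute power2_eq_square)
  have "0 \<le> (A - t)\<^sup>2" by simp
  hence le: "(norm (t *\<^sub>R u + v))\<^sup>2 \<le> A\<^sup>2"
    unfolding eq by (simp add: power2_diff algebra_simps)
  have "0 \<le> 2 * t * A" using eq zero_le_power2[of "norm (t *\<^sub>R u + v)"] zero_le_power2[of t] by linarith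
  hence "0 \<le> A" using assms(2) by (simp add: zero_le_mult_iff)
  with le have "norm (t *\<^sub>R u + v) \<le> A" by (rule power2_le_imp_le)
  thus ?thesis by (simp add: A_def)
qed

text \<open>
  The properties of the set of control points on which the argument rests.  The assumption
  \<open>finite_differences\<close> is finite local complexity, \<open>recurrence\<close> is repetitivity, and \<open>predecessor\<close>
  says that every point arises from a point of the previous hierarchical level up to a bounded error.
\<close>
locale inflation_set =
  fixes D :: "(real ^ 'n::finite) set" and \<phi> :: "real ^ 'n \<Rightarrow> real ^ 'n"
  assumes linear_phi: "linear \<phi>"
    and inflation_closed: "x \<in> D \<Longrightarrow> \<phi> x \<in> D"
    and rel_dense: "relatively_dense D"
    and finite_differences: "finite {x - y | x y. x \<in> D \<and> y \<in> D \<and> norm (x - y) \<le> R}"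
    and recurrence: "finite F \<Longrightarrow> F \<subseteq> D \<Longrightarrow> relatively_dense {t. (\<lambda>x. x + t) ` F \<subseteq> D}"
    and predecessor: "\<exists>M. \<forall>x\<in>D. \<exists>x'\<in>D. norm (x - \<phi> x') \<le> M"
    and expansion: "\<exists>C>0. \<exists>r>0. r < 1 \<and> (\<forall>n x. norm x \<le> C * r ^ n * norm ((\<phi> ^^ n) x))"
begin

lemma linear_pow: "linear (\<phi> ^^ n)"
  by (rule linear_funpow[OF linear_phi])

lemma surj_pow: "surj (\<phi> ^^ n)"
proof -
  obtain C r where C: "C > 0" "r > 0" "\<And>n x. norm x \<le> C * r ^ n * norm ((\<phi> ^^ n) x)"
    using expansion by blast
  have "x = 0" if "(\<phi> ^^ n) x = 0" for x using C(3)[of x n] that by simp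
  hence "inj (\<phi> ^^ n)" using linear_injective_0[OF linear_pow] by blast
  thus ?thesis using linear_injective_imp_surjective[OF linear_pow] by blast
qed

lemma pow_closed: "x \<in> D \<Longrightarrow> (\<phi> ^^ n) x \<in> D"
  by (induction n) (auto intro: inflation_closed)

lemma exists_near:
  obtains R where "R > 0" "\<And>y. \<exists>x\<in>D. norm (x - y) \<le> R"
proof -
  obtain R where "R > 0" "\<And>y. D \<inter> ball y R \<noteq> {}" using rel_dense unfolding relatively_dense_def by blast
  hence "\<exists>x\<in>D. norm (x - y) \<le> R" for y
  proof -
    obtain x where "x \<in> D" "dist y x < R" using \<open>\<And>y. D \<inter> ball y R \<noteq> {}\<close>[of y] by auto
    thus ?thesis by (intro bexI[of _ x]) (auto simp: dist_norm norm_minus_commute)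
  qed
  thus ?thesis using that \<open>R > 0\<close> by blast
qed

text \<open>
  Choose points of \<open>D\<close> close to equally spaced points of the segment from \<open>x\<close> to \<open>y\<close>.  Finitely many
  vectors thus serve as steps between arbitrary points of \<open>D\<close>.
\<close>
lemma chain:
  obtains G where "finite G" "\<And>v. v \<in> G \<Longrightarrow> \<exists>x\<in>D. \<exists>y\<in>D. v = x - y"
    "\<And>x y. x \<in> D \<Longrightarrow> y \<in> D \<Longrightarrow> \<exists>n c. c 0 = x \<and> c n = y \<and> (\<forall>i. c i \<in> D) \<and>
       (\<forall>i<n. c i - c (Suc i) \<in> G) \<and> real n \<le> norm (x - y) + 1"
proof -
  obtain R where R: "R > 0" "\<And>y. \<exists>x\<in>D. norm (x - y) \<le> R" by (rule exists_near) (rule that)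
  then obtain pk where pk: "\<And>y. pk y \<in> D" "\<And>y. norm (pk y - y) \<le> R" by metis
  let ?G = "{x - y | x y. x \<in> D \<and> y \<in> D \<and> norm (x - y) \<le> 2 * R + 1}"
  show ?thesis
  proof (rule that[of ?G])
    show "finite ?G" by (rule finite_differences)
    show "\<exists>x\<in>D. \<exists>y\<in>D. v = x - y" if "v \<in> ?G" for v using that by blast
    fix x y assume xy: "x \<in> D" "y \<in> D"
    define n where "n = nat \<lceil>norm (x - y)\<rceil>"
    have "real n = real_of_int \<lceil>norm (x - y)\<rceil>" by (simp add: n_def)
    hence n: "norm (x - y) \<le> n" "real n \<le> norm (x - y) + 1" by linarith+
    define p where "p i = x + (real i / real n) *\<^sub>R (y - x)" for i
    define c where "c i = (if i = 0 then x else if i = n then y else pk (p i))" for i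
    have c0: "c 0 = x" by (simp add: c_def)
    have cn: "c n = y"
    proof (cases "n = 0")
      case True thus ?thesis using n(1) by (simp add: c_def)
    qed (simp add: c_def)
    have near: "norm (c i - p i) \<le> R" if "i \<le> n" for i
    proof (cases "i = 0")
      case True thus ?thesis using R by (simp add: c_def p_def)
    next
      case False
      thus ?thesis using R pk(2)[of "p i"] by (auto simp: c_def p_def)
    qed
    have step: "norm (c (Suc i) - c i) \<le> 2 * R + 1" if i: "i < n" for i
    proof -
      have "p (Suc i) - p i = (1 / real n) *\<^sub>R (y - x)"
        using i unfolding p_def by (simp add: add_divide_distrib scaleR_left_distrib)
      hence "norm (p (Suc i) - p i) = norm (x - y) / n" by (simp add: norm_minus_commute)
      also have "\<dots> \<le> 1" using n i by (simp add: field_simps)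
      finally have "norm (p (Suc i) - p i) \<le> 1" .
      moreover have "c (Suc i) - c i = (c (Suc i) - p (Suc i)) + (p (Suc i) - p i) - (c i - p i)" by simp
      ultimately show ?thesis
        using near[of i] near[of "Suc i"] i
          norm_triangle_ineq4[of "(c (Suc i) - p (Suc i)) + (p (Suc i) - p i)" "c i - p i"]
          norm_triangle_ineq[of "c (Suc i) - p (Suc i)" "p (Suc i) - p i"] by simp
    qed
    have cD: "\<forall>i. c i \<in> D" using xy pk(1) by (auto simp: c_def)
    have "c i - c (Suc i) \<in> ?G" if "i < n" for i
      using cD step[OF that] by (auto simp: norm_minus_commute)
    thus "\<exists>n c. c 0 = x \<and> c n = y \<and> (\<forall>i. c i \<in> D) \<and>
       (\<forall>i<n. c i - c (Suc i) \<in> ?G) \<and> real n \<le> norm (x - y) + 1"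
      using c0 cn cD n(2) by blast
  qed
qed

lemma far_pair: "\<exists>x\<in>D. \<exists>y\<in>D. norm (x - y) \<ge> r"
proof -
  obtain R where R: "R > 0" "\<And>y. \<exists>x\<in>D. norm (x - y) \<le> R" by (rule exists_near) (rule that)
  obtain z :: "real ^ 'n" where z: "norm z = \<bar>r\<bar> + 2 * R"
    using vector_choose_size[of "\<bar>r\<bar> + 2 * R"] R(1) by auto
  obtain x y where xy: "x \<in> D" "norm (x - z) \<le> R" "y \<in> D" "norm (y - 0) \<le> R" using R(2) by meson
  have "z = (x - y) - (x - z) + (y - 0)" by simp
  hence "norm z \<le> norm ((x - y) - (x - z)) + norm (y - 0)" by (metis norm_triangle_ineq)
  also have "norm ((x - y) - (x - z)) \<le> norm (x - y) + norm (x - z)" by (rule norm_triangle_ineq4)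
  finally have "norm z \<le> norm (x - y) + norm (x - z) + norm (y - 0)" by simp
  thus ?thesis using xy z by (intro bexI[of _ x] bexI[of _ y]) auto
qed

lemma bounded_values_on_differences:
  fixes g :: "real ^ 'n \<Rightarrow> 'b::real_normed_vector"
  obtains K where "K \<ge> 0" "\<And>x y. x \<in> D \<Longrightarrow> y \<in> D \<Longrightarrow> norm (x - y) \<le> R \<Longrightarrow> norm (g (x - y)) \<le> K"
proof -
  have "bounded (g ` {x - y | x y. x \<in> D \<and> y \<in> D \<and> norm (x - y) \<le> R})"
    by (intro finite_imp_bounded finite_imageI finite_differences)
  then obtain K where "K > 0" "\<forall>v \<in> g ` {x - y | x y. x \<in> D \<and> y \<in> D \<and> norm (x - y) \<le> R}. norm v \<le> K"
    unfolding bounded_pos by blast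
  thus ?thesis using that[of K] by fastforce
qed

text \<open>
  Since \<open>D\<close> is relatively dense, every \<open>t x\<close> is within a bounded distance of \<open>D - D\<close>; so \<open>h (t x)\<close>
  stays bounded as \<open>t\<close> grows.
\<close>
lemma linear_zero_on_differences:
  fixes h :: "real ^ 'n \<Rightarrow> complex"
  assumes h: "linear h" and zero: "\<And>x y. x \<in> D \<Longrightarrow> y \<in> D \<Longrightarrow> h (x - y) = 0"
  shows "h x = 0"
proof -
  obtain K where K: "K > 0" "\<And>x. norm (h x) \<le> K * norm x" using linear_bounded_pos[OF h] by blast
  obtain R where R: "R > 0" "\<And>y. \<exists>x\<in>D. norm (x - y) \<le> R" by (rule exists_near) (rule that)
  have bound: "t * norm (h x) \<le> K * (2 * R)" if "t > 0" for t
  proof -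
    obtain u v where uv: "u \<in> D" "norm (u - t *\<^sub>R x) \<le> R" "v \<in> D" "norm (v - 0) \<le> R" using R(2) by meson
    have "h (t *\<^sub>R x) = h (t *\<^sub>R x - (u - v)) + h (u - v)" by (simp add: linear_add[OF h, symmetric])
    hence "norm (h (t *\<^sub>R x)) \<le> K * norm (t *\<^sub>R x - (u - v))" using zero[OF uv(1,3)] K(2) by simp
    also have "norm (t *\<^sub>R x - (u - v)) \<le> 2 * R"
    proof -
      have eq: "t *\<^sub>R x - (u - v) = (v - 0) - (u - t *\<^sub>R x)" by simp
      show ?thesis unfolding eq using norm_triangle_ineq4[of "v - 0" "u - t *\<^sub>R x"] uv by linarith
    qed
    finally show ?thesis using K(1) that by (simp add: linear_scale[OF h])
  qed
  have "norm (h x) = 0"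
  proof (rule ccontr)
    assume "norm (h x) \<noteq> 0"
    hence pos: "norm (h x) > 0" by simp
    define t where "t = (K * (2 * R) + 1) / norm (h x)"
    have "t > 0" using pos K R by (auto simp: t_def intro!: divide_pos_pos add_pos_pos)
    moreover have "t * norm (h x) = K * (2 * R) + 1" using pos by (simp add: t_def)
    ultimately show False using bound[of t] by simp
  qed
  thus ?thesis by simp
qed

lemma predecessor_pow: "\<exists>M. \<forall>x\<in>D. \<exists>x'\<in>D. norm (x - (\<phi> ^^ n) x') \<le> M"
proof (induction n)
  case 0
  show ?case by (intro exI[of _ 0]) auto
next
  case (Suc n)
  then obtain M where M: "\<And>x. x \<in> D \<Longrightarrow> \<exists>x'\<in>D. norm (x - (\<phi> ^^ n) x') \<le> M" by blast
  obtain M' where M': "\<And>x. x \<in> D \<Longrightarrow> \<exists>x'\<in>D. norm (x - \<phi> x') \<le> M'" using predecessor by blast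
  obtain K where K: "K > 0" "\<And>x. norm (\<phi> x) \<le> K * norm x" using linear_bounded_pos[OF linear_phi] by blast
  have "\<exists>x'\<in>D. norm (x - (\<phi> ^^ Suc n) x') \<le> M' + K * M" if x: "x \<in> D" for x
  proof -
    obtain y where y: "y \<in> D" "norm (x - \<phi> y) \<le> M'" using M'[OF x] by blast
    obtain z where z: "z \<in> D" "norm (y - (\<phi> ^^ n) z) \<le> M" using M[OF y(1)] by blast
    have eq: "x - (\<phi> ^^ Suc n) z = (x - \<phi> y) + \<phi> (y - (\<phi> ^^ n) z)" by (simp add: linear_diff[OF linear_phi])
    have "norm (\<phi> (y - (\<phi> ^^ n) z)) \<le> K * M"
      using order_trans[OF K(2) mult_left_mono[OF z(2)]] K(1) by simp
    hence "norm (x - (\<phi> ^^ Suc n) z) \<le> M' + K * M"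
      unfolding eq using norm_triangle_ineq[of "x - \<phi> y" "\<phi> (y - (\<phi> ^^ n) z)"] y(2) by linarith
    thus ?thesis using z(1) by blast
  qed
  thus ?case by blast
qed

end

section \<open>Cocycles on a Delone set: rigidity and boundedness\<close>

text \<open>
  Only the values of \<open>g\<close> on \<open>D - D\<close> matter.  The cocycle identity says that \<open>g\<close> measures the
  increments of a function on \<open>D\<close>.
\<close>
locale equivariant_cocycle = inflation_set +
  fixes g :: "real ^ 'n \<Rightarrow> complex" and \<mu> :: complex
  assumes cocycle: "x \<in> D \<Longrightarrow> y \<in> D \<Longrightarrow> z \<in> D \<Longrightarrow> g (x - z) = g (x - y) + g (y - z)"
    and equivariant: "x \<in> D \<Longrightarrow> y \<in> D \<Longrightarrow> g (\<phi> x - \<phi> y) = \<mu> * g (x - y)"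
begin

lemma equivariant_pow:
  "x \<in> D \<Longrightarrow> y \<in> D \<Longrightarrow> g ((\<phi> ^^ n) x - (\<phi> ^^ n) y) = \<mu> ^ n * g (x - y)"
  by (induction n) (auto simp: equivariant pow_closed)

lemma large_scale_Lipschitz:
  obtains K where "K \<ge> 0" "\<And>x y. x \<in> D \<Longrightarrow> y \<in> D \<Longrightarrow> norm (g (x - y)) \<le> K * (norm (x - y) + 1)"
proof -
  obtain G where G: "finite G"
    "\<And>x y. x \<in> D \<Longrightarrow> y \<in> D \<Longrightarrow> \<exists>n c. c 0 = x \<and> c n = y \<and> (\<forall>i. c i \<in> D) \<and>
       (\<forall>i<n. c i - c (Suc i) \<in> G) \<and> real n \<le> norm (x - y) + 1" by (rule chain) (rule that)
  have "bounded (g ` G)" using G(1) by (intro finite_imp_bounded finite_imageI)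
  then obtain K where "K > 0" "\<And>v. v \<in> G \<Longrightarrow> norm (g v) \<le> K" unfolding bounded_pos by auto
  hence K: "K \<ge> 0" "\<And>v. v \<in> G \<Longrightarrow> norm (g v) \<le> K" by auto
  show ?thesis
  proof (rule that[OF K(1)])
    fix x y assume xy: "x \<in> D" "y \<in> D"
    obtain n c where c: "c 0 = x" "c n = y" "\<And>i. c i \<in> D"
      "\<And>i. i < n \<Longrightarrow> c i - c (Suc i) \<in> G" "real n \<le> norm (x - y) + 1"
      using G(2)[OF xy] by blast
    have "norm (g (c 0 - c i)) \<le> i * K" if "i \<le> n" for i
      using that
    proof (induction i)
      case 0 show ?case using cocycle[of "c 0" "c 0" "c 0"] c(3) by simp
    next
      case (Suc i)
      have "norm (g (c i - c (Suc i))) \<le> K"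
        using K(2)[OF c(4)[of i]] Suc.prems by simp
      hence "norm (g (c 0 - c (Suc i))) \<le> real i * K + K"
        using Suc cocycle[OF c(3)[of 0] c(3)[of i] c(3)[of "Suc i"]]
          norm_triangle_ineq[of "g (c 0 - c i)" "g (c i - c (Suc i))"] by simp
      thus ?case by (simp add: algebra_simps)
    qed
    from this[of n] have "norm (g (x - y)) \<le> real n * K" using c by simp
    also have "\<dots> \<le> (norm (x - y) + 1) * K" using c(5) K(1) by (rule mult_right_mono)
    finally show "norm (g (x - y)) \<le> K * (norm (x - y) + 1)" by (simp add: mult.commute)
  qed
qed

text \<open>
  The number \<open>s\<close> is the limit, for \<open>r\<close> tending to infinity, of the largest slope of \<open>g\<close> over pairs of
  points at distance at least \<open>r\<close>.
\<close>
lemma asymptotic_slope: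
  obtains s where "s \<ge> 0"
    "\<And>\<eta>. \<eta> > 0 \<Longrightarrow> \<exists>r>0. \<forall>x\<in>D. \<forall>y\<in>D. norm (x - y) \<ge> r \<longrightarrow> norm (g (x - y)) \<le> (s + \<eta>) * norm (x - y)"
    "\<And>\<eta> r. \<eta> > 0 \<Longrightarrow> r > 0 \<Longrightarrow> \<exists>x\<in>D. \<exists>y\<in>D. norm (x - y) \<ge> r \<and> norm (g (x - y)) > (s - \<eta>) * norm (x - y)"
proof -
  define bd where "bd t r \<longleftrightarrow> (\<forall>x\<in>D. \<forall>y\<in>D. norm (x - y) \<ge> r \<longrightarrow> norm (g (x - y)) \<le> t * norm (x - y))" for t r
  define S where "S = {t. \<exists>r>0. bd t r}"
  obtain K where K: "K \<ge> 0" "\<And>x y. x \<in> D \<Longrightarrow> y \<in> D \<Longrightarrow> norm (g (x - y)) \<le> K * (norm (x - y) + 1)"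
    by (rule large_scale_Lipschitz) (rule that)
  have "bd (2 * K) 1"
    unfolding bd_def
  proof (intro ballI impI)
    fix x y assume xy: "x \<in> D" "y \<in> D" "norm (x - y) \<ge> 1"
    have "K * (norm (x - y) + 1) \<le> K * (2 * norm (x - y))" using xy K by (intro mult_left_mono) auto
    thus "norm (g (x - y)) \<le> 2 * K * norm (x - y)" using K(2)[OF xy(1,2)] by simp
  qed
  hence "2 * K \<in> S" unfolding S_def by (auto intro!: exI[of _ 1])
  hence ne: "S \<noteq> {}" by blast
  have pos: "0 \<le> t" if t: "t \<in> S" for t
  proof -
    obtain r where r: "r > 0" "bd t r" using t unfolding S_def by blast
    obtain x y where xy: "x \<in> D" "y \<in> D" "norm (x - y) \<ge> r" using far_pair by blast
    have "0 \<le> norm (g (x - y))" by simp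
    also have "\<dots> \<le> t * norm (x - y)" using r(2) xy unfolding bd_def by simp
    finally show ?thesis using r(1) xy(3) by (auto simp: zero_le_mult_iff)
  qed
  have bdd: "bdd_below S" using pos by (auto simp: bdd_below_def)
  have upper: "\<exists>r>0. bd (Inf S + \<eta>) r" if \<eta>: "\<eta> > 0" for \<eta>
  proof -
    obtain t where t: "t \<in> S" "t < Inf S + \<eta>" using cInf_lessD[OF ne, of "Inf S + \<eta>"] \<eta> by auto
    then obtain r where r: "r > 0" "bd t r" unfolding S_def by blast
    have "bd (Inf S + \<eta>) r"
      unfolding bd_def
    proof (intro ballI impI)
      fix x y assume "x \<in> D" "y \<in> D" "norm (x - y) \<ge> r"
      hence "norm (g (x - y)) \<le> t * norm (x - y)" using r(2) unfolding bd_def by simp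
      thus "norm (g (x - y)) \<le> (Inf S + \<eta>) * norm (x - y)"
        using mult_right_mono[OF less_imp_le[OF t(2)], of "norm (x - y)"] by simp
    qed
    thus ?thesis using r(1) by blast
  qed
  have lower: "\<not> bd (Inf S - \<eta>) r" if "\<eta> > 0" "r > 0" for \<eta> r
  proof -
    have "Inf S - \<eta> \<notin> S" using that(1) cInf_lower[OF _ bdd, of "Inf S - \<eta>"] by auto
    thus ?thesis using that(2) unfolding S_def by blast
  qed
  show ?thesis
  proof (rule that[of "Inf S"])
    show "Inf S \<ge> 0" using ne pos by (rule cInf_greatest)
    show "\<exists>r>0. \<forall>x\<in>D. \<forall>y\<in>D. norm (x - y) \<ge> r \<longrightarrow> norm (g (x - y)) \<le> (Inf S + \<eta>) * norm (x - y)"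
      if "\<eta> > 0" for \<eta> using upper[OF that] unfolding bd_def .
    show "\<exists>x\<in>D. \<exists>y\<in>D. norm (x - y) \<ge> r \<and> norm (g (x - y)) > (Inf S - \<eta>) * norm (x - y)"
      if "\<eta> > 0" "r > 0" for \<eta> r using lower[OF that] unfolding bd_def by (simp add: not_le)
  qed
qed

text \<open>
  Take a long pair \<open>c, c'\<close> of almost extremal slope and let \<open>w\<close> be the phase that makes
  \<open>g (c - c')\<close> positive.  The slope bound from \<open>x\<close> to \<open>c'\<close> bounds \<open>Re (w g)\<close> at \<open>x\<close> from above, the
  one from \<open>c\<close> to \<open>x\<close> bounds it from below, and because the pair is almost extremal the two bounds
  nearly agree, up to the curvature of the distance function, for all \<open>x\<close> near the midpoint.  The
  radius of the ball is a fixed small multiple \<open>\<kappa>\<close> of the length of the pair.  The set \<open>W\<close> contains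
  the admissible phases.
\<close>
lemma almost_linear_ball:
  assumes wits: "\<And>x y. x \<in> D \<Longrightarrow> y \<in> D \<Longrightarrow> \<exists>w\<in>W. Re (w * g (x - y)) = norm (g (x - y))"
    and unit: "\<And>w. w \<in> W \<Longrightarrow> norm w = 1"
  obtains s where "s \<ge> 0"
    "\<And>\<epsilon> R\<^sub>1. \<epsilon> > 0 \<Longrightarrow> \<exists>R\<ge>R\<^sub>1. \<exists>q\<in>D. \<exists>w\<in>W. \<exists>u. norm u = 1 \<and>
       (\<forall>x\<in>D. norm (x - q) \<le> R \<longrightarrow> \<bar>Re (w * g (x - q)) - s * (u \<bullet> (x - q))\<bar> \<le> \<epsilon> * R)"
proof -
  obtain s where s: "s \<ge> 0"
    "\<And>\<eta>. \<eta> > 0 \<Longrightarrow> \<exists>r>0. \<forall>x\<in>D. \<forall>y\<in>D. norm (x - y) \<ge> r \<longrightarrow> norm (g (x - y)) \<le> (s + \<eta>) * norm (x - y)"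
    "\<And>\<eta> r. \<eta> > 0 \<Longrightarrow> r > 0 \<Longrightarrow> \<exists>x\<in>D. \<exists>y\<in>D. norm (x - y) \<ge> r \<and> norm (g (x - y)) > (s - \<eta>) * norm (x - y)"
    by (rule asymptotic_slope) (rule that)
  obtain \<rho> where \<rho>: "\<rho> > 0" "\<And>y. \<exists>x\<in>D. norm (x - y) \<le> \<rho>" by (rule exists_near) (rule that)
  show ?thesis
  proof (rule that[OF s(1)])
    fix \<epsilon> R\<^sub>1 :: real assume \<epsilon>: "\<epsilon> > 0"
    (* The error on the ball of radius \<kappa> t around the midpoint is made of a curvature term
       s \<kappa>^2 t / 2, a term 6 \<eta> t from the defect of the slope, and a bounded term from the distance
       between the midpoint and D.  The choices of \<kappa>, \<eta> and t_0 keep these below the fractions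
       1/4, 1/4 and 1/2 of \<epsilon> \<kappa> t. *)
    define \<kappa> where "\<kappa> = min (1/2) (\<epsilon> / (2 * (s + 1)))"
    have \<kappa>: "\<kappa> > 0" using \<epsilon> s(1) by (simp add: \<kappa>_def)
    have \<kappa>2: "\<kappa> \<le> 1/2" unfolding \<kappa>_def by (rule min.cobounded1)
    have \<kappa>3: "\<kappa> \<le> \<epsilon> / (2 * (s + 1))" unfolding \<kappa>_def by (rule min.cobounded2)
    have "s * \<kappa> \<le> (s + 1) * (\<epsilon> / (2 * (s + 1)))"
      using s(1) \<kappa> by (intro mult_mono \<kappa>3) auto
    also have "(s + 1) * (\<epsilon> / (2 * (s + 1))) = \<epsilon> / 2" using s(1) by (simp add: field_simps)
    finally have s\<kappa>: "s * \<kappa> \<le> \<epsilon> / 2" .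
    define \<eta> where "\<eta> = \<epsilon> * \<kappa> / 24"
    have \<eta>: "\<eta> > 0" using \<epsilon> \<kappa> by (simp add: \<eta>_def)
    obtain r where r: "r > 0" and r_all: "\<forall>x\<in>D. \<forall>y\<in>D. norm (x - y) \<ge> r \<longrightarrow>
        norm (g (x - y)) \<le> (s + \<eta>) * norm (x - y)" using s(2)[OF \<eta>] by (elim exE conjE)
    have r_le: "norm (g (x - y)) \<le> (s + \<eta>) * norm (x - y)"
      if "x \<in> D" "y \<in> D" "norm (x - y) \<ge> r" for x y using r_all that by simp
    define t\<^sub>0 where "t\<^sub>0 = max (max 1 (R\<^sub>1 / \<kappa>)) (max (2 * (r + \<rho>)) ((4 * s * \<rho> + 4 * \<eta> * \<rho>) / (\<epsilon> * \<kappa>)))"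
    have "t\<^sub>0 > 0" by (simp add: t\<^sub>0_def)
    then obtain c c' where cc: "c \<in> D" "c' \<in> D" "norm (c - c') \<ge> 2 * t\<^sub>0"
        "norm (g (c - c')) > (s - \<eta>) * norm (c - c')" using s(3)[OF \<eta>, of "2 * t\<^sub>0"] by auto
    define t where "t = norm (c - c') / 2"
    have t: "t \<ge> t\<^sub>0" "t > 0" using cc(3) \<open>t\<^sub>0 > 0\<close> by (auto simp: t_def)
    have tR: "\<kappa> * t \<ge> R\<^sub>1"
    proof -
      have "R\<^sub>1 / \<kappa> \<le> t" using t unfolding t\<^sub>0_def by linarith
      thus ?thesis using \<kappa> by (simp add: field_simps)
    qed
    have tr: "t \<ge> 2 * (r + \<rho>)" using t unfolding t\<^sub>0_def by linarith
    have t\<rho>: "2 * s * \<rho> + 2 * \<eta> * \<rho> \<le> \<epsilon> * \<kappa> * t / 2"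
    proof -
      have "(4 * s * \<rho> + 4 * \<eta> * \<rho>) / (\<epsilon> * \<kappa>) \<le> t" using t unfolding t\<^sub>0_def by linarith
      hence "4 * s * \<rho> + 4 * \<eta> * \<rho> \<le> t * (\<epsilon> * \<kappa>)" using \<epsilon> \<kappa> by (simp add: pos_divide_le_eq)
      thus ?thesis by (simp add: algebra_simps)
    qed
    define u where "u = (1 / (2 * t)) *\<^sub>R (c - c')"
    have u: "norm u = 1" "c - c' = (2 * t) *\<^sub>R u"
      using t by (auto simp: u_def t_def)
    obtain w where w: "w \<in> W" "Re (w * g (c - c')) = norm (g (c - c'))" using wits cc(1,2) by blast
    define m where "m = c' + t *\<^sub>R u"
    have mc: "c = m + t *\<^sub>R u" using u(2) unfolding m_def
      by (metis add.commute add.left_commute diff_add_cancel mult_2 scaleR_left_distrib)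
    obtain q where q: "q \<in> D" "norm (q - m) \<le> \<rho>" using \<rho>(2) by blast
    have Re_le: "Re (w * z) \<le> norm z" for z
      using complex_Re_le_cmod[of "w * z"] unit[OF w(1)] by (simp add: norm_mult)
    have main: "2 * t * (s - \<eta>) \<le> Re (w * g (c - c'))"
      using w(2) cc(4) by (simp add: t_def field_simps)
    have se: "s + \<eta> \<ge> 0" using s(1) \<eta> by simp
    have nu: "norm (t *\<^sub>R u) = t" using u(1) t(2) by simp
    \<comment> \<open>the two halves of the almost extremal segment\<close>
    have half: "t - \<rho> \<le> norm (c - q)" "norm (c - q) \<le> t + \<rho>" "t - \<rho> \<le> norm (q - c')" "norm (q - c') \<le> t + \<rho>"
    proof -
      have cq: "c - q = t *\<^sub>R u - (q - m)" and qc: "q - c' = t *\<^sub>R u + (q - m)" using mc by (auto simp: m_def)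
      show "t - \<rho> \<le> norm (c - q)" "norm (c - q) \<le> t + \<rho>" "t - \<rho> \<le> norm (q - c')" "norm (q - c') \<le> t + \<rho>"
        using norm_triangle_ineq2[of "t *\<^sub>R u" "q - m"] norm_triangle_ineq4[of "t *\<^sub>R u" "q - m"]
          norm_triangle_ineq[of "t *\<^sub>R u" "q - m"] norm_diff_ineq[of "t *\<^sub>R u" "q - m"] nu q(2)
        unfolding cq qc by linarith+
    qed
    have far: "t - \<rho> \<ge> r" using tr r \<rho>(1) by simp
    have slope: "Re (w * g (x - y)) \<le> (s + \<eta>) * L"
      if "x \<in> D" "y \<in> D" "r \<le> norm (x - y)" "norm (x - y) \<le> L" for x y L
      using Re_le[of "g (x - y)"] r_le[OF that(1-3)] mult_left_mono[OF that(4) se] by linarith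
    have b1: "Re (w * g (c - q)) \<le> (s + \<eta>) * (t + \<rho>)" using half far by (intro slope cc q) auto
    have b2: "Re (w * g (q - c')) \<le> (s + \<eta>) * (t + \<rho>)" using half far by (intro slope cc q) auto
    have "\<bar>Re (w * g (x - q)) - s * (u \<bullet> (x - q))\<bar> \<le> \<epsilon> * (\<kappa> * t)"
      if x: "x \<in> D" "norm (x - q) \<le> \<kappa> * t" for x
    proof -
      define v where "v = x - q"
      have \<kappa>t: "\<kappa> * t \<le> t / 2" using mult_right_mono[OF \<kappa>2, of t] t by simp
      have nv: "norm v \<le> \<kappa> * t" using x(2) by (simp add: v_def)
      have nv2: "norm v \<le> t / 2" using nv \<kappa>t by (rule order_trans)
      have uv: "\<bar>u \<bullet> v\<bar> \<le> t"
        using Cauchy_Schwarz_ineq2[of u v] nv \<kappa>t t unfolding u(1) by linarith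
      have sq: "(norm v)\<^sup>2 / (2 * t) \<le> \<kappa> * (\<kappa> * t) / 2"
      proof -
        have "(norm v)\<^sup>2 \<le> (\<kappa> * t)\<^sup>2" using nv by (intro power_mono) auto
        thus ?thesis using t by (simp add: power2_eq_square field_simps)
      qed
      have sq': "(norm (- v))\<^sup>2 / (2 * t) \<le> \<kappa> * (\<kappa> * t) / 2" using sq by simp
      have \<kappa>\<kappa>: "\<kappa> * (\<kappa> * t) / 2 \<le> t / 2"
      proof -
        have "\<kappa> * (\<kappa> * t) \<le> 1 * t" using \<kappa> \<kappa>2 t \<kappa>t by (intro mult_mono) auto
        thus ?thesis by simp
      qed
      \<comment> \<open>second-order bounds for the distances to the end points\<close>
      have d1: "norm (x - c') \<le> t + u \<bullet> v + \<kappa> * (\<kappa> * t) / 2 + \<rho>"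
      proof -
        have "x - c' = (t *\<^sub>R u + v) + (q - m)" by (simp add: m_def v_def)
        hence "norm (x - c') \<le> norm (t *\<^sub>R u + v) + norm (q - m)" by (metis norm_triangle_ineq)
        thus ?thesis using norm_add_le_second_order[OF u(1) t(2), of v] sq q(2) by simp
      qed
      have d2: "norm (c - x) \<le> t - u \<bullet> v + \<kappa> * (\<kappa> * t) / 2 + \<rho>"
      proof -
        have "c - x = (t *\<^sub>R u + - v) - (q - m)" by (simp add: mc v_def)
        hence "norm (c - x) \<le> norm (t *\<^sub>R u + - v) + norm (q - m)" by (metis norm_triangle_ineq4)
        thus ?thesis using norm_add_le_second_order[OF u(1) t(2), of "- v"] sq' q(2) by simp
      qed
      have far1: "r \<le> norm (x - c')"
      proof -
        have "norm (q - c') - norm v \<le> norm (x - c')"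
          using norm_diff_ineq[of "q - c'" v] by (simp add: v_def)
        hence "t - \<rho> - t / 2 \<le> norm (x - c')" using half(3) nv2 by linarith
        thus ?thesis using tr by (simp add: field_simps)
      qed
      have far2: "r \<le> norm (c - x)"
      proof -
        have "norm (c - q) - norm v \<le> norm (c - x)"
          using norm_triangle_ineq2[of "c - q" v] by (simp add: v_def)
        hence "t - \<rho> - t / 2 \<le> norm (c - x)" using half(1) nv2 by linarith
        thus ?thesis using tr by (simp add: field_simps)
      qed
      have e1: "Re (w * g (x - c')) \<le> (s + \<eta>) * (t + u \<bullet> v + \<kappa> * (\<kappa> * t) / 2 + \<rho>)"
        by (rule slope[OF x(1) cc(2) far1 d1])
      have e2: "Re (w * g (c - x)) \<le> (s + \<eta>) * (t - u \<bullet> v + \<kappa> * (\<kappa> * t) / 2 + \<rho>)"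
        by (rule slope[OF cc(1) x(1) far2 d2])
      have s1: "Re (w * g (x - c')) = Re (w * g (x - q)) + Re (w * g (q - c'))"
        using cocycle[OF x(1) q(1) cc(2)] by (simp add: algebra_simps)
      have s2: "Re (w * g (c - q)) = Re (w * g (c - x)) + Re (w * g (x - q))"
        using cocycle[OF cc(1) x(1) q(1)] by (simp add: algebra_simps)
      have s3: "Re (w * g (c - c')) = Re (w * g (c - q)) + Re (w * g (q - c'))"
        using cocycle[OF cc(1) q(1) cc(2)] by (simp add: algebra_simps)
      have up: "Re (w * g (x - q)) \<le> (s + \<eta>) * (t + u \<bullet> v + \<kappa> * (\<kappa> * t) / 2 + \<rho>) - 2 * t * (s - \<eta>) + (s + \<eta>) * (t + \<rho>)"
        using e1 s1 s3 main b1 by linarith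
      have low: "- Re (w * g (x - q)) \<le> (s + \<eta>) * (t - u \<bullet> v + \<kappa> * (\<kappa> * t) / 2 + \<rho>) - 2 * t * (s - \<eta>) + (s + \<eta>) * (t + \<rho>)"
        using e2 s2 s3 main b2 by linarith
      have exp: "(s + \<eta>) * (t + h + \<kappa> * (\<kappa> * t) / 2 + \<rho>) - 2 * t * (s - \<eta>) + (s + \<eta>) * (t + \<rho>) \<le> s * h + \<epsilon> * (\<kappa> * t)"
        if h: "\<bar>h\<bar> \<le> t" for h
      proof -
        have "(s + \<eta>) * (t + h + \<kappa> * (\<kappa> * t) / 2 + \<rho>) - 2 * t * (s - \<eta>) + (s + \<eta>) * (t + \<rho>)
          = s * h + (s * \<kappa>) * (\<kappa> * t) / 2 + \<eta> * (4 * t + h + \<kappa> * (\<kappa> * t) / 2) + (2 * s * \<rho> + 2 * \<eta> * \<rho>)"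
          by (simp add: algebra_simps)
        also have "\<dots> \<le> s * h + (\<epsilon> / 2) * (\<kappa> * t) / 2 + \<eta> * (6 * t) + \<epsilon> * \<kappa> * t / 2"
        proof -
          have "4 * t + h + \<kappa> * (\<kappa> * t) / 2 \<le> 6 * t" using h \<kappa>\<kappa> t(2) by linarith
          hence "\<eta> * (4 * t + h + \<kappa> * (\<kappa> * t) / 2) \<le> \<eta> * (6 * t)" using \<eta> by (intro mult_left_mono) auto
          moreover have "(s * \<kappa>) * (\<kappa> * t) \<le> (\<epsilon> / 2) * (\<kappa> * t)"
            using s\<kappa> \<kappa> t(2) by (intro mult_right_mono) auto
          ultimately show ?thesis using t\<rho> by linarith
        qed
        also have "\<dots> = s * h + \<epsilon> * (\<kappa> * t)" by (simp add: \<eta>_def)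
        finally show ?thesis .
      qed
      show ?thesis using up low exp[of "u \<bullet> v"] exp[of "- (u \<bullet> v)"] uv
        unfolding v_def[symmetric] by (simp add: abs_le_iff)
    qed
    thus "\<exists>R\<ge>R\<^sub>1. \<exists>q\<in>D. \<exists>w\<in>W. \<exists>u. norm u = 1 \<and>
       (\<forall>x\<in>D. norm (x - q) \<le> R \<longrightarrow> \<bar>Re (w * g (x - q)) - s * (u \<bullet> (x - q))\<bar> \<le> \<epsilon> * R)"
      using tR q(1) w(1) u(1) by blast
  qed
qed

text \<open>
  Scaling down: for the largest \<open>n\<close> such that \<open>\<phi>^n\<close> maps a ball of radius \<open>r\<close> into the almost linear
  ball of radius \<open>R\<close>, one has \<open>R\<close> comparable to \<open>\<bar>\<mu>\<bar>^n r\<close>, so an error of order \<open>R\<close> becomes one of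
  order \<open>r\<close> after division by \<open>\<bar>\<mu>\<bar>^n\<close>.  This is where \<open>\<mu>\<close> must grow as fast as \<open>\<phi>\<close>.  The pull-back
  turns the phase by powers of \<open>\<mu> / \<bar>\<mu>\<bar>\<close>, which is why \<open>W\<close> has to be closed under this rotation.
\<close>
lemma almost_linear_small_ball:
  assumes wits: "\<And>x y. x \<in> D \<Longrightarrow> y \<in> D \<Longrightarrow> \<exists>w\<in>W. Re (w * g (x - y)) = norm (g (x - y))"
    and unit: "\<And>w. w \<in> W \<Longrightarrow> norm w = 1"
    and rot: "\<And>w. w \<in> W \<Longrightarrow> w * (\<mu> / norm \<mu>) \<in> W"
    and \<mu>: "norm \<mu> > 1"
    and growth: "\<And>n x. norm ((\<phi> ^^ n) x) \<le> C * norm \<mu> ^ n * norm x" "C > 0"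
  obtains A where
    "\<And>\<epsilon> r. \<epsilon> > 0 \<Longrightarrow> r > 0 \<Longrightarrow> \<exists>q. \<exists>w\<in>W. \<exists>a. norm a \<le> A \<and>
       (\<forall>x\<in>D. \<forall>y\<in>D. norm (x - q) \<le> r \<longrightarrow> norm (y - q) \<le> r \<longrightarrow> \<bar>Re (w * g (x - y)) - a \<bullet> (x - y)\<bar> \<le> \<epsilon>)"
proof -
  obtain s where s: "s \<ge> 0"
    "\<And>\<epsilon> R\<^sub>1. \<epsilon> > 0 \<Longrightarrow> \<exists>R\<ge>R\<^sub>1. \<exists>q\<in>D. \<exists>w\<in>W. \<exists>u. norm u = 1 \<and>
       (\<forall>x\<in>D. norm (x - q) \<le> R \<longrightarrow> \<bar>Re (w * g (x - q)) - s * (u \<bullet> (x - q))\<bar> \<le> \<epsilon> * R)"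
    by (rule almost_linear_ball[OF wits unit]; (assumption | rule that))
  let ?L = "norm \<mu>"
  have \<mu>0: "\<mu> \<noteq> 0" using \<mu> by auto
  have rot_pow: "w * (\<mu> / ?L) ^ n \<in> W" if "w \<in> W" for w n
    using that
  proof (induction n)
    case (Suc n)
    have "w * (\<mu> / ?L) ^ Suc n = w * (\<mu> / ?L) ^ n * (\<mu> / ?L)" by (simp only: power_Suc mult_ac)
    thus ?case using rot[OF Suc.IH[OF Suc.prems]] by (simp only:)
  qed simp
  show ?thesis
  proof (rule that[of "s * C"])
    fix \<epsilon> r :: real assume \<epsilon>: "\<epsilon> > 0" and r: "r > 0"
    define r' where "r' = C * r"
    have r': "r' > 0" using growth(2) r by (simp add: r'_def)
    define \<epsilon>\<^sub>1 where "\<epsilon>\<^sub>1 = \<epsilon> / (2 * r' * ?L)"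
    have "?L > 0" using \<mu> by linarith
    hence "\<epsilon>\<^sub>1 > 0" unfolding \<epsilon>\<^sub>1_def using \<epsilon> r' by (intro divide_pos_pos mult_pos_pos) auto
    then obtain R p\<^sub>0 w u where R: "R \<ge> r'" "p\<^sub>0 \<in> D" "w \<in> W" "norm u = 1"
      and "\<forall>x\<in>D. norm (x - p\<^sub>0) \<le> R \<longrightarrow> \<bar>Re (w * g (x - p\<^sub>0)) - s * (u \<bullet> (x - p\<^sub>0))\<bar> \<le> \<epsilon>\<^sub>1 * R"
      using s(2)[of \<epsilon>\<^sub>1 r'] by metis
    hence lin: "\<bar>Re (w * g (x - p\<^sub>0)) - s * (u \<bullet> (x - p\<^sub>0))\<bar> \<le> \<epsilon>\<^sub>1 * R"
      if "x \<in> D" "norm (x - p\<^sub>0) \<le> R" for x using that by simp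
    obtain n where n: "r' * ?L ^ n \<le> R" "R < r' * ?L ^ Suc n"
    proof -
      have ex: "\<exists>m. R < r' * ?L ^ m"
        using real_arch_pow[OF \<mu>, of "R / r'"] r' by (auto simp: field_simps)
      define m where "m = (LEAST m. R < r' * ?L ^ m)"
      have m: "R < r' * ?L ^ m" unfolding m_def using ex by (rule LeastI_ex)
      have "m \<noteq> 0" using m R(1) by (intro notI) simp
      then obtain k where k: "m = Suc k" using not0_implies_Suc by blast
      hence "\<not> R < r' * ?L ^ k" unfolding m_def using not_less_Least by (metis lessI)
      thus ?thesis using that[of k] m k by simp
    qed
    obtain q where q: "p\<^sub>0 = (\<phi> ^^ n) q" using surj_pow by (metis surjD)
    define a where "a = (s / ?L ^ n) *\<^sub>R adjoint (\<phi> ^^ n) u"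
    have a: "a \<bullet> v = s / ?L ^ n * (u \<bullet> (\<phi> ^^ n) v)" for v
      unfolding a_def using adjoint_works[OF linear_pow[of n], of v u] by (simp add: inner_commute)
    have na: "norm a \<le> s * C"
    proof -
      have "(norm a)\<^sup>2 = s / ?L ^ n * (u \<bullet> (\<phi> ^^ n) a)" using a[of a] by (simp add: power2_norm_eq_inner)
      also have "\<dots> \<le> s / ?L ^ n * (C * ?L ^ n * norm a)"
        using s(1) norm_cauchy_schwarz[of u "(\<phi> ^^ n) a"] R(4) growth(1)[of n a]
        by (intro mult_left_mono) auto
      also have "\<dots> = s * C * norm a" using \<mu>0 by (simp add: field_simps)
      finally show ?thesis by (cases "norm a = 0") (use s(1) growth(2) in \<open>auto simp: power2_eq_square\<close>)
    qed
    define w' where "w' = w * (\<mu> / ?L) ^ n"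
    have "\<bar>Re (w' * g (x - y)) - a \<bullet> (x - y)\<bar> \<le> \<epsilon>"
      if xy: "x \<in> D" "y \<in> D" "norm (x - q) \<le> r" "norm (y - q) \<le> r" for x y
    proof -
      have in_ball: "norm ((\<phi> ^^ n) z - p\<^sub>0) \<le> R" if "norm (z - q) \<le> r" for z
      proof -
        have "norm ((\<phi> ^^ n) z - p\<^sub>0) = norm ((\<phi> ^^ n) (z - q))" using linear_diff[OF linear_pow] q by simp
        also have "\<dots> \<le> C * ?L ^ n * norm (z - q)" by (rule growth)
        also have "\<dots> \<le> C * ?L ^ n * r" using that growth(2) by (intro mult_left_mono) auto
        finally show ?thesis using n(1) by (simp add: r'_def mult_ac)
      qed
      let ?x = "(\<phi> ^^ n) x" and ?y = "(\<phi> ^^ n) y"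
      have gx: "g (?x - p\<^sub>0) = g (?x - ?y) + g (?y - p\<^sub>0)"
        using cocycle pow_closed xy R(2) by blast
      have "u \<bullet> (?x - p\<^sub>0) = u \<bullet> (?x - ?y) + u \<bullet> (?y - p\<^sub>0)" by (simp add: inner_diff_right)
      hence id: "Re (w * g (?x - ?y)) - s * (u \<bullet> (?x - ?y)) =
         (Re (w * g (?x - p\<^sub>0)) - s * (u \<bullet> (?x - p\<^sub>0))) - (Re (w * g (?y - p\<^sub>0)) - s * (u \<bullet> (?y - p\<^sub>0)))"
        unfolding gx by (simp add: algebra_simps)
      have "\<bar>Re (w * g (?x - ?y)) - s * (u \<bullet> (?x - ?y))\<bar> \<le> 2 * (\<epsilon>\<^sub>1 * R)"
        unfolding id using lin[OF pow_closed[OF xy(1)] in_ball[OF xy(3)]] lin[OF pow_closed[OF xy(2)] in_ball[OF xy(4)]]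
        by linarith
      also have "\<dots> \<le> 2 * (\<epsilon>\<^sub>1 * (r' * ?L ^ Suc n))"
        using n(2) \<open>\<epsilon>\<^sub>1 > 0\<close> by (intro mult_left_mono) auto
      also have "\<dots> = \<epsilon> * ?L ^ n" using r' \<mu>0 by (simp add: \<epsilon>\<^sub>1_def field_simps)
      finally have le: "\<bar>Re (w * g (?x - ?y)) - s * (u \<bullet> (?x - ?y))\<bar> \<le> \<epsilon> * ?L ^ n" .
      have "w * g (?x - ?y) = of_real (?L ^ n) * (w' * g (x - y))"
        unfolding w'_def equivariant_pow[OF xy(1,2)] using \<mu>0 by (simp add: field_simps)
      hence "Re (w * g (?x - ?y)) = ?L ^ n * Re (w' * g (x - y))" by (metis Re_complex_of_real Im_complex_of_real mult_zero_left diff_zero times_complex.sel(1))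
      moreover have "s * (u \<bullet> (?x - ?y)) = ?L ^ n * (a \<bullet> (x - y))"
        using a[of "x - y"] linear_diff[OF linear_pow] \<mu>0 by (simp add: field_simps)
      ultimately have "?L ^ n * \<bar>Re (w' * g (x - y)) - a \<bullet> (x - y)\<bar> \<le> ?L ^ n * \<epsilon>"
        using le by (simp add: right_diff_distrib[symmetric] abs_mult mult.commute)
      thus ?thesis using \<mu>0 by simp
    qed
    moreover have "w' \<in> W" unfolding w'_def using rot_pow R(3) by blast
    ultimately show "\<exists>q. \<exists>w\<in>W. \<exists>a. norm a \<le> s * C \<and>
       (\<forall>x\<in>D. \<forall>y\<in>D. norm (x - q) \<le> r \<longrightarrow> norm (y - q) \<le> r \<longrightarrow> \<bar>Re (w * g (x - y)) - a \<bullet> (x - y)\<bar> \<le> \<epsilon>)"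
      using na by blast
  qed
qed

text \<open>
  By recurrence every finite subset of \<open>D\<close> has a translate in each of the small balls where \<open>g\<close> is
  almost linear.  The pairs \<open>(w, a)\<close> range over a compact set, so the finite intersection property
  yields one pair that is exact on all of \<open>D\<close>.
\<close>
theorem rigidity:
  assumes wits: "\<And>x y. x \<in> D \<Longrightarrow> y \<in> D \<Longrightarrow> \<exists>w\<in>W. Re (w * g (x - y)) = norm (g (x - y))"
    and unit: "\<And>w. w \<in> W \<Longrightarrow> norm w = 1"
    and rot: "\<And>w. w \<in> W \<Longrightarrow> w * (\<mu> / norm \<mu>) \<in> W"
    and cpt: "compact W"
    and \<mu>: "norm \<mu> > 1"
    and growth: "\<And>n x. norm ((\<phi> ^^ n) x) \<le> C * norm \<mu> ^ n * norm x" "C > 0"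
  shows "\<exists>w\<in>W. \<exists>a. \<forall>x\<in>D. \<forall>y\<in>D. Re (w * g (x - y)) = a \<bullet> (x - y)"
proof -
  obtain A where A: "\<And>\<epsilon> r. \<epsilon> > 0 \<Longrightarrow> r > 0 \<Longrightarrow> \<exists>q. \<exists>w\<in>W. \<exists>a. norm a \<le> A \<and>
       (\<forall>x\<in>D. \<forall>y\<in>D. norm (x - q) \<le> r \<longrightarrow> norm (y - q) \<le> r \<longrightarrow> \<bar>Re (w * g (x - y)) - a \<bullet> (x - y)\<bar> \<le> \<epsilon>)"
    by (rule almost_linear_small_ball[OF wits unit rot \<mu> growth]; (assumption | rule that))
  have on_finite: "\<exists>w\<in>W. \<exists>a. norm a \<le> A \<and> (\<forall>x\<in>F. \<forall>y\<in>F. \<bar>Re (w * g (x - y)) - a \<bullet> (x - y)\<bar> \<le> \<epsilon>)"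
    if F: "finite F" "F \<subseteq> D" and \<epsilon>: "\<epsilon> > 0" for F \<epsilon>
  proof -
    obtain B where B: "B > 0" "\<And>x. x \<in> F \<Longrightarrow> norm x \<le> B"
      using finite_imp_bounded[OF F(1)] unfolding bounded_pos by blast
    obtain S where S: "S > 0" "\<And>y. {t. (\<lambda>x. x + t) ` F \<subseteq> D} \<inter> ball y S \<noteq> {}"
      using recurrence[OF F] unfolding relatively_dense_def by blast
    obtain q w a where *: "w \<in> W" "norm a \<le> A"
      "\<And>x y. x \<in> D \<Longrightarrow> y \<in> D \<Longrightarrow> norm (x - q) \<le> B + S \<Longrightarrow> norm (y - q) \<le> B + S \<Longrightarrow>
         \<bar>Re (w * g (x - y)) - a \<bullet> (x - y)\<bar> \<le> \<epsilon>"
      using A[OF \<epsilon>, of "B + S"] B(1) S(1) by (metis add_pos_pos)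
    obtain t where "t \<in> {t. (\<lambda>x. x + t) ` F \<subseteq> D}" "t \<in> ball q S" using S(2)[of q] by blast
    hence t: "(\<lambda>x. x + t) ` F \<subseteq> D" "norm (t - q) \<le> S"
      by (auto simp: dist_norm norm_minus_commute)
    have tF: "x + t \<in> D" "norm (x + t - q) \<le> B + S" if "x \<in> F" for x
      using t(1) that norm_triangle_ineq[of x "t - q"] B(2)[OF that] t(2)
      by (auto simp: add_diff_eq)
    have "\<bar>Re (w * g (x - y)) - a \<bullet> (x - y)\<bar> \<le> \<epsilon>" if "x \<in> F" "y \<in> F" for x y
      using *(3)[OF tF(1)[OF that(1)] tF(1)[OF that(2)] tF(2)[OF that(1)] tF(2)[OF that(2)]] by simp
    thus ?thesis using *(1,2) by blast
  qed
  define K where "K = W \<times> cball (0 :: real ^ 'n) A"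
  have "compact K" unfolding K_def using cpt by (intro compact_Times) auto
  define Z where "Z i = (case i of (x, y, \<epsilon>) \<Rightarrow> {p :: complex \<times> (real ^ 'n). \<bar>Re (fst p * g (x - y)) - snd p \<bullet> (x - y)\<bar> \<le> \<epsilon>})"
    for i :: "(real ^ 'n) \<times> (real ^ 'n) \<times> real"
  define I where "I = D \<times> D \<times> {0 :: real <..}"
  have "K \<inter> (\<Inter>i\<in>I. Z i) \<noteq> {}"
  proof (rule compact_imp_fip_image[OF \<open>compact K\<close>])
    fix i show "closed (Z i)"
      unfolding Z_def case_prod_unfold by (intro closed_Collect_le continuous_intros)
  next
    fix J assume J: "finite J" "J \<subseteq> I"
    define F where "F = fst ` J \<union> (fst \<circ> snd) ` J"
    have F: "finite F" "F \<subseteq> D" using J by (auto simp: F_def I_def)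
    define \<epsilon> where "\<epsilon> = Min (insert 1 ((snd \<circ> snd) ` J))"
    have \<epsilon>: "\<epsilon> > 0" unfolding \<epsilon>_def using J by (subst Min_gr_iff) (auto simp: I_def)
    have \<epsilon>_le: "\<epsilon> \<le> e" if "(x, y, e) \<in> J" for x y e
      unfolding \<epsilon>_def using J(1) that by (intro Min_le) (auto intro!: image_eqI[of _ _ "(x, y, e)"])
    obtain w a where wa: "w \<in> W" "norm a \<le> A" "\<And>x y. x \<in> F \<Longrightarrow> y \<in> F \<Longrightarrow> \<bar>Re (w * g (x - y)) - a \<bullet> (x - y)\<bar> \<le> \<epsilon>"
      using on_finite[OF F \<epsilon>] by blast
    have "(w, a) \<in> Z (x, y, e)" if "(x, y, e) \<in> J" for x y e
    proof -
      have "x \<in> F" "y \<in> F" using that unfolding F_def by force+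
      thus ?thesis using wa(3) \<epsilon>_le[OF that] unfolding Z_def by fastforce
    qed
    hence "(w, a) \<in> K \<inter> (\<Inter>i\<in>J. Z i)" using wa(1,2) by (auto simp: K_def)
    thus "K \<inter> (\<Inter>i\<in>J. Z i) \<noteq> {}" by blast
  qed
  then obtain w a where wa: "w \<in> W" "\<And>x y \<epsilon>. x \<in> D \<Longrightarrow> y \<in> D \<Longrightarrow> \<epsilon> > 0 \<Longrightarrow> \<bar>Re (w * g (x - y)) - a \<bullet> (x - y)\<bar> \<le> \<epsilon>"
    unfolding K_def I_def Z_def by fastforce
  have "Re (w * g (x - y)) = a \<bullet> (x - y)" if "x \<in> D" "y \<in> D" for x y
  proof -
    have "\<bar>Re (w * g (x - y)) - a \<bullet> (x - y)\<bar> \<le> 0" using wa(2)[OF that] by (rule field_le_epsilon) simp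
    thus ?thesis by simp
  qed
  thus ?thesis using wa(1) by blast
qed

text \<open>
  Up to bounded errors, the \<open>n\<close>-th predecessors of two points are at most half as far apart, and \<open>g\<close> at
  the pair is \<open>\<mu>^n\<close> times \<open>g\<close> at the predecessors.  So induction on the scale \<open>2^k\<close> of the distance
  keeps one and the same bound.
\<close>
lemma bounded_if_contracted:
  assumes \<mu>: "norm \<mu> < 1"
  shows "\<exists>K. \<forall>x\<in>D. \<forall>y\<in>D. norm (g (x - y)) \<le> K"
proof -
  obtain C r where C: "C > 0" "r > 0" "r < 1" "\<And>n x. norm x \<le> C * r ^ n * norm ((\<phi> ^^ n) x)"
    using expansion by blast
  have "(\<lambda>n. C * r ^ n) \<longlonglongrightarrow> C * 0" using C by (intro tendsto_mult tendsto_const LIMSEQ_realpow_zero) auto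
  hence "\<forall>\<^sub>F n in sequentially. C * r ^ n < 1 / 2" by (rule order_tendstoD) simp
  then obtain n\<^sub>0 where n\<^sub>0: "\<And>n. n \<ge> n\<^sub>0 \<Longrightarrow> C * r ^ n < 1 / 2" unfolding eventually_sequentially by blast
  define n where "n = Suc n\<^sub>0"
  have half: "norm x \<le> norm ((\<phi> ^^ n) x) / 2" for x
  proof -
    have "C * r ^ n * norm ((\<phi> ^^ n) x) \<le> (1 / 2) * norm ((\<phi> ^^ n) x)"
      using n\<^sub>0[of n] by (intro mult_right_mono) (auto simp: n_def)
    thus ?thesis using C(4)[of x n] by simp
  qed
  obtain M' where M': "\<And>x. x \<in> D \<Longrightarrow> \<exists>x'\<in>D. norm (x - (\<phi> ^^ n) x') \<le> M'" using predecessor_pow by blast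
  define M where "M = max M' 0"
  have M: "\<exists>x'\<in>D. norm (x - (\<phi> ^^ n) x') \<le> M" if "x \<in> D" for x
    using M'[OF that] by (auto simp: M_def intro: le_max_iff_disj[THEN iffD2])
  define q where "q = norm \<mu> ^ n"
  have "q \<le> norm \<mu>" unfolding q_def n_def
    using power_decreasing[of 1 "Suc n\<^sub>0" "norm \<mu>"] \<mu> by simp
  hence q: "q < 1" "q \<ge> 0" using \<mu> by (simp_all add: q_def)
  obtain K\<^sub>1 where K\<^sub>1: "K\<^sub>1 \<ge> 0" "\<And>x y. x \<in> D \<Longrightarrow> y \<in> D \<Longrightarrow> norm (x - y) \<le> M \<Longrightarrow> norm (g (x - y)) \<le> K\<^sub>1"
    by (rule bounded_values_on_differences[of M g]) (rule that)
  obtain K\<^sub>0 where K\<^sub>0: "K\<^sub>0 \<ge> 0" "\<And>x y. x \<in> D \<Longrightarrow> y \<in> D \<Longrightarrow> norm (x - y) \<le> 2 * M + 1 \<Longrightarrow> norm (g (x - y)) \<le> K\<^sub>0"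
    by (rule bounded_values_on_differences[of "2 * M + 1" g]) (rule that)
  define K where "K = max K\<^sub>0 (2 * K\<^sub>1 / (1 - q))"
  have K: "q * K + 2 * K\<^sub>1 \<le> K"
  proof -
    have "2 * K\<^sub>1 / (1 - q) \<le> K" by (simp add: K_def)
    hence "2 * K\<^sub>1 \<le> K * (1 - q)" using q by (simp add: pos_divide_le_eq)
    thus ?thesis by (simp add: algebra_simps)
  qed
  (* The predecessors of points at distance at most 2 M + 2^(k+1) are at distance at most
     (2 M + 2^(k+1) + 2 M) / 2 = 2 M + 2^k. *)
  have main: "\<forall>x\<in>D. \<forall>y\<in>D. norm (x - y) \<le> 2 * M + 2 ^ k \<longrightarrow> norm (g (x - y)) \<le> K" for k :: nat
  proof (induction k)
    case 0
    show ?case using K\<^sub>0(2) by (auto simp: K_def intro: le_max_iff_disj[THEN iffD2])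
  next
    case (Suc k)
    show ?case
    proof (intro ballI impI)
      fix x y assume xy: "x \<in> D" "y \<in> D" "norm (x - y) \<le> 2 * M + 2 ^ Suc k"
      obtain x' where x': "x' \<in> D" "norm (x - (\<phi> ^^ n) x') \<le> M" using M[OF xy(1)] by blast
      obtain y' where y': "y' \<in> D" "norm (y - (\<phi> ^^ n) y') \<le> M" using M[OF xy(2)] by blast
      let ?x = "(\<phi> ^^ n) x'" and ?y = "(\<phi> ^^ n) y'"
      have D': "?x \<in> D" "?y \<in> D" using pow_closed x' y' by auto
      have "norm (?x - ?y) \<le> norm (x - y) + 2 * M"
      proof -
        have eq: "?x - ?y = ((x - y) - (x - ?x)) + (y - ?y)" by simp
        show ?thesis unfolding eq
          using norm_triangle_ineq[of "(x - y) - (x - ?x)" "y - ?y"] norm_triangle_ineq4[of "x - y" "x - ?x"] x'(2) y'(2)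
          by linarith
      qed
      moreover have "norm (x' - y') \<le> norm (?x - ?y) / 2" using half[of "x' - y'"] by (simp add: linear_diff[OF linear_pow])
      ultimately have "norm (x' - y') \<le> 2 * M + 2 ^ k" using xy(3) by simp
      hence IH: "norm (g (x' - y')) \<le> K" using Suc x'(1) y'(1) by blast
      have "g (x - y) = g (x - ?x) + g (?x - ?y) + g (?y - y)"
        using cocycle[OF xy(1) D'(1) xy(2)] cocycle[OF D'(1) D'(2) xy(2)] by simp
      hence "norm (g (x - y)) \<le> norm (g (x - ?x)) + norm (g (?x - ?y)) + norm (g (?y - y))"
        using norm_triangle_ineq[of "g (x - ?x) + g (?x - ?y)" "g (?y - y)"] norm_triangle_ineq[of "g (x - ?x)" "g (?x - ?y)"]
        by simp
      moreover have "norm (g (x - ?x)) \<le> K\<^sub>1" using K\<^sub>1(2)[OF xy(1) D'(1)] x'(2) by simp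
      moreover have "norm (g (?y - y)) \<le> K\<^sub>1" using K\<^sub>1(2)[OF D'(2) xy(2)] y'(2) by (simp add: norm_minus_commute)
      moreover have "norm (g (?x - ?y)) \<le> q * K"
        unfolding equivariant_pow[OF x'(1) y'(1)] norm_mult norm_power q_def[symmetric]
        using IH q(2) by (rule mult_left_mono)
      ultimately show "norm (g (x - y)) \<le> K" using K by linarith
    qed
  qed
  have "norm (g (x - y)) \<le> K" if xy: "x \<in> D" "y \<in> D" for x y
  proof -
    obtain k :: nat where "norm (x - y) < 2 ^ k" using real_arch_pow[of 2 "norm (x - y)"] by auto
    hence "norm (x - y) \<le> 2 * M + 2 ^ k" by (simp add: M_def)
    thus ?thesis using main[of k] xy by blast
  qed
  thus ?thesis by blast
qed

text \<open>
  For a real eigenvalue the phases \<open>1\<close> and \<open>-1\<close> suffice, and real cocycles have to be treated with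
  these alone: with all phases, rigidity could return the imaginary phase, for which the real part of
  \<open>w g\<close> vanishes and gives no information.
\<close>
lemma real_cocycle_linear:
  assumes real_g: "\<And>x y. x \<in> D \<Longrightarrow> y \<in> D \<Longrightarrow> Im (g (x - y)) = 0" and real_\<mu>: "Im \<mu> = 0"
    and \<mu>: "norm \<mu> > 1" and growth: "\<And>n x. norm ((\<phi> ^^ n) x) \<le> C * norm \<mu> ^ n * norm x" "C > 0"
  shows "\<exists>a. \<forall>x\<in>D. \<forall>y\<in>D. Re (g (x - y)) = a \<bullet> (x - y)"
proof -
  have unit: "norm w = 1" if "w \<in> {1, -1}" for w :: complex using that by auto
  have "\<mu> = of_real (Re \<mu>)" using real_\<mu> by (simp add: complex_eq_iff)
  hence "\<mu> / norm \<mu> \<in> {1, -1}"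
    using \<mu> by (cases "Re \<mu> \<ge> 0") (auto simp: complex_eq_iff cmod_def)
  moreover have "w * s \<in> {1, -1}" if "w \<in> {1, -1}" "s \<in> {1, -1}" for w s :: complex using that by auto
  ultimately have rot: "w * (\<mu> / norm \<mu>) \<in> {1, -1}" if "w \<in> {1, -1}" for w using that by blast
  have wits: "\<exists>w\<in>{1, -1}. Re (w * g (x - y)) = norm (g (x - y))" if "x \<in> D" "y \<in> D" for x y
    using real_g[OF that] by (cases "Re (g (x - y)) \<ge> 0") (auto simp: cmod_def)
  obtain w a where wa: "w \<in> {1, -1 :: complex}" "\<forall>x\<in>D. \<forall>y\<in>D. Re (w * g (x - y)) = a \<bullet> (x - y)"
    using rigidity[of "{1, -1}" C, OF wits unit rot finite_imp_compact \<mu> growth] by blast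
  have "Re (g (x - y)) = (Re w *\<^sub>R a) \<bullet> (x - y)" if "x \<in> D" "y \<in> D" for x y
  proof -
    have "Re (w * g (x - y)) = a \<bullet> (x - y)" using wa(2) that by blast
    thus ?thesis using wa(1) by auto
  qed
  thus ?thesis by blast
qed

text \<open>
  For real \<open>\<mu>\<close> the real and imaginary parts of \<open>g\<close> are themselves equivariant.  For nonreal \<open>\<mu>\<close> one
  linear real part \<open>Re (w g)\<close> is enough, because equivariance expresses the imaginary part of \<open>w g\<close>
  through the real part at \<open>\<xi>\<close> and at \<open>\<phi> \<xi>\<close>.
\<close>
lemma dominant_cocycle_linear:
  assumes \<mu>: "norm \<mu> > 1" and growth: "\<And>n x. norm ((\<phi> ^^ n) x) \<le> C * norm \<mu> ^ n * norm x" "C > 0"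
  shows "\<exists>h. linear h \<and> (\<forall>x\<in>D. \<forall>y\<in>D. g (x - y) = h (x - y))"
proof (cases "Im \<mu> = 0")
  case True
  have part: "equivariant_cocycle D \<phi> (\<lambda>v. of_real (f (g v))) \<mu>" if f: "f = Re \<or> f = Im" for f
  proof unfold_locales
    fix x y z assume "x \<in> D" "y \<in> D" "z \<in> D"
    thus "complex_of_real (f (g (x - z))) = of_real (f (g (x - y))) + of_real (f (g (y - z)))"
      using cocycle[of x y z] f by auto
  next
    fix x y assume "x \<in> D" "y \<in> D"
    thus "complex_of_real (f (g (\<phi> x - \<phi> y))) = \<mu> * of_real (f (g (x - y)))"
      using equivariant[of x y] True f by (auto simp: complex_eq_iff)
  qed
  have "\<exists>a. \<forall>x\<in>D. \<forall>y\<in>D. f (g (x - y)) = a \<bullet> (x - y)" if "f = Re \<or> f = Im" for f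
    using equivariant_cocycle.real_cocycle_linear[OF part[OF that] _ True \<mu> growth] by simp
  then obtain a b where ab: "\<forall>x\<in>D. \<forall>y\<in>D. Re (g (x - y)) = a \<bullet> (x - y)" "\<forall>x\<in>D. \<forall>y\<in>D. Im (g (x - y)) = b \<bullet> (x - y)"
    by metis
  define h where "h v = Complex (a \<bullet> v) (b \<bullet> v)" for v
  have "linear h" by (rule linearI) (simp_all add: h_def complex_eq_iff inner_add_right)
  moreover have "\<forall>x\<in>D. \<forall>y\<in>D. g (x - y) = h (x - y)" using ab by (simp add: h_def complex_eq_iff)
  ultimately show ?thesis by blast
next
  case False
  have unit: "norm w = 1" if "w \<in> sphere 0 1" for w :: complex using that by simp
  have rot: "w * (\<mu> / norm \<mu>) \<in> sphere 0 1" if "w \<in> sphere 0 1" for w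
  proof -
    have "\<mu> \<noteq> 0" using \<mu> by auto
    thus ?thesis using that by (simp add: norm_mult norm_divide)
  qed
  have wits: "\<exists>w\<in>sphere 0 1. Re (w * g (x - y)) = norm (g (x - y))" for x y
  proof (cases "g (x - y) = 0")
    case True
    thus ?thesis by (intro bexI[of _ 1]) auto
  next
    case nz: False
    let ?z = "g (x - y)"
    have "cnj ?z / norm ?z * ?z = norm ?z"
      using nz complex_norm_square[of ?z] by (simp add: field_simps power2_eq_square)
    thus ?thesis using nz by (intro bexI[of _ "cnj ?z / norm ?z"]) (auto simp: norm_divide)
  qed
  obtain w a where wa: "w \<in> sphere 0 1" "\<And>x y. x \<in> D \<Longrightarrow> y \<in> D \<Longrightarrow> Re (w * g (x - y)) = a \<bullet> (x - y)"
    using rigidity[of "sphere 0 1" C, OF wits unit rot compact_sphere \<mu> growth] by blast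
  have w0: "w \<noteq> 0" using wa(1) by auto
  define h where "h v = Complex (a \<bullet> v) ((Re \<mu> * (a \<bullet> v) - a \<bullet> \<phi> v) / Im \<mu>) / w" for v
  have "linear h"
    by (rule linearI) (simp_all add: h_def complex_eq_iff inner_add_right add_divide_distrib[symmetric]
        linear_add[OF linear_phi] linear_scale[OF linear_phi] Re_divide Im_divide field_simps)
  moreover have "g (x - y) = h (x - y)" if xy: "x \<in> D" "y \<in> D" for x y
  proof -
    let ?z = "w * g (x - y)"
    have "Re (\<mu> * ?z) = a \<bullet> (\<phi> x - \<phi> y)"
      using wa(2)[OF inflation_closed[OF xy(1)] inflation_closed[OF xy(2)]] equivariant[OF xy]
      by (simp add: mult.left_commute)
    hence "Re \<mu> * Re ?z - Im \<mu> * Im ?z = a \<bullet> \<phi> (x - y)" by (simp add: linear_diff[OF linear_phi])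
    hence "Im ?z = (Re \<mu> * (a \<bullet> (x - y)) - a \<bullet> \<phi> (x - y)) / Im \<mu>"
      using False wa(2)[OF xy] by (simp add: field_simps)
    hence "?z = Complex (a \<bullet> (x - y)) ((Re \<mu> * (a \<bullet> (x - y)) - a \<bullet> \<phi> (x - y)) / Im \<mu>)"
      using wa(2)[OF xy] by (simp add: complex_eq_iff)
    thus ?thesis using w0 by (simp add: h_def field_simps)
  qed
  ultimately show ?thesis by blast
qed

end

section \<open>Control points of a fixed point\<close>

lemma shift_tile_shift_tile: "(T +\<^sub>t x) +\<^sub>t y = T +\<^sub>t (x + y)"
  by (simp add: shift_tile_def image_image add.assoc)

lemma shift_tile_0 [simp]: "T +\<^sub>t 0 = T"
  by (simp add: shift_tile_def)

lemma shift_tile_mem: "P \<in> \<P> \<Longrightarrow> P +\<^sub>t x \<in> \<P> +\<^sub>p x"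
  by (simp add: shift_tiles_def)

lemma proto_tilesD:
  assumes "proto_tiles \<A>"
  shows "finite \<A>" "P \<in> \<A> \<Longrightarrow> bounded P" "P \<in> \<A> \<Longrightarrow> open P" "P \<in> \<A> \<Longrightarrow> P \<noteq> {}" "P \<in> \<A> \<Longrightarrow> 0 \<in> P"
proof -
  have *: "finite \<A>" "\<forall>P\<in>\<A>. is_tile P \<and> 0 \<in> P" using assms unfolding proto_tiles_def by blast+
  show "finite \<A>" by (rule *)
  show "P \<in> \<A> \<Longrightarrow> bounded P" "P \<in> \<A> \<Longrightarrow> open P" "P \<in> \<A> \<Longrightarrow> P \<noteq> {}" "P \<in> \<A> \<Longrightarrow> 0 \<in> P"
    using *(2) by (auto simp: is_tile_def)
qed

lemma shift_tile_unique:
  assumes "proto_tiles \<A>" "P \<in> \<A>" "Q \<in> \<A>" "P +\<^sub>t x = Q +\<^sub>t y"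
  shows "P = Q" "x = y"
proof -
  have "Q = (Q +\<^sub>t y) +\<^sub>t (- y)" by (simp add: shift_tile_shift_tile)
  also have "\<dots> = P +\<^sub>t (x - y)" unfolding assms(4)[symmetric] by (simp add: shift_tile_shift_tile)
  finally have Q: "Q = P +\<^sub>t (x - y)" .
  have inj: "\<forall>P\<in>\<A>. \<forall>Q\<in>\<A>. \<forall>x. Q = P +\<^sub>t x \<longrightarrow> Q = P"
    using assms(1) by (simp add: proto_tiles_def)
  show PQ: "P = Q" using inj[rule_format, OF assms(2,3) Q] by (rule sym)
  have "P +\<^sub>t (x - y) = P" using Q PQ by (simp only:)
  hence "x - y = 0" by (rule shift_bounded_eq_zero[OF proto_tilesD(2,4)[OF assms(1,2)]])
  thus "x = y" by simp
qed

lemma shift_tiles_memE: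
  assumes "T \<in> \<P> +\<^sub>p x"
  obtains S where "S \<in> \<P>" "T = S +\<^sub>t x"
  using assms by (auto simp: shift_tiles_def)

lemma finite_positions:
  assumes "proto_tiles \<A>" "finite \<Q>" "P \<in> \<A>"
  shows "finite {s. P +\<^sub>t s \<in> \<Q>}"
proof -
  have "inj (\<lambda>s. P +\<^sub>t s)" using shift_tile_unique(2)[OF assms(1,3,3)] by (auto intro: injI)
  from finite_vimageI[OF assms(2) this] show ?thesis by (simp add: vimage_def)
qed

lemma finite_control_points:
  assumes "proto_tiles \<A>" "finite \<Q>"
  shows "finite {c P + s | P s. P \<in> \<A> \<and> P +\<^sub>t s \<in> \<Q>}"
proof -
  have "{c P + s | P s. P \<in> \<A> \<and> P +\<^sub>t s \<in> \<Q>} = (\<Union>P\<in>\<A>. (\<lambda>s. c P + s) ` {s. P +\<^sub>t s \<in> \<Q>})" by auto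
  thus ?thesis using finite_positions[OF assms] proto_tilesD(1)[OF assms(1)] by auto
qed

lemma finite_if_bounded_separated:
  fixes S :: "'a::euclidean_space set"
  assumes "bounded S" "e > 0" "\<And>x y. x \<in> S \<Longrightarrow> y \<in> S \<Longrightarrow> dist x y < e \<Longrightarrow> x = y"
  shows "finite S"
proof (rule ccontr)
  assume "infinite S"
  then obtain l where l: "l islimpt S" using bounded_infinite_imp_islimpt[OF order_refl assms(1)] by metis
  obtain x where x: "x \<in> S" "x \<noteq> l" "dist x l < e / 2"
    using l assms(2) unfolding islimpt_approachable by (meson half_gt_zero)
  obtain y where y: "y \<in> S" "dist y l < min (e / 2) (dist x l)"
    using l assms(2) x(2) unfolding islimpt_approachable by (metis half_gt_zero min_less_iff_conj zero_less_dist_iff)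
  have "dist x y < e" using x(3) y(2) dist_triangle2[of x y l] by linarith
  hence "x = y" by (rule assms(3)[OF x(1) y(1)])
  thus False using y(2) by simp
qed

text \<open>
  Each proto-tile contains a ball around \<open>0\<close>, so the positions of disjoint translates of it are
  uniformly separated.
\<close>
lemma finite_patch_in_ball:
  assumes "proto_tiles \<A>" "is_patch \<T>" "\<T> \<subseteq> translates \<A>"
  shows "finite (\<T> \<sqinter>\<^sub>p ball a R)"
proof -
  have fin: "finite {s. P +\<^sub>t s \<in> \<T> \<sqinter>\<^sub>p ball a R}" (is "finite ?S") if P: "P \<in> \<A>" for P
  proof -
    have P': "open P" "0 \<in> P" using proto_tilesD[OF assms(1)] P by blast+
    then obtain \<rho> where \<rho>: "\<rho> > 0" "ball 0 \<rho> \<subseteq> P" by (meson openE)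
    have mem: "s \<in> P +\<^sub>t s" for s using P'(2) by (force simp: shift_tile_def)
    have "?S \<subseteq> ball a R" using mem by (auto simp: restrict_to_def)
    hence "bounded ?S" by (rule bounded_subset[OF bounded_ball])
    thus ?thesis
    proof (rule finite_if_bounded_separated[OF _ \<rho>(1)])
      fix s s' assume s: "s \<in> ?S" "s' \<in> ?S" "dist s s' < \<rho>"
      have "s' - s \<in> P" using \<rho>(2) s(3) by (auto simp: subset_iff dist_norm norm_minus_commute)
      hence "s' \<in> P +\<^sub>t s" unfolding shift_tile_def by (rule rev_image_eqI) simp
      hence "(P +\<^sub>t s) \<inter> (P +\<^sub>t s') \<noteq> {}" using mem by blast
      hence "P +\<^sub>t s = P +\<^sub>t s'"
        using assms(2) s(1,2) unfolding is_patch_def restrict_to_def by blast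
      thus "s = s'" by (rule shift_tile_unique(2)[OF assms(1) P P])
    qed
  qed
  have "\<T> \<sqinter>\<^sub>p ball a R \<subseteq> (\<Union>P\<in>\<A>. (\<lambda>s. P +\<^sub>t s) ` {s. P +\<^sub>t s \<in> \<T> \<sqinter>\<^sub>p ball a R})"
    using assms(3) by (fastforce simp: translates_def restrict_to_def)
  thus ?thesis by (rule finite_subset) (use fin proto_tilesD(1)[OF assms(1)] in auto)
qed

lemma subst_image_nonempty:
  assumes "proto_tiles \<A>" "primitive_rule \<A> \<phi> \<omega>" "linear \<phi>" "P \<in> \<A>"
  shows "\<omega> P \<noteq> {}"
proof
  assume "\<omega> P = {}"
  obtain K where K: "K > 0" "\<exists>x. P +\<^sub>t x \<in> subst_iter \<A> \<phi> \<omega> K P"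
    using assms(2,4) unfolding primitive_rule_def by blast
  have "subst \<A> \<phi> \<omega> {P} = {}"
    using subst_tile[OF assms(1,4), of \<phi> \<omega> 0] \<open>\<omega> P = {}\<close> by (simp add: shift_tiles_def)
  moreover have "(subst \<A> \<phi> \<omega> ^^ k) {} = {}" for k
    by (induction k) (auto simp: subst_def)
  moreover obtain k where "K = Suc k" using K(1) by (cases K) auto
  ultimately have "subst_iter \<A> \<phi> \<omega> K P = {}" by (simp add: funpow_swap1)
  thus False using K(2) by simp
qed

text \<open>
  The solution is \<open>c P = \<Sum> \<phi>^(-k-1) (d (q^k P))\<close>, summed over \<open>k \<ge> 0\<close>.
\<close>
lemma solve_control_equation:
  fixes \<phi> :: "real ^ 'n::finite \<Rightarrow> real ^ 'n" and d :: "'p \<Rightarrow> real ^ 'n"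
  assumes lin: "linear \<phi>"
    and exp: "C > 0" "r > 0" "r < 1" "\<And>n x. norm x \<le> C * r ^ n * norm ((\<phi> ^^ n) x)"
    and A: "finite A" "\<And>P. P \<in> A \<Longrightarrow> q P \<in> A"
  shows "\<exists>c. \<forall>P\<in>A. \<phi> (c P) = c (q P) + d P"
proof -
  have "x = 0" if "\<phi> x = 0" for x using exp(4)[of x 1] that by simp
  hence "inj \<phi>" using linear_injective_0[OF lin] by blast
  hence surj: "surj \<phi>" using linear_injective_imp_surjective[OF lin] by blast
  define \<psi> where "\<psi> = inv \<phi>"
  have \<psi>: "\<phi> (\<psi> y) = y" for y unfolding \<psi>_def using surj by (simp add: surj_f_inv_f)
  have \<psi>n: "(\<phi> ^^ n) ((\<psi> ^^ n) y) = y" for n y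
    by (induction n) (simp_all add: funpow_swap1[of \<phi>] \<psi>)
  have contr: "norm ((\<psi> ^^ n) y) \<le> C * r ^ n * norm y" for n y using exp(4)[of "(\<psi> ^^ n) y" n] \<psi>n by simp
  have "bounded (d ` A)" using A(1) by (intro finite_imp_bounded) auto
  then obtain M where M: "M > 0" "\<And>P. P \<in> A \<Longrightarrow> norm (d P) \<le> M" unfolding bounded_pos by auto
  have qA: "(q ^^ k) P \<in> A" if "P \<in> A" for k P by (induction k) (use that A(2) in auto)
  define f where "f P k = (\<psi> ^^ Suc k) (d ((q ^^ k) P))" for P k
  have sm: "summable (f P)" if "P \<in> A" for P
  proof (rule summable_comparison_test')
    show "summable (\<lambda>k. (C * r * M) * r ^ k)" using exp by (intro summable_mult summable_geometric) auto
    fix k assume "k \<ge> (0::nat)"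
    have "norm (f P k) \<le> C * r ^ Suc k * norm (d ((q ^^ k) P))" unfolding f_def by (rule contr)
    also have "\<dots> \<le> C * r ^ Suc k * M" using exp M(2)[OF qA[OF that]] by (intro mult_left_mono) auto
    finally show "norm (f P k) \<le> (C * r * M) * r ^ k" by (simp add: mult_ac)
  qed
  have bl: "bounded_linear \<phi>" using lin by (simp add: linear_conv_bounded_linear)
  have "\<phi> (suminf (f P)) = suminf (f (q P)) + d P" if P: "P \<in> A" for P
  proof -
    have "\<phi> (suminf (f P)) = (\<Sum>k. \<phi> (f P k))" by (rule bounded_linear.suminf[OF bl sm[OF P]])
    moreover have "summable (\<lambda>k. \<phi> (f P k))" by (rule bounded_linear.summable[OF bl sm[OF P]])
    moreover have "\<phi> (f P 0) = d P" by (simp add: f_def \<psi>)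
    moreover have "\<phi> (f P (Suc k)) = f (q P) k" for k by (simp add: f_def \<psi> funpow_swap1[of q])
    ultimately show ?thesis using suminf_split_head[of "\<lambda>k. \<phi> (f P k)"] by (simp add: algebra_simps)
  qed
  thus ?thesis by (intro exI[of _ "\<lambda>P. suminf (f P)"]) blast
qed

lemma relatively_dense_mono:
  assumes "relatively_dense A" "A \<subseteq> B"
  shows "relatively_dense B"
proof -
  obtain R where R: "R > 0" "\<forall>y. A \<inter> ball y R \<noteq> {}" using assms(1) unfolding relatively_dense_def by blast
  have "\<forall>y. B \<inter> ball y R \<noteq> {}" using R(2) assms(2) by (metis disjoint_iff subsetD)
  thus ?thesis using R(1) unfolding relatively_dense_def by blast
qed

text \<open>
  Fix in every \<open>\<omega> P\<close> one tile \<open>q P + e P\<close> and choose \<open>c\<close> with \<open>\<phi> (c P) = c (q P) + e P\<close>.  Then \<open>\<phi>\<close> maps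
  the control point of a tile to the control point of the selected tile in its substitution.
\<close>
lemma control_points:
  fixes \<phi> :: "real ^ 'n::finite \<Rightarrow> real ^ 'n"
  assumes rule: "pseudo_substitution \<A> \<phi> \<omega>" and prim: "primitive_rule \<A> \<phi> \<omega>"
    and fp: "fixed_point \<A> \<phi> \<omega> \<T>" and rep: "repetitive \<T>" and flc: "tiling_FLC \<T>"
    and expd: "C > 0" "r > 0" "r < 1" "\<And>n x. norm x \<le> C * r ^ n * norm ((\<phi> ^^ n) x)"
  obtains c where "inflation_set {c P + x | P x. P \<in> \<A> \<and> P +\<^sub>t x \<in> \<T>} \<phi>"
proof -
  have proto: "proto_tiles \<A>" and lin: "linear \<phi>"
    and \<omega>: "\<And>P. P \<in> \<A> \<Longrightarrow> finite (\<omega> P)" "\<And>P. P \<in> \<A> \<Longrightarrow> \<omega> P \<subseteq> translates \<A>"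
    using rule unfolding pseudo_substitution_def expansive_def by auto
  have patch: "is_patch \<T>" and cover: "closure (\<Union>\<T>) = UNIV" and tr: "\<T> \<subseteq> translates \<A>"
    and sub: "subst \<A> \<phi> \<omega> \<T> = \<T>"
    using fp unfolding fixed_point_def is_tiling_def supp_def by auto
  have finA: "finite \<A>" by (rule proto_tilesD[OF proto])
  have "\<exists>Q e. Q \<in> \<A> \<and> Q +\<^sub>t e \<in> \<omega> P" if "P \<in> \<A>" for P
    using subst_image_nonempty[OF proto prim lin that] \<omega>(2)[OF that] by (fastforce simp: translates_def)
  then obtain q e where qe: "\<And>P. P \<in> \<A> \<Longrightarrow> q P \<in> \<A>" "\<And>P. P \<in> \<A> \<Longrightarrow> q P +\<^sub>t e P \<in> \<omega> P" by metis
  obtain c where c: "\<And>P. P \<in> \<A> \<Longrightarrow> \<phi> (c P) = c (q P) + e P"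
    using solve_control_equation[where q = q and d = e, OF lin expd finA qe(1)] by blast
  have step: "\<omega> P +\<^sub>p \<phi> x \<subseteq> \<T>" if "P \<in> \<A>" "P +\<^sub>t x \<in> \<T>" for P x
    using that sub unfolding subst_def by blast
  define D where "D = {c P + x | P x. P \<in> \<A> \<and> P +\<^sub>t x \<in> \<T>}"
  have "bounded (\<Union>\<A>)" using finA proto_tilesD(2)[OF proto] by blast
  then obtain M\<^sub>0 where M\<^sub>0: "M\<^sub>0 > 0" "\<And>P u. P \<in> \<A> \<Longrightarrow> u \<in> P \<Longrightarrow> norm u \<le> M\<^sub>0"
    unfolding bounded_pos by blast
  have "bounded (c ` \<A>)" using finA by (intro finite_imp_bounded) auto
  then obtain M\<^sub>1 where M\<^sub>1: "M\<^sub>1 > 0" "\<And>P. P \<in> \<A> \<Longrightarrow> norm (c P) \<le> M\<^sub>1" unfolding bounded_pos by auto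
  have "inflation_set D \<phi>"
  proof (rule inflation_set.intro)
    show "linear \<phi>" by (rule lin)
  next
    fix x assume "x \<in> D"
    then obtain P a where P: "x = c P + a" "P \<in> \<A>" "P +\<^sub>t a \<in> \<T>" unfolding D_def by blast
    have "(q P +\<^sub>t e P) +\<^sub>t \<phi> a \<in> \<T>" using step[OF P(2,3)] qe(2)[OF P(2)] shift_tile_mem by blast
    hence "q P +\<^sub>t (e P + \<phi> a) \<in> \<T>" by (simp add: shift_tile_shift_tile)
    moreover have "\<phi> x = c (q P) + (e P + \<phi> a)" using linear_add[OF lin] c[OF P(2)] by (simp add: P(1))
    ultimately show "\<phi> x \<in> D" unfolding D_def using qe(1)[OF P(2)] by blast
  next
    show "relatively_dense D"
      unfolding relatively_dense_def
    proof (intro exI[of _ "M\<^sub>0 + M\<^sub>1 + 1"] conjI allI)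
      show "M\<^sub>0 + M\<^sub>1 + 1 > 0" using M\<^sub>0 M\<^sub>1 by simp
      fix y
      have "y \<in> closure (\<Union>\<T>)" using cover by simp
      then obtain z T where z: "z \<in> T" "T \<in> \<T>" "dist z y < 1" by (auto simp: closure_approachable dest: spec[of _ 1])
      then obtain P a where P: "P \<in> \<A>" "T = P +\<^sub>t a" using tr by (auto simp: translates_def)
      then obtain u where u: "u \<in> P" "z = u + a" using z(1) by (auto simp: shift_tile_def)
      have "c P + a \<in> D" unfolding D_def using P z(2) by blast
      moreover have "dist y (c P + a) < M\<^sub>0 + M\<^sub>1 + 1"
      proof -
        have eq: "y - (c P + a) = (u - c P) - (z - y)" by (simp add: u(2))
        have "norm (y - (c P + a)) \<le> norm u + norm (c P) + norm (z - y)"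
          unfolding eq using norm_triangle_ineq4[of "u - c P" "z - y"] norm_triangle_ineq4[of u "c P"] by linarith
        thus ?thesis using M\<^sub>0(2)[OF P(1) u(1)] M\<^sub>1(2)[OF P(1)] z(3) by (simp add: dist_norm)
      qed
      ultimately show "D \<inter> ball y (M\<^sub>0 + M\<^sub>1 + 1) \<noteq> {}" by auto
    qed
  next
    fix R :: real
    define R' where "R' = M\<^sub>0 + \<bar>R\<bar> + 2 * M\<^sub>1 + 1"
    have "R' > 0" using M\<^sub>0 M\<^sub>1 by (simp add: R'_def)
    then obtain Y where Y: "finite Y" "Y \<subseteq> {\<T> \<sqinter>\<^sub>p ball x R' | x. True}"
        "\<And>\<P>. \<P> \<in> {\<T> \<sqinter>\<^sub>p ball x R' | x. True} \<Longrightarrow> \<exists>\<Q>\<in>Y. \<exists>x. \<P> = \<Q> +\<^sub>p x"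
      using flc unfolding tiling_FLC_def finite_mod_translation_def by meson
    define cps where "cps \<Q> = {c P + s | P s. P \<in> \<A> \<and> P +\<^sub>t s \<in> \<Q>}" for \<Q>
    have fin: "finite (cps \<Q>)" if "\<Q> \<in> Y" for \<Q>
      unfolding cps_def using Y(2) that finite_patch_in_ball[OF proto patch tr]
      by (intro finite_control_points[OF proto]) auto
    have "{x - y | x y. x \<in> D \<and> y \<in> D \<and> norm (x - y) \<le> R} \<subseteq> (\<Union>\<Q>\<in>Y. (\<lambda>(s, t). s - t) ` (cps \<Q> \<times> cps \<Q>))"
    proof safe
      fix x y assume xy: "x \<in> D" "y \<in> D" "norm (x - y) \<le> R"
      obtain P a where P: "x = c P + a" "P \<in> \<A>" "P +\<^sub>t a \<in> \<T>" using xy(1) unfolding D_def by blast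
      obtain Q b where Q: "y = c Q + b" "Q \<in> \<A>" "Q +\<^sub>t b \<in> \<T>" using xy(2) unfolding D_def by blast
      have "norm (b - a) \<le> R + 2 * M\<^sub>1"
      proof -
        have eq: "b - a = (c P - c Q) - (x - y)" by (simp add: P(1) Q(1))
        have "norm (b - a) \<le> norm (c P) + norm (c Q) + norm (x - y)"
          unfolding eq using norm_triangle_ineq4[of "c P - c Q" "x - y"] norm_triangle_ineq4[of "c P" "c Q"] by linarith
        thus ?thesis using M\<^sub>1(2)[OF P(2)] M\<^sub>1(2)[OF Q(2)] xy(3) by linarith
      qed
      hence near: "P +\<^sub>t a \<subseteq> ball a R'" "Q +\<^sub>t b \<subseteq> ball a R'"
      proof -
        show "P +\<^sub>t a \<subseteq> ball a R'"
          using M\<^sub>0 M\<^sub>1(1) P(2) by (fastforce simp: shift_tile_def dist_norm R'_def)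
        show "Q +\<^sub>t b \<subseteq> ball a R'"
        proof
          fix v assume "v \<in> Q +\<^sub>t b"
          then obtain u where u: "u \<in> Q" "v = u + b" by (auto simp: shift_tile_def)
          have "norm (v - a) \<le> norm u + norm (b - a)"
            using norm_triangle_ineq[of u "b - a"] by (simp add: u(2) add_diff_eq)
          hence "norm (v - a) < R'"
            using M\<^sub>0(2)[OF Q(2) u(1)] \<open>norm (b - a) \<le> R + 2 * M\<^sub>1\<close> by (simp add: R'_def)
          thus "v \<in> ball a R'" by (simp add: dist_norm norm_minus_commute)
        qed
      qed
      obtain \<Q> v where \<Q>: "\<Q> \<in> Y" "\<T> \<sqinter>\<^sub>p ball a R' = \<Q> +\<^sub>p v" using Y(3) by blast
      have pulled: "S +\<^sub>t (s - v) \<in> \<Q>" if "S +\<^sub>t s \<in> \<T>" "S +\<^sub>t s \<subseteq> ball a R'" for S s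
      proof -
        have "S +\<^sub>t s \<in> \<Q> +\<^sub>p v" using that \<Q>(2)[symmetric] by (simp add: restrict_to_def)
        then obtain T where T: "T \<in> \<Q>" "S +\<^sub>t s = T +\<^sub>t v" by (rule shift_tiles_memE)
        have "S +\<^sub>t (s - v) = (S +\<^sub>t s) +\<^sub>t (- v)" by (simp add: shift_tile_shift_tile)
        also have "\<dots> = T" unfolding T(2) by (simp add: shift_tile_shift_tile)
        finally show ?thesis using T(1) by simp
      qed
      have "c P + (a - v) \<in> cps \<Q>" "c Q + (b - v) \<in> cps \<Q>"
        unfolding cps_def using pulled[OF P(3) near(1)] pulled[OF Q(3) near(2)] P(2) Q(2) by blast+
      moreover have "x - y = (c P + (a - v)) - (c Q + (b - v))" by (simp add: P(1) Q(1))
      ultimately show "x - y \<in> (\<Union>\<Q>\<in>Y. (\<lambda>(s, t). s - t) ` (cps \<Q> \<times> cps \<Q>))" using \<Q>(1) by force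
    qed
    thus "finite {x - y | x y. x \<in> D \<and> y \<in> D \<and> norm (x - y) \<le> R}"
      by (rule finite_subset) (use Y(1) fin in auto)
  next
    fix F assume F: "finite F" "F \<subseteq> D"
    have "\<exists>P a. x = c P + a \<and> P \<in> \<A> \<and> P +\<^sub>t a \<in> \<T>" if "x \<in> F" for x
      using F(2) that unfolding D_def by blast
    then obtain pt po where pp: "\<And>x. x \<in> F \<Longrightarrow> x = c (pt x) + po x \<and> pt x \<in> \<A> \<and> pt x +\<^sub>t po x \<in> \<T>" by metis
    define \<P> where "\<P> = (\<lambda>x. pt x +\<^sub>t po x) ` F"
    have sub_T: "\<P> \<subseteq> \<T>" using pp by (auto simp: \<P>_def)
    have "is_patch \<P>"
      unfolding is_patch_def using patch[unfolded is_patch_def] subsetD[OF sub_T] by simp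
    moreover have "finite \<P>" using F(1) by (simp add: \<P>_def)
    ultimately have "relatively_dense {v. \<P> +\<^sub>p v \<subseteq> \<T>}"
      using rep[unfolded repetitive_def, rule_format, of \<P>] sub_T by simp
    moreover have "{v. \<P> +\<^sub>p v \<subseteq> \<T>} \<subseteq> {v. (\<lambda>x. x + v) ` F \<subseteq> D}"
    proof safe
      fix v x assume v: "\<P> +\<^sub>p v \<subseteq> \<T>" and x: "x \<in> F"
      have "(pt x +\<^sub>t po x) +\<^sub>t v \<in> \<T>" using v x shift_tile_mem[of "pt x +\<^sub>t po x" \<P> v] by (auto simp: \<P>_def)
      hence "pt x +\<^sub>t (po x + v) \<in> \<T>" by (simp add: shift_tile_shift_tile)
      hence "c (pt x) + (po x + v) \<in> D" unfolding D_def using pp[OF x] by blast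
      thus "x + v \<in> D" using pp[OF x] by (metis add.assoc)
    qed
    ultimately show "relatively_dense {v. (\<lambda>x. x + v) ` F \<subseteq> D}" by (rule relatively_dense_mono)
  next
    define E where "E = (\<Union>Q\<in>\<A>. (\<lambda>s. s - \<phi> (c Q)) ` {c P + s | P s. P \<in> \<A> \<and> P +\<^sub>t s \<in> \<omega> Q})"
    have "finite E" unfolding E_def using finite_control_points[OF proto \<omega>(1)]
      by (intro finite_UN_I finA finite_imageI)
    hence "bounded E" by (rule finite_imp_bounded)
    then obtain M where M: "\<forall>z\<in>E. norm z \<le> M" unfolding bounded_iff by blast
    have "\<exists>x'\<in>D. norm (x - \<phi> x') \<le> M" if x: "x \<in> D" for x
    proof -
      obtain P a where P: "x = c P + a" "P \<in> \<A>" "P +\<^sub>t a \<in> \<T>" using x unfolding D_def by blast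
      have "P +\<^sub>t a \<in> subst \<A> \<phi> \<omega> \<T>" using P(3) sub by simp
      then obtain Q b where Q: "Q \<in> \<A>" "Q +\<^sub>t b \<in> \<T>" "P +\<^sub>t a \<in> \<omega> Q +\<^sub>p \<phi> b" unfolding subst_def by blast
      then obtain S where S: "S \<in> \<omega> Q" "P +\<^sub>t a = S +\<^sub>t \<phi> b" by (auto elim: shift_tiles_memE)
      then obtain P' s where P': "P' \<in> \<A>" "S = P' +\<^sub>t s" using \<omega>(2)[OF Q(1)] by (auto simp: translates_def)
      have "P +\<^sub>t a = P' +\<^sub>t (s + \<phi> b)" using S(2) P'(2) by (simp add: shift_tile_shift_tile)
      hence eq: "P = P'" "a = s + \<phi> b" using shift_tile_unique[OF proto P(2) P'(1)] by blast+
      have "x - \<phi> (c Q + b) = (c P + s) - \<phi> (c Q)" using linear_add[OF lin] by (simp add: P(1) eq(2))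
      moreover have "(c P + s) - \<phi> (c Q) \<in> E" unfolding E_def using Q(1) S(1) P' eq(1) by blast
      ultimately have "norm (x - \<phi> (c Q + b)) \<le> M" using M by metis
      moreover have "c Q + b \<in> D" unfolding D_def using Q by blast
      ultimately show ?thesis by blast
    qed
    thus "\<exists>M. \<forall>x\<in>D. \<exists>x'\<in>D. norm (x - \<phi> x') \<le> M" by blast
  next
    show "\<exists>C>0. \<exists>r>0. r < 1 \<and> (\<forall>n x. norm x \<le> C * r ^ n * norm ((\<phi> ^^ n) x))" using expd by blast
  qed
  thus ?thesis using that unfolding D_def by blast
qed

section \<open>Irreducible rational polynomials and Lagrange interpolation at their roots\<close>

abbreviation cpoly :: "rat poly \<Rightarrow> complex poly" where
  "cpoly \<equiv> map_poly of_rat"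

lemma cpoly_pCons: "cpoly (pCons a p) = pCons (of_rat a) (cpoly p)"
  by (simp add: map_poly_pCons)

lemma cpoly_add: "cpoly (p + q) = cpoly p + cpoly q"
  by (rule poly_eqI) (simp add: coeff_map_poly of_rat_add)

lemma cpoly_diff: "cpoly (p - q) = cpoly p - cpoly q"
  by (rule poly_eqI) (simp add: coeff_map_poly of_rat_diff)

lemma cpoly_smult: "cpoly (smult c p) = smult (of_rat c) (cpoly p)"
  by (rule poly_eqI) (simp add: coeff_map_poly of_rat_mult)

lemma cpoly_mult: "cpoly (p * q) = cpoly p * cpoly q"
  by (induction p) (simp_all add: cpoly_add cpoly_smult cpoly_pCons)

lemma cpoly_pderiv: "cpoly (pderiv p) = pderiv (cpoly p)"
  by (rule poly_eqI) (simp add: coeff_map_poly coeff_pderiv of_rat_mult of_rat_add)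

lemma degree_cpoly [simp]: "degree (cpoly p) = degree p"
  by (rule degree_map_poly) simp

lemma cpoly_eq_0_iff [simp]: "cpoly p = 0 \<longleftrightarrow> p = 0"
  by (auto simp: poly_eq_iff coeff_map_poly)

text \<open>
  By division with remainder, a nonzero rational polynomial of least degree that vanishes at \<open>\<nu>\<close> divides
  both \<open>p\<close> and \<open>q\<close>; as \<open>p\<close> is irreducible, it is \<open>p\<close> up to a unit.
\<close>
lemma irreducible_dvd_if_common_root:
  assumes "irreducible p" "poly (cpoly p) \<nu> = 0" "poly (cpoly q) \<nu> = 0"
  shows "p dvd q"
proof -
  have "p \<noteq> 0" using assms(1) by auto
  then obtain f where f: "f \<noteq> 0" "poly (cpoly f) \<nu> = 0"
      and least: "\<And>g. g \<noteq> 0 \<Longrightarrow> poly (cpoly g) \<nu> = 0 \<Longrightarrow> degree f \<le> degree g"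
    using ex_has_least_nat[of "\<lambda>f. f \<noteq> 0 \<and> poly (cpoly f) \<nu> = 0" p degree] assms(2) by blast
  have f_dvd: "f dvd g" if g: "poly (cpoly g) \<nu> = 0" for g
  proof -
    have "poly (cpoly ((g div f) * f + g mod f)) \<nu> = 0" using g by simp
    hence root: "poly (cpoly (g mod f)) \<nu> = 0" unfolding cpoly_add cpoly_mult using f(2) by simp
    have "g mod f = 0"
    proof (rule ccontr)
      assume nz: "g mod f \<noteq> 0"
      have "degree f \<le> degree (g mod f)" by (rule least[OF nz root])
      thus False using degree_mod_less[OF f(1), of g] nz by simp
    qed
    thus ?thesis by (rule mod_0_imp_dvd)
  qed
  have "\<not> is_unit f"
  proof
    assume "is_unit f"
    then obtain h where "1 = f * h" by (rule dvdE)
    hence "cpoly 1 = cpoly f * cpoly h" by (simp add: cpoly_mult[symmetric])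
    hence "poly (cpoly f * cpoly h) \<nu> = 1" by simp
    thus False using f(2) by simp
  qed
  hence "p dvd f" using irreducibleD'[OF assms(1) f_dvd[OF assms(2)]] by blast
  thus ?thesis using f_dvd[OF assms(3)] by (rule dvd_trans)
qed

lemma conjugate_root:
  assumes "irreducible p" "poly (cpoly p) \<mu> = 0" "poly (cpoly p) \<nu> = 0" "poly (cpoly q) \<mu> = 0"
  shows "poly (cpoly q) \<nu> = 0"
  using irreducible_dvd_if_common_root[OF assms(1,2,4)] assms(3) by (auto simp: dvd_def cpoly_mult)

lemma irreducible_simple_root:
  assumes "irreducible p" "poly (cpoly p) \<nu> = 0"
  shows "poly (pderiv (cpoly p)) \<nu> \<noteq> 0"
proof
  assume "poly (pderiv (cpoly p)) \<nu> = 0"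
  hence "poly (cpoly (pderiv p)) \<nu> = 0" by (simp add: cpoly_pderiv)
  hence dvd: "p dvd pderiv p" by (rule irreducible_dvd_if_common_root[OF assms])
  have p0: "p \<noteq> 0" using assms(1) by auto
  have deg: "degree p \<noteq> 0"
  proof
    assume "degree p = 0"
    then obtain c where "p = [:c:]" by (rule degree_eq_zeroE)
    thus False using assms(2) p0 by (simp add: cpoly_pCons)
  qed
  hence "pderiv p \<noteq> 0" by (simp add: pderiv_eq_0_iff)
  hence "degree p \<le> degree (pderiv p)" using dvd by (intro dvd_imp_degree_le)
  thus False using deg by (simp add: degree_pderiv)
qed

lemma irreducible_card_roots:
  assumes "irreducible p"
  shows "card {\<nu>. poly (cpoly p) \<nu> = 0} = degree p"
proof -
  have p0: "cpoly p \<noteq> 0" using assms by auto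
  have "order \<nu> (cpoly p) = 1" if "poly (cpoly p) \<nu> = 0" for \<nu>
    using order_pderiv[OF p0 that] irreducible_simple_root[OF assms that] by (simp add: order_0I)
  hence "size (proots (cpoly p)) = (\<Sum>\<nu> | poly (cpoly p) \<nu> = 0. 1)"
    using p0 by (simp add: size_multiset_overloaded_eq)
  thus ?thesis by (simp add: size_proots_complex)
qed

text \<open>
  The polynomial \<open>p / (X - \<nu>)\<close> divided by its value at \<open>\<nu>\<close>, for a root \<open>\<nu>\<close> of \<open>p\<close>.  Evaluated at a
  diagonalizable map annihilated by \<open>p\<close>, it is the projection onto the eigenspace of \<open>\<nu>\<close>.
\<close>
definition lagrange :: "rat poly \<Rightarrow> complex \<Rightarrow> complex poly" where
  "lagrange p \<nu> = smult (1 / poly (pderiv (cpoly p)) \<nu>) (synthetic_div (cpoly p) \<nu>)"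

text \<open>
  Modulo \<open>p\<close>, multiplication of the Lagrange polynomial by \<open>X\<close> is multiplication by \<open>\<nu>\<close>.
\<close>
lemma lagrange_shift:
  assumes "poly (cpoly p) \<nu> = 0"
  shows "pCons 0 (lagrange p \<nu>) = smult \<nu> (lagrange p \<nu>) + smult (1 / poly (pderiv (cpoly p)) \<nu>) (cpoly p)"
proof -
  let ?c = "1 / poly (pderiv (cpoly p)) \<nu>" and ?s = "synthetic_div (cpoly p) \<nu>"
  have "pCons 0 (smult ?c ?s) = smult ?c (pCons 0 ?s)" by simp
  also have "pCons 0 ?s = cpoly p + smult \<nu> ?s" using synthetic_div_correct[of "cpoly p" \<nu>] assms by simp
  finally show ?thesis by (simp add: lagrange_def smult_add_right mult.commute)
qed

lemma degree_lagrange: "degree (lagrange p \<nu>) \<le> degree p - 1"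
  unfolding lagrange_def by (rule order_trans[OF degree_smult_le]) (simp add: degree_synthetic_div)

lemma poly_lagrange:
  assumes "irreducible p" "poly (cpoly p) \<nu> = 0" "poly (cpoly p) \<mu> = 0"
  shows "poly (lagrange p \<nu>) \<mu> = (if \<mu> = \<nu> then 1 else 0)"
proof -
  let ?s = "synthetic_div (cpoly p) \<nu>"
  have fac: "cpoly p = [:-\<nu>, 1:] * ?s" using synthetic_div_correct'[of \<nu> "cpoly p"] assms(2) by simp
  have "poly (cpoly p) \<mu> = (\<mu> - \<nu>) * poly ?s \<mu>" by (subst fac) (simp add: algebra_simps)
  hence "poly ?s \<mu> = 0" if "\<mu> \<noteq> \<nu>" using that assms(3) by simp
  moreover have "poly (pderiv (cpoly p)) \<nu> = poly ?s \<nu>"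
    by (subst fac, subst pderiv_mult) (simp add: pderiv_pCons)
  ultimately show ?thesis using irreducible_simple_root[OF assms(1,2)] by (simp add: lagrange_def)
qed

lemma sum_lagrange:
  assumes "irreducible p"
  shows "(\<Sum>\<nu> | poly (cpoly p) \<nu> = 0. lagrange p \<nu>) = 1"
proof -
  let ?Z = "{\<nu>. poly (cpoly p) \<nu> = 0}"
  define r where "r = (\<Sum>\<nu>\<in>?Z. lagrange p \<nu>) - 1"
  have p0: "cpoly p \<noteq> 0" using assms by auto
  have fin: "finite ?Z" using p0 by (rule poly_roots_finite)
  have "r = 0"
  proof (rule ccontr)
    assume r0: "r \<noteq> 0"
    have "degree (\<Sum>\<nu>\<in>?Z. lagrange p \<nu>) \<le> degree p - 1"
      by (rule degree_sum_le[OF fin]) (rule degree_lagrange)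
    hence deg: "degree r \<le> degree p - 1" unfolding r_def by (intro degree_diff_le) auto
    have "poly r \<mu> = 0" if "\<mu> \<in> ?Z" for \<mu>
    proof -
      have "(\<Sum>\<nu>\<in>?Z. poly (lagrange p \<nu>) \<mu>) = (\<Sum>\<nu>\<in>?Z. if \<mu> = \<nu> then 1 else 0)"
        using that by (intro sum.cong) (auto simp: poly_lagrange[OF assms])
      also have "\<dots> = 1" using fin that by simp
      finally show ?thesis by (simp add: r_def poly_sum)
    qed
    hence "?Z \<subseteq> {x. poly r x = 0}" by blast
    hence "card ?Z \<le> card {x. poly r x = 0}" by (intro card_mono poly_roots_finite r0)
    also have "\<dots> \<le> degree r" by (rule card_poly_roots_bound[OF r0])
    finally have le: "degree p \<le> degree p - 1" using deg irreducible_card_roots[OF assms] by simp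
    hence "degree p = 0" by simp
    then obtain c where "p = [:c:]" by (rule degree_eq_zeroE)
    moreover from this have "c \<noteq> 0" using assms by auto
    ultimately show False using assms by (auto simp: irreducible_def is_unit_const_poly_iff dvd_field_iff)
  qed
  thus ?thesis by (simp add: r_def)
qed

text \<open>
  The coefficients of \<open>p / (X - \<nu>)\<close> are polynomials in \<open>\<nu>\<close> with rational coefficients, which are
  moreover the same for all \<open>\<nu>\<close>.
\<close>
lemma coeffs_synthetic_div_rational:
  "\<exists>T. \<forall>\<nu>. (\<Sum>k\<le>N. coeff (synthetic_div (cpoly p) \<nu>) k * of_rat (\<tau> k)) = poly (cpoly T) \<nu>"
proof (induction p arbitrary: \<tau> N)
  case 0
  show ?case by (rule exI[of _ 0]) simp
next
  case (pCons a p)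
  show ?case
  proof (cases N)
    case 0
    show ?thesis by (rule exI[of _ "smult (\<tau> 0) p"]) (simp add: 0 cpoly_pCons cpoly_smult)
  next
    case (Suc M)
    obtain T where T: "\<And>\<nu>. (\<Sum>k\<le>M. coeff (synthetic_div (cpoly p) \<nu>) k * of_rat (\<tau> (Suc k))) = poly (cpoly T) \<nu>"
      using pCons.IH[of "\<lambda>k. \<tau> (Suc k)" M] by auto
    show ?thesis
      by (rule exI[of _ "smult (\<tau> 0) p + T"])
        (simp add: Suc cpoly_pCons cpoly_smult cpoly_add sum.atMost_Suc_shift T del: sum.atMost_Suc)
  qed
qed

section \<open>Rank and trace of idempotent matrices\<close>

interpretation fun_space: vector_space "\<lambda>(c::complex) (f :: 'b \<Rightarrow> complex) x. c * f x"
  by unfold_locales (auto simp: algebra_simps fun_eq_iff)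

lemma sum_fun_apply: "(\<Sum>i\<in>I. f i) x = (\<Sum>i\<in>I. f i x)" for f :: "'i \<Rightarrow> 'b \<Rightarrow> 'c::comm_monoid_add"
  by (induction I rule: infinite_finite_induct) auto

text \<open>
  The trace of an idempotent is its rank: if \<open>P = \<alpha> e\<close> with independent rows \<open>e\<close> fixed by \<open>P\<close>,
  then \<open>e \<alpha>\<close> is the identity matrix, and \<open>\<alpha> e\<close> has the same trace.
\<close>
lemma trace_eq_card_basis:
  fixes P :: "'b \<Rightarrow> 'b \<Rightarrow> complex" and e :: "'i \<Rightarrow> 'b \<Rightarrow> complex"
  assumes fin: "finite I" "finite B"
    and fixd: "\<And>l j. l \<in> I \<Longrightarrow> j \<in> B \<Longrightarrow> (\<Sum>i\<in>B. e l i * P i j) = e l j"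
    and indep: "\<And>c. (\<And>j. j \<in> B \<Longrightarrow> (\<Sum>l\<in>I. c l * e l j) = 0) \<Longrightarrow> \<forall>l\<in>I. c l = 0"
    and rows: "\<And>i. i \<in> B \<Longrightarrow> \<exists>\<alpha>. \<forall>j\<in>B. P i j = (\<Sum>l\<in>I. \<alpha> l * e l j)"
  shows "(\<Sum>i\<in>B. P i i) = of_nat (card I)"
proof -
  obtain \<alpha> where \<alpha>: "\<And>i j. i \<in> B \<Longrightarrow> j \<in> B \<Longrightarrow> P i j = (\<Sum>l\<in>I. \<alpha> i l * e l j)"
    using rows by metis
  have dual: "(\<Sum>i\<in>B. e l i * \<alpha> i m) = (if l = m then 1 else 0)" if l: "l \<in> I" and m: "m \<in> I" for l m
  proof -
    define c where "c m = (\<Sum>i\<in>B. e l i * \<alpha> i m) - (if l = m then 1 else 0)" for m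
    have "(\<Sum>m\<in>I. c m * e m j) = 0" if j: "j \<in> B" for j
    proof -
      have "(\<Sum>m\<in>I. c m * e m j) = (\<Sum>m\<in>I. \<Sum>i\<in>B. e l i * \<alpha> i m * e m j) - (\<Sum>m\<in>I. if l = m then e m j else 0)"
        unfolding c_def by (simp add: left_diff_distrib sum_subtractf sum_distrib_right if_distrib[of "\<lambda>x. x * _"] cong: if_cong)
      also have "(\<Sum>m\<in>I. if l = m then e m j else 0) = e l j" using l fin by simp
      also have "(\<Sum>m\<in>I. \<Sum>i\<in>B. e l i * \<alpha> i m * e m j) = (\<Sum>i\<in>B. e l i * (\<Sum>m\<in>I. \<alpha> i m * e m j))"
        by (subst sum.swap) (simp add: sum_distrib_left mult.assoc)
      also have "\<dots> = (\<Sum>i\<in>B. e l i * P i j)" using \<alpha> j by (intro sum.cong) auto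
      finally show ?thesis using fixd[OF l j] by simp
    qed
    hence "c m = 0" using indep[of c] m by blast
    thus ?thesis by (simp add: c_def)
  qed
  have "(\<Sum>i\<in>B. P i i) = (\<Sum>i\<in>B. \<Sum>l\<in>I. e l i * \<alpha> i l)"
    using \<alpha> by (intro sum.cong) (auto simp: mult.commute)
  also have "\<dots> = (\<Sum>l\<in>I. \<Sum>i\<in>B. e l i * \<alpha> i l)" by (rule sum.swap)
  also have "\<dots> = (\<Sum>l\<in>I. 1)" by (intro sum.cong refl) (simp add: dual)
  finally show ?thesis by simp
qed

text \<open>
  Extend the vectors \<open>e\<close> to a basis of the row space.  The cardinality of the basis is the trace,
  which is the number of the vectors \<open>e\<close>; so nothing was added.
\<close>
lemma fixed_vectors_span_rows:
  fixes P :: "'b \<Rightarrow> 'b \<Rightarrow> complex" and e :: "'i \<Rightarrow> 'b \<Rightarrow> complex"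
  assumes fin: "finite I" "finite B"
    and idem: "\<And>i j. i \<in> B \<Longrightarrow> j \<in> B \<Longrightarrow> (\<Sum>k\<in>B. P i k * P k j) = P i j"
    and fixd: "\<And>l j. l \<in> I \<Longrightarrow> j \<in> B \<Longrightarrow> (\<Sum>i\<in>B. e l i * P i j) = e l j"
    and indep: "\<And>c. (\<And>j. j \<in> B \<Longrightarrow> (\<Sum>l\<in>I. c l * e l j) = 0) \<Longrightarrow> \<forall>l\<in>I. c l = 0"
    and trace: "(\<Sum>i\<in>B. P i i) = of_nat (card I)"
    and i: "i \<in> B"
  shows "\<exists>\<alpha>. \<forall>j\<in>B. P i j = (\<Sum>l\<in>I. \<alpha> l * e l j)"
proof -
  (* Vectors indexed by B are represented by functions that vanish outside B. *)
  define r where "r i = (\<lambda>j. if j \<in> B then P i j else 0)" for i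
  define f where "f l = (\<lambda>j. if j \<in> B then e l j else 0)" for l
  have inj: "inj_on f I"
  proof (rule inj_onI, rule ccontr)
    fix l m assume lm: "l \<in> I" "m \<in> I" "f l = f m" "l \<noteq> m"
    define c :: "'i \<Rightarrow> complex" where "c k = (if k = l then 1 else if k = m then -1 else 0)" for k
    have "(\<Sum>k\<in>I. c k * e k j) = 0" if "j \<in> B" for j
    proof -
      have "(\<Sum>k\<in>I. c k * e k j) = (\<Sum>k\<in>{l,m}. c k * e k j)"
        using fin lm by (intro sum.mono_neutral_right) (auto simp: c_def)
      also have "\<dots> = e l j - e m j" using lm by (simp add: c_def)
      also have "\<dots> = 0" using fun_cong[OF lm(3), of j] that by (simp add: f_def)
      finally show ?thesis .
    qed
    hence "c l = 0" using indep[of c] lm(1) by blast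
    thus False by (simp add: c_def)
  qed
  have ind_f: "fun_space.independent (f ` I)"
  proof (rule fun_space.independent_if_scalars_zero)
    show "finite (f ` I)" using fin by simp
  next
    fix u v assume sum: "(\<Sum>v\<in>f ` I. (\<lambda>x. u v * v x)) = 0" and v: "v \<in> f ` I"
    have "(\<Sum>l\<in>I. u (f l) * e l j) = 0" if j: "j \<in> B" for j
    proof -
      have "(\<Sum>l\<in>I. u (f l) * e l j) = (\<Sum>l\<in>I. u (f l) * f l j)" using j by (simp add: f_def)
      also have "\<dots> = (\<Sum>v\<in>f ` I. (\<lambda>x. u v * v x)) j" by (simp add: sum_fun_apply sum.reindex[OF inj])
      finally show ?thesis using sum by simp
    qed
    hence "\<forall>l\<in>I. u (f l) = 0" using indep[of "\<lambda>l. u (f l)"] by blast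
    thus "u v = 0" using v by auto
  qed
  have span_rows: "x \<in> fun_space.span (r ` B) \<Longrightarrow>
      (\<forall>j. (\<Sum>k\<in>B. x k * r k j) = x j) \<and> (\<forall>j. j \<notin> B \<longrightarrow> x j = 0)" for x
  proof (induction rule: fun_space.span_induct)
    case base
    show ?case
      unfolding fun_space.subspace_def
      by (auto simp: distrib_right sum.distrib mult.assoc sum_distrib_left[symmetric])
  next
    case (step x)
    then obtain i where i: "i \<in> B" "x = r i" by blast
    have "(\<Sum>k\<in>B. r i k * r k j) = r i j" for j
    proof (cases "j \<in> B")
      case True
      have "(\<Sum>k\<in>B. r i k * r k j) = (\<Sum>k\<in>B. P i k * P k j)" using True by (intro sum.cong) (auto simp: r_def)
      thus ?thesis using idem[OF i(1) True] True by (simp add: r_def)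
    qed (simp add: r_def)
    thus ?case by (auto simp: i r_def)
  qed
  have f_span: "f ` I \<subseteq> fun_space.span (r ` B)"
  proof
    fix v assume "v \<in> f ` I"
    then obtain l where l: "l \<in> I" "v = f l" by blast
    have "f l = (\<Sum>i\<in>B. (\<lambda>x. e l i * r i x))"
    proof
      fix j show "f l j = (\<Sum>i\<in>B. (\<lambda>x. e l i * r i x)) j"
        using fixd[OF l(1), of j] by (cases "j \<in> B") (auto simp: f_def r_def sum_fun_apply)
    qed
    also have "\<dots> \<in> fun_space.span (r ` B)"
      by (intro fun_space.span_sum fun_space.span_scale fun_space.span_base) auto
    finally show "v \<in> fun_space.span (r ` B)" using l by simp
  qed
  obtain S where S: "f ` I \<subseteq> S" "S \<subseteq> fun_space.span (r ` B)" "fun_space.independent S"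
      "fun_space.span (r ` B) \<subseteq> fun_space.span S"
    using fun_space.maximal_independent_subset_extend[OF f_span ind_f] by blast
  have finS: "finite S" using fun_space.independent_span_bound[OF _ S(3,2)] fin by simp
  have rep: "\<exists>\<alpha>. \<forall>j\<in>B. P i j = (\<Sum>v\<in>S'. \<alpha> v * v j)"
    if i: "i \<in> B" and S': "finite S'" "r i \<in> fun_space.span S'" for i S'
  proof -
    obtain \<alpha> where \<alpha>: "r i = (\<Sum>v\<in>S'. (\<lambda>x. \<alpha> v * v x))"
      using S'(2) unfolding fun_space.span_finite[OF S'(1)] by blast
    have "P i j = (\<Sum>v\<in>S'. \<alpha> v * v j)" if "j \<in> B" for j
      using fun_cong[OF \<alpha>, of j] that by (simp add: r_def sum_fun_apply)
    thus ?thesis by blast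
  qed
  have "(\<Sum>i\<in>B. P i i) = of_nat (card S)"
  proof (rule trace_eq_card_basis[where e = "\<lambda>v. v" and P = P and B = B and I = S])
    show "(\<Sum>i\<in>B. v i * P i j) = v j" if "v \<in> S" "j \<in> B" for v j
    proof -
      have "(\<Sum>i\<in>B. v i * P i j) = (\<Sum>i\<in>B. v i * r i j)" using that by (intro sum.cong) (auto simp: r_def)
      thus ?thesis using span_rows[of v] S(2) that(1) by auto
    qed
    show "\<forall>v\<in>S. c v = 0" if c: "\<And>j. j \<in> B \<Longrightarrow> (\<Sum>v\<in>S. c v * v j) = 0" for c
    proof -
      have "(\<Sum>v\<in>S. (\<lambda>x. c v * v x)) = 0"
      proof
        fix j
        have "v j = 0" if "v \<in> S" "j \<notin> B" for v using span_rows[of v] S(2) that by auto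
        thus "(\<Sum>v\<in>S. (\<lambda>x. c v * v x)) j = 0 j"
          using c[of j] by (cases "j \<in> B") (auto simp: sum_fun_apply intro!: sum.neutral)
      qed
      thus ?thesis using fun_space.independentD[OF S(3) finS order_refl] by blast
    qed
    show "\<exists>\<alpha>. \<forall>j\<in>B. P i j = (\<Sum>l\<in>S. \<alpha> l * l j)" if "i \<in> B" for i
      using rep[OF that finS] S(4) fun_space.span_base[of "r i" "r ` B"] that by blast
  qed (use finS fin in auto)
  hence "card S = card (f ` I)" using trace card_image[OF inj] by simp
  hence "f ` I = S" using S(1) finS by (intro card_subset_eq) auto
  then obtain \<alpha> where \<alpha>: "\<forall>j\<in>B. P i j = (\<Sum>v\<in>f ` I. \<alpha> v * v j)"
    using rep[OF i finS] S(4) fun_space.span_base[of "r i" "r ` B"] i by blast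
  have "P i j = (\<Sum>l\<in>I. \<alpha> (f l) * e l j)" if "j \<in> B" for j
    using \<alpha> that by (simp add: sum.reindex[OF inj]) (simp add: f_def)
  thus ?thesis by (intro exI[of _ "\<lambda>l. \<alpha> (f l)"]) blast
qed

section \<open>Spectral decomposition of rational coordinates\<close>

interpretation rat_space: vector_space "\<lambda>(r::rat) (x::'v::real_vector). of_rat r *\<^sub>R x"
  by unfold_locales (simp_all add: algebra_simps of_rat_add of_rat_mult)

text \<open>
  A rational subspace of finite dimension, given by a basis \<open>B\<close>, on which \<open>\<phi>\<close> acts and is annihilated
  by an irreducible polynomial \<open>p\<close>.  The basis need not be linearly independent over the reals.
\<close>
locale rational_action =
  fixes B :: "'v::real_vector set" and \<phi> :: "'v \<Rightarrow> 'v" and p :: "rat poly"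
  assumes finite_B: "finite B"
    and independent_B: "rat_space.independent B"
    and linear_action: "linear \<phi>"
    and phi_B: "b \<in> B \<Longrightarrow> \<phi> b \<in> rat_space.span B"
    and irreducible_p: "irreducible p"
    and annihilates: "x \<in> rat_space.span B \<Longrightarrow> (\<Sum>k\<le>degree p. of_rat (coeff p k) *\<^sub>R (\<phi> ^^ k) x) = 0"
begin

definition V :: "'v set" where "V = rat_space.span B"

definition coord :: "'v \<Rightarrow> 'v \<Rightarrow> rat" where "coord b x = rat_space.representation B x b"

definition rat_linear :: "('v \<Rightarrow> complex) \<Rightarrow> bool" where
  "rat_linear e \<longleftrightarrow> (\<forall>x\<in>V. \<forall>y\<in>V. e (x + y) = e x + e y) \<and> (\<forall>r. \<forall>x\<in>V. e (of_rat r *\<^sub>R x) = of_rat r * e x)"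

lemma V_scale: "x \<in> V \<Longrightarrow> of_rat r *\<^sub>R x \<in> V"
  unfolding V_def by (rule rat_space.span_scale)

lemma V_sum: "(\<And>i. i \<in> I \<Longrightarrow> f i \<in> V) \<Longrightarrow> (\<Sum>i\<in>I. f i) \<in> V"
  unfolding V_def by (rule rat_space.span_sum)

lemma B_subset_V: "B \<subseteq> V"
  unfolding V_def by (rule rat_space.span_superset)

lemma coord_add: "x \<in> V \<Longrightarrow> y \<in> V \<Longrightarrow> coord b (x + y) = coord b x + coord b y"
  unfolding coord_def V_def by (simp add: rat_space.representation_add independent_B)

lemma coord_scale: "x \<in> V \<Longrightarrow> coord b (of_rat r *\<^sub>R x) = r * coord b x"
  unfolding coord_def V_def by (simp add: rat_space.representation_scale independent_B)

lemma coord_sum: "(\<And>i. i \<in> I \<Longrightarrow> f i \<in> V) \<Longrightarrow> coord b (\<Sum>i\<in>I. f i) = (\<Sum>i\<in>I. coord b (f i))"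
  unfolding coord_def V_def by (simp add: rat_space.representation_sum independent_B)

lemma coord_expand: "x \<in> V \<Longrightarrow> (\<Sum>b\<in>B. of_rat (coord b x) *\<^sub>R b) = x"
  unfolding coord_def V_def by (rule rat_space.sum_representation_eq[OF independent_B _ finite_B order_refl])

lemma coord_zero: "coord b 0 = 0"
  unfolding coord_def by (simp add: rat_space.representation_zero)

lemma rat_linear_sum:
  assumes "rat_linear e" "finite I" "\<And>i. i \<in> I \<Longrightarrow> f i \<in> V"
  shows "e (\<Sum>i\<in>I. of_rat (r i) *\<^sub>R f i) = (\<Sum>i\<in>I. of_rat (r i) * e (f i))"
  using assms(2,3)
proof (induction I rule: finite_induct)
  case empty
  have "(0::'v) \<in> V" unfolding V_def by (rule rat_space.span_zero)
  hence "e (0 + 0) = e 0 + e 0" using assms(1) unfolding rat_linear_def by blast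
  thus ?case by simp
next
  case (insert i I)
  have "e (of_rat (r i) *\<^sub>R f i + (\<Sum>i\<in>I. of_rat (r i) *\<^sub>R f i)) =
      e (of_rat (r i) *\<^sub>R f i) + e (\<Sum>i\<in>I. of_rat (r i) *\<^sub>R f i)"
    using assms(1) insert.prems unfolding rat_linear_def by (blast intro: V_scale V_sum)
  moreover have "e (of_rat (r i) *\<^sub>R f i) = of_rat (r i) * e (f i)"
    using assms(1) insert.prems unfolding rat_linear_def by blast
  ultimately show ?case using insert by simp
qed

lemma rat_linear_expand:
  assumes "rat_linear e" "x \<in> V"
  shows "e x = (\<Sum>b\<in>B. of_rat (coord b x) * e b)"
proof -
  have "e (\<Sum>b\<in>B. of_rat (coord b x) *\<^sub>R b) = (\<Sum>b\<in>B. of_rat (coord b x) * e b)"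
    using B_subset_V by (intro rat_linear_sum assms finite_B) auto
  thus ?thesis by (simp add: coord_expand[OF assms(2)])
qed

lemma phi_V: "x \<in> V \<Longrightarrow> \<phi> x \<in> V"
proof -
  assume x: "x \<in> V"
  have "\<phi> x = \<phi> (\<Sum>b\<in>B. of_rat (coord b x) *\<^sub>R b)" by (simp add: coord_expand[OF x])
  also have "\<dots> = (\<Sum>b\<in>B. of_rat (coord b x) *\<^sub>R \<phi> b)"
    using linear_action by (simp add: linear_sum linear_scale)
  also have "\<dots> \<in> V" using phi_B by (intro V_sum V_scale) (auto simp: V_def)
  finally show ?thesis .
qed

lemma phi_pow_V: "x \<in> V \<Longrightarrow> (\<phi> ^^ n) x \<in> V"
  by (induction n) (auto intro: phi_V)

lemma annihilates_coord:
  assumes "x \<in> V"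
  shows "(\<Sum>k\<le>degree p. coeff (cpoly p) k * of_rat (coord b ((\<phi> ^^ k) x))) = 0"
proof -
  have "(\<Sum>k\<le>degree p. coeff p k * coord b ((\<phi> ^^ k) x)) =
      coord b (\<Sum>k\<le>degree p. of_rat (coeff p k) *\<^sub>R (\<phi> ^^ k) x)"
    using assms by (simp add: coord_sum coord_scale V_scale phi_pow_V)
  also have "\<dots> = 0" using annihilates[of x] assms by (simp add: V_def coord_zero)
  finally have "of_rat (\<Sum>k\<le>degree p. coeff p k * coord b ((\<phi> ^^ k) x)) = (0::complex)" by simp
  thus ?thesis by (simp add: of_rat_sum of_rat_mult coeff_map_poly)
qed

text \<open>
  The spectral component for \<open>\<nu>\<close> of the coordinate \<open>coord b\<close>: this form composed with the Lagrange
  polynomial at \<open>\<phi>\<close>.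
\<close>
definition component :: "complex \<Rightarrow> 'v \<Rightarrow> 'v \<Rightarrow> complex" where
  "component \<nu> b x = (\<Sum>k\<le>degree p. coeff (lagrange p \<nu>) k * of_rat (coord b ((\<phi> ^^ k) x)))"

lemma component_rat_linear: "rat_linear (component \<nu> b)"
  by (simp add: rat_linear_def component_def linear_add[OF linear_funpow[OF linear_action]] linear_scale[OF linear_funpow[OF linear_action]]
      coord_add coord_scale phi_pow_V of_rat_add of_rat_mult distrib_left sum.distrib sum_distrib_left mult_ac)

lemma component_equivariant:
  assumes "poly (cpoly p) \<nu> = 0" "x \<in> V"
  shows "component \<nu> b (\<phi> x) = \<nu> * component \<nu> b x"
proof -
  let ?L = "lagrange p \<nu>" and ?a = "\<lambda>k. of_rat (coord b ((\<phi> ^^ k) x)) :: complex"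
  let ?c = "1 / poly (pderiv (cpoly p)) \<nu>"
  have "component \<nu> b (\<phi> x) = (\<Sum>k\<le>degree p. coeff (pCons 0 ?L) (Suc k) * ?a (Suc k))"
    unfolding component_def by (simp add: funpow_swap1)
  also have "\<dots> = (\<Sum>k\<le>Suc (degree p). coeff (pCons 0 ?L) k * ?a k)"
    by (subst sum.atMost_Suc_shift) simp
  also have "\<dots> = (\<Sum>k\<le>Suc (degree p). \<nu> * (coeff ?L k * ?a k) + ?c * (coeff (cpoly p) k * ?a k))"
    unfolding lagrange_shift[OF assms(1)] by (simp add: algebra_simps)
  also have "\<dots> = (\<Sum>k\<le>degree p. \<nu> * (coeff ?L k * ?a k) + ?c * (coeff (cpoly p) k * ?a k))"
    using degree_lagrange[of p \<nu>] by (simp add: coeff_eq_0)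
  also have "\<dots> = \<nu> * component \<nu> b x + ?c * (\<Sum>k\<le>degree p. coeff (cpoly p) k * ?a k)"
    by (simp add: component_def sum.distrib sum_distrib_left)
  finally show ?thesis using annihilates_coord[OF assms(2), of b] by simp
qed

lemma component_sum:
  assumes "x \<in> V"
  shows "(\<Sum>\<nu> | poly (cpoly p) \<nu> = 0. component \<nu> b x) = of_rat (coord b x)"
proof -
  let ?Z = "{\<nu>. poly (cpoly p) \<nu> = 0}"
  have "(\<Sum>\<nu>\<in>?Z. component \<nu> b x) =
      (\<Sum>k\<le>degree p. coeff (\<Sum>\<nu>\<in>?Z. lagrange p \<nu>) k * of_rat (coord b ((\<phi> ^^ k) x)))"
    unfolding component_def by (subst sum.swap) (simp add: coeff_sum sum_distrib_right)
  also have "\<dots> = (\<Sum>k\<le>degree p. if k = 0 then of_rat (coord b x) else 0)"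
    unfolding sum_lagrange[OF irreducible_p] by (intro sum.cong) auto
  finally show ?thesis by simp
qed

text \<open>
  Expand \<open>e\<close> in rational coordinates and pull the Lagrange polynomial, evaluated at \<open>\<phi>\<close>, out of \<open>e\<close>.
  For \<open>\<mu> = \<nu>\<close> the components thus reproduce \<open>e\<close>; for another root \<open>\<mu>\<close> the sum vanishes.
\<close>
lemma reproduce:
  assumes e: "rat_linear e" and eig: "\<And>x. x \<in> V \<Longrightarrow> e (\<phi> x) = \<mu> * e x" and x: "x \<in> V"
  shows "(\<Sum>b\<in>B. e b * component \<nu> b x) = poly (lagrange p \<nu>) \<mu> * e x"
proof -
  have pow: "e ((\<phi> ^^ k) x) = \<mu> ^ k * e x" for k
    by (induction k) (use x in \<open>auto simp: eig phi_pow_V\<close>)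
  have "(\<Sum>b\<in>B. e b * component \<nu> b x) =
      (\<Sum>k\<le>degree p. coeff (lagrange p \<nu>) k * (\<Sum>b\<in>B. of_rat (coord b ((\<phi> ^^ k) x)) * e b))"
    unfolding component_def sum_distrib_left by (subst sum.swap) (simp add: mult_ac)
  also have "\<dots> = (\<Sum>k\<le>degree p. coeff (lagrange p \<nu>) k * \<mu> ^ k) * e x"
    using rat_linear_expand[OF e phi_pow_V[OF x]] pow by (simp add: sum_distrib_right mult.assoc)
  also have "(\<Sum>k\<le>degree p. coeff (lagrange p \<nu>) k * \<mu> ^ k) = poly (lagrange p \<nu>) \<mu>"
    unfolding poly_altdef using degree_lagrange[of p \<nu>]
    by (intro sum.mono_neutral_right) (auto simp: coeff_eq_0)
  finally show ?thesis .
qed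

text \<open>
  The trace for \<open>\<nu>\<close> is \<open>T(\<nu>) / p'(\<nu>)\<close> with a rational polynomial \<open>T\<close>.  If it equals the integer \<open>J\<close>
  at one root of \<open>p\<close>, then \<open>T - J p'\<close> vanishes there, hence at all conjugates.
\<close>
lemma trace_conjugate:
  assumes "poly (cpoly p) \<mu> = 0" "poly (cpoly p) \<nu> = 0" "(\<Sum>b\<in>B. component \<mu> b b) = of_nat J"
  shows "(\<Sum>b\<in>B. component \<nu> b b) = of_nat J"
proof -
  define \<tau> where "\<tau> k = (\<Sum>b\<in>B. coord b ((\<phi> ^^ k) b))" for k
  obtain T where T: "\<And>\<nu>. (\<Sum>k\<le>degree p. coeff (synthetic_div (cpoly p) \<nu>) k * of_rat (\<tau> k)) = poly (cpoly T) \<nu>"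
    using coeffs_synthetic_div_rational[where N = "degree p" and p = p and \<tau> = \<tau>] by auto
  have tr: "(\<Sum>b\<in>B. component \<nu> b b) = poly (cpoly T) \<nu> / poly (cpoly (pderiv p)) \<nu>" for \<nu>
  proof -
    have "(\<Sum>b\<in>B. component \<nu> b b) = (\<Sum>k\<le>degree p. coeff (lagrange p \<nu>) k * of_rat (\<tau> k))"
      unfolding component_def \<tau>_def by (subst sum.swap) (simp add: of_rat_sum sum_distrib_left)
    also have "\<dots> = (\<Sum>k\<le>degree p. coeff (synthetic_div (cpoly p) \<nu>) k * of_rat (\<tau> k)) / poly (pderiv (cpoly p)) \<nu>"
      by (simp add: lagrange_def sum_divide_distrib)
    finally show ?thesis by (simp add: T cpoly_pderiv)
  qed
  have nz: "poly (cpoly (pderiv p)) \<mu> \<noteq> 0" "poly (cpoly (pderiv p)) \<nu> \<noteq> 0"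
    using irreducible_simple_root[OF irreducible_p] assms(1,2) by (auto simp: cpoly_pderiv)
  have "poly (cpoly (T - smult (of_nat J) (pderiv p))) \<mu> = 0"
    using assms(3) nz(1) unfolding tr by (simp add: cpoly_diff cpoly_smult field_simps)
  hence "poly (cpoly (T - smult (of_nat J) (pderiv p))) \<nu> = 0"
    by (rule conjugate_root[OF irreducible_p assms(1,2)])
  thus ?thesis using nz(2) unfolding tr by (simp add: cpoly_diff cpoly_smult field_simps)
qed

lemma trace_eq_card_eigenfunctionals:
  assumes root: "poly (cpoly p) \<nu> = 0" and fin: "finite I"
    and e: "\<And>l. l \<in> I \<Longrightarrow> rat_linear (e l)" "\<And>l x. l \<in> I \<Longrightarrow> x \<in> V \<Longrightarrow> e l (\<phi> x) = \<nu> * e l x"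
    and indep: "\<And>c. (\<And>b. b \<in> B \<Longrightarrow> (\<Sum>l\<in>I. c l * e l b) = 0) \<Longrightarrow> \<forall>l\<in>I. c l = 0"
    and rows: "\<And>b. b \<in> B \<Longrightarrow> \<exists>\<alpha>. \<forall>x\<in>V. component \<nu> b x = (\<Sum>l\<in>I. \<alpha> l * e l x)"
  shows "(\<Sum>b\<in>B. component \<nu> b b) = of_nat (card I)"
proof (rule trace_eq_card_basis[where P = "component \<nu>" and e = e, OF fin finite_B])
  show "(\<Sum>i\<in>B. e l i * component \<nu> i j) = e l j" if "l \<in> I" "j \<in> B" for l j
    using reproduce[OF e(1)[OF that(1)] e(2)[OF that(1)], of j \<nu>] B_subset_V that
      poly_lagrange[OF irreducible_p root root] by auto
  show "\<forall>l\<in>I. c l = 0" if "\<And>j. j \<in> B \<Longrightarrow> (\<Sum>l\<in>I. c l * e l j) = 0" for c using indep that by blast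
  show "\<exists>\<alpha>. \<forall>j\<in>B. component \<nu> i j = (\<Sum>l\<in>I. \<alpha> l * e l j)" if "i \<in> B" for i
    using rows[OF that] B_subset_V by blast
qed

lemma components_spanned:
  assumes root: "poly (cpoly p) \<nu> = 0" and fin: "finite I"
    and e: "\<And>l. l \<in> I \<Longrightarrow> rat_linear (e l)" "\<And>l x. l \<in> I \<Longrightarrow> x \<in> V \<Longrightarrow> e l (\<phi> x) = \<nu> * e l x"
    and indep: "\<And>c. (\<And>b. b \<in> B \<Longrightarrow> (\<Sum>l\<in>I. c l * e l b) = 0) \<Longrightarrow> \<forall>l\<in>I. c l = 0"
    and trace: "(\<Sum>b\<in>B. component \<nu> b b) = of_nat (card I)"
    and b: "b \<in> B"
  shows "\<exists>\<alpha>. \<forall>x\<in>V. component \<nu> b x = (\<Sum>l\<in>I. \<alpha> l * e l x)"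
proof -
  have one: "poly (lagrange p \<nu>) \<nu> = 1" using poly_lagrange[OF irreducible_p root root] by simp
  have "\<exists>\<alpha>. \<forall>j\<in>B. component \<nu> b j = (\<Sum>l\<in>I. \<alpha> l * e l j)"
  proof (rule fixed_vectors_span_rows[where P = "component \<nu>" and e = e, OF fin finite_B _ _ _ trace b])
    show "\<forall>l\<in>I. c l = 0" if "\<And>j. j \<in> B \<Longrightarrow> (\<Sum>l\<in>I. c l * e l j) = 0" for c using indep that by blast
    show "(\<Sum>k\<in>B. component \<nu> i k * component \<nu> k j) = component \<nu> i j" if "i \<in> B" "j \<in> B" for i j
      using reproduce[OF component_rat_linear component_equivariant[OF root], of j i \<nu>] B_subset_V that one by auto
    show "(\<Sum>i\<in>B. e l i * component \<nu> i j) = e l j" if "l \<in> I" "j \<in> B" for l j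
      using reproduce[OF e(1)[OF that(1)] e(2)[OF that(1)], of j \<nu>] B_subset_V that one by auto
  qed
  then obtain \<alpha> where \<alpha>: "\<And>j. j \<in> B \<Longrightarrow> component \<nu> b j = (\<Sum>l\<in>I. \<alpha> l * e l j)" by blast
  have "component \<nu> b x = (\<Sum>l\<in>I. \<alpha> l * e l x)" if x: "x \<in> V" for x
  proof -
    have "component \<nu> b x = (\<Sum>j\<in>B. of_rat (coord j x) * (\<Sum>l\<in>I. \<alpha> l * e l j))"
      using rat_linear_expand[OF component_rat_linear x, of \<nu> b] \<alpha> by simp
    also have "\<dots> = (\<Sum>l\<in>I. \<alpha> l * (\<Sum>j\<in>B. of_rat (coord j x) * e l j))"
      unfolding sum_distrib_left by (subst sum.swap) (simp add: mult_ac)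
    also have "\<dots> = (\<Sum>l\<in>I. \<alpha> l * e l x)"
      using rat_linear_expand[OF e(1) x] by (intro sum.cong) auto
    finally show ?thesis .
  qed
  thus ?thesis by blast
qed

end

lemma of_real_of_rat: "complex_of_real (of_rat r) = of_rat r"
  by (cases r) (simp add: of_rat_rat)

lemma (in rational_action) linear_imp_rat_linear:
  assumes "linear h" shows "rat_linear h"
  unfolding rat_linear_def using linear_add[OF assms] linear_scale[OF assms]
  by (simp add: scaleR_conv_of_real of_real_of_rat)

lemma (in rational_action) rat_linear_eqI:
  assumes "rat_linear g" "rat_linear h" "\<And>b. b \<in> B \<Longrightarrow> g b = h b" "x \<in> V"
  shows "g x = h x"
  using rat_linear_expand[OF assms(1,4)] rat_linear_expand[OF assms(2,4)] assms(3) by simp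

section \<open>Eigencoordinates of a diagonalizable map\<close>

text \<open>
  The rows of \<open>W\<close>, the inverse of \<open>U\<close>, are left eigenvectors of the matrix of \<open>\<phi>\<close>.  As linear forms
  they are joint coordinates in which \<open>\<phi>\<close> is diagonal.
\<close>
locale eigencoordinates =
  fixes \<phi> :: "real ^ 'n::finite \<Rightarrow> real ^ 'n" and U W :: "complex ^ 'n ^ 'n" and d :: "'n \<Rightarrow> complex"
  assumes linear_map: "linear \<phi>"
    and UW: "U ** W = mat 1" and WU: "W ** U = mat 1"
    and diagonal: "W ** complex_matrix \<phi> = (\<chi> i j. d i * W $ i $ j)"
begin

definition eigenform :: "'n \<Rightarrow> real ^ 'n \<Rightarrow> complex" where
  "eigenform i x = (\<Sum>j\<in>UNIV. W $ i $ j * of_real (x $ j))"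

lemma coordinate_add: "eigenform i (x + y) = eigenform i x + eigenform i y"
  by (simp add: eigenform_def distrib_left sum.distrib)

lemma coordinate_scale: "eigenform i (r *\<^sub>R x) = of_real r * eigenform i x"
  by (simp add: eigenform_def sum_distrib_left mult_ac)

lemma coordinate_axis: "eigenform i (axis j 1) = W $ i $ j"
  by (simp add: eigenform_def axis_def if_distrib[of of_real] if_distrib[of "\<lambda>x. _ * x"] cong: if_cong)

lemma coordinate_eigen: "eigenform i (\<phi> x) = d i * eigenform i x"
proof -
  have "complex_of_real (\<phi> x $ j) = (\<Sum>k\<in>UNIV. complex_matrix \<phi> $ j $ k * of_real (x $ k))" for j
  proof -
    have "\<phi> x = matrix \<phi> *v x" using matrix_works[of \<phi> x] linear_map by simp
    hence "\<phi> x $ j = (\<Sum>k\<in>UNIV. matrix \<phi> $ j $ k * x $ k)" by (simp add: matrix_vector_mult_def)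
    thus ?thesis by (simp add: complex_matrix_def)
  qed
  hence "eigenform i (\<phi> x) = (\<Sum>j\<in>UNIV. \<Sum>k\<in>UNIV. W $ i $ j * (complex_matrix \<phi> $ j $ k * of_real (x $ k)))"
    by (simp add: eigenform_def sum_distrib_left)
  also have "\<dots> = (\<Sum>k\<in>UNIV. (W ** complex_matrix \<phi>) $ i $ k * of_real (x $ k))"
    by (subst sum.swap) (simp add: matrix_matrix_mult_def sum_distrib_right mult.assoc)
  also have "\<dots> = d i * eigenform i x" unfolding diagonal by (simp add: eigenform_def sum_distrib_left mult.assoc)
  finally show ?thesis .
qed

lemma coordinate_eigen_pow: "eigenform i ((\<phi> ^^ n) x) = d i ^ n * eigenform i x"
  by (induction n) (auto simp: coordinate_eigen)

lemma inversion: "complex_of_real (x $ k) = (\<Sum>i\<in>UNIV. U $ k $ i * eigenform i x)"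
proof -
  have "(\<Sum>i\<in>UNIV. U $ k $ i * eigenform i x) = (\<Sum>i\<in>UNIV. \<Sum>j\<in>UNIV. U $ k $ i * W $ i $ j * of_real (x $ j))"
    by (simp add: eigenform_def sum_distrib_left mult.assoc)
  also have "\<dots> = (\<Sum>j\<in>UNIV. (U ** W) $ k $ j * of_real (x $ j))"
    by (subst sum.swap) (simp add: matrix_matrix_mult_def sum_distrib_right)
  also have "\<dots> = of_real (x $ k)" unfolding UW by (simp add: mat_def if_distrib[of "\<lambda>x. x * _"] cong: if_cong)
  finally show ?thesis by simp
qed

lemma coordinates_eq_imp_eq: "(\<And>i. eigenform i x = eigenform i y) \<Longrightarrow> x = y"
  using inversion[of x] inversion[of y] by (simp add: vec_eq_iff) (metis of_real_eq_iff)

lemma coordinates_independent: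
  assumes "\<And>x. (\<Sum>i\<in>UNIV. c i * eigenform i x) = 0"
  shows "c i = 0"
proof -
  have z: "(\<Sum>i\<in>UNIV. c i * W $ i $ j) = 0" for j using assms[of "axis j 1"] by (simp add: coordinate_axis)
  have "c i = (\<Sum>m\<in>UNIV. c m * (W ** U) $ m $ i)"
    unfolding WU by (simp add: mat_def if_distrib[of "\<lambda>x. _ * x"] cong: if_cong)
  also have "\<dots> = (\<Sum>j\<in>UNIV. (\<Sum>m\<in>UNIV. c m * W $ m $ j) * U $ j $ i)"
    unfolding matrix_matrix_mult_def by (simp add: sum_distrib_left sum_distrib_right mult.assoc, subst sum.swap, simp)
  finally show ?thesis using z by simp
qed

definition l1_norm :: "real ^ 'n \<Rightarrow> real" where
  "l1_norm x = (\<Sum>i\<in>UNIV. norm (eigenform i x))"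

lemma norm_equivalence:
  obtains C where "C > 0" "\<And>x. norm x \<le> C * l1_norm x" "\<And>x. l1_norm x \<le> C * norm x"
proof -
  define a where "a = (\<Sum>k\<in>UNIV. \<Sum>i\<in>UNIV. norm (U $ k $ i))"
  define b where "b = (\<Sum>i\<in>UNIV. \<Sum>j\<in>UNIV. norm (W $ i $ j))"
  have ab: "a \<ge> 0" "b \<ge> 0" by (auto simp: a_def b_def intro!: sum_nonneg)
  have 1: "norm x \<le> a * l1_norm x" for x
  proof -
    let ?S = "l1_norm x"
    have "norm x \<le> (\<Sum>k\<in>UNIV. \<bar>x $ k\<bar>)" by (rule norm_le_l1_cart)
    also have "\<dots> \<le> (\<Sum>k\<in>UNIV. \<Sum>i\<in>UNIV. norm (U $ k $ i) * ?S)"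
    proof (rule sum_mono)
      fix k
      have "\<bar>x $ k\<bar> = norm (complex_of_real (x $ k))" by simp
      also have "\<dots> \<le> (\<Sum>i\<in>UNIV. norm (U $ k $ i) * norm (eigenform i x))"
        unfolding inversion by (rule sum_norm_le) (simp add: norm_mult)
      also have "\<dots> \<le> (\<Sum>i\<in>UNIV. norm (U $ k $ i) * ?S)"
        unfolding l1_norm_def by (intro sum_mono mult_left_mono member_le_sum) auto
      finally show "\<bar>x $ k\<bar> \<le> (\<Sum>i\<in>UNIV. norm (U $ k $ i) * ?S)" .
    qed
    also have "\<dots> = a * ?S" by (simp add: a_def sum_distrib_right)
    finally show ?thesis .
  qed
  have 2: "l1_norm x \<le> b * norm x" for x
  proof -
    have "l1_norm x \<le> (\<Sum>i\<in>UNIV. \<Sum>j\<in>UNIV. norm (W $ i $ j) * norm x)"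
      unfolding l1_norm_def eigenform_def
      by (intro sum_mono sum_norm_le) (auto simp: norm_mult intro!: mult_left_mono component_le_norm_cart)
    thus ?thesis by (simp add: b_def sum_distrib_right)
  qed
  show ?thesis
  proof (rule that[of "a + b + 1"])
    show "a + b + 1 > 0" using ab by simp
    fix x
    let ?S = "l1_norm x"
    have S: "?S \<ge> 0" by (simp add: l1_norm_def sum_nonneg)
    have "a * ?S \<le> (a + b + 1) * ?S" "b * norm x \<le> (a + b + 1) * norm x"
      using ab S by (auto intro!: mult_right_mono)
    thus "norm x \<le> (a + b + 1) * ?S" "?S \<le> (a + b + 1) * norm x" using 1[of x] 2[of x] by auto
  qed
qed

lemma pow_growth:
  assumes "\<And>i. norm (d i) \<le> \<rho>"
  shows "\<exists>C>0. \<forall>n x. norm ((\<phi> ^^ n) x) \<le> C * \<rho> ^ n * norm x"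
proof -
  obtain C where C: "C > 0" "\<And>x. norm x \<le> C * l1_norm x" "\<And>x. l1_norm x \<le> C * norm x"
    by (rule norm_equivalence) (rule that)
  have \<rho>: "\<rho> \<ge> 0" using assms order_trans norm_ge_zero by blast
  have "norm ((\<phi> ^^ n) x) \<le> (C * C) * \<rho> ^ n * norm x" for n x
  proof -
    have "norm ((\<phi> ^^ n) x) \<le> C * (\<Sum>i\<in>UNIV. norm (d i) ^ n * norm (eigenform i x))"
      using C(2)[of "(\<phi> ^^ n) x"] by (simp add: l1_norm_def coordinate_eigen_pow norm_mult norm_power)
    also have "\<dots> \<le> C * (\<Sum>i\<in>UNIV. \<rho> ^ n * norm (eigenform i x))"
      using C(1) assms by (intro mult_left_mono sum_mono mult_right_mono power_mono) auto
    also have "\<dots> = C * \<rho> ^ n * l1_norm x" by (simp add: l1_norm_def sum_distrib_left mult.assoc)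
    also have "\<dots> \<le> C * \<rho> ^ n * (C * norm x)" using C \<rho> by (intro mult_left_mono) auto
    finally show ?thesis by (simp add: mult_ac)
  qed
  thus ?thesis using C(1) by (intro exI[of _ "C * C"]) auto
qed

lemma pow_expansion:
  assumes "\<And>i. norm (d i) \<ge> s" "s > 0"
  shows "\<exists>C>0. \<forall>n x. norm x \<le> C * (1 / s) ^ n * norm ((\<phi> ^^ n) x)"
proof -
  obtain C where C: "C > 0" "\<And>x. norm x \<le> C * l1_norm x" "\<And>x. l1_norm x \<le> C * norm x"
    by (rule norm_equivalence) (rule that)
  have "norm x \<le> (C * C) * (1 / s) ^ n * norm ((\<phi> ^^ n) x)" for n x
  proof -
    have "norm (eigenform i x) \<le> (1 / s) ^ n * norm (eigenform i ((\<phi> ^^ n) x))" for i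
    proof -
      have "s ^ n * norm (eigenform i x) \<le> norm (d i) ^ n * norm (eigenform i x)"
        using assms by (intro mult_right_mono power_mono) auto
      thus ?thesis using assms(2) by (simp add: coordinate_eigen_pow norm_mult norm_power field_simps)
    qed
    hence "l1_norm x \<le> (1 / s) ^ n * l1_norm ((\<phi> ^^ n) x)"
      unfolding l1_norm_def sum_distrib_left by (intro sum_mono)
    also have "\<dots> \<le> (1 / s) ^ n * (C * norm ((\<phi> ^^ n) x))"
      using assms(2) by (intro mult_left_mono C(3)) auto
    finally have "C * l1_norm x \<le> C * ((1 / s) ^ n * (C * norm ((\<phi> ^^ n) x)))"
      using C(1) by (intro mult_left_mono) auto
    thus ?thesis using C(2)[of x] by (simp add: mult_ac)
  qed
  thus ?thesis using C(1) by (intro exI[of _ "C * C"]) auto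
qed

lemma matrix_U: "complex_matrix \<phi> ** U = (\<chi> i j. U $ i $ j * d j)"
proof -
  let ?M = "complex_matrix \<phi>" and ?D = "\<chi> i j. if i = j then d i else 0"
  have "W ** ?M = ?D ** W"
    unfolding diagonal by (simp add: vec_eq_iff matrix_matrix_mult_def if_distrib[of "\<lambda>x. x * _"] cong: if_cong)
  hence "U ** (W ** ?M) ** U = U ** (?D ** W) ** U" by simp
  hence "(U ** W) ** ?M ** U = U ** ?D ** (W ** U)" by (simp only: matrix_mul_assoc)
  hence "?M ** U = U ** ?D" unfolding UW WU by (simp add: matrix_mul_lid matrix_mul_rid)
  also have "\<dots> = (\<chi> i j. U $ i $ j * d j)"
    by (simp add: vec_eq_iff matrix_matrix_mult_def if_distrib[of "\<lambda>x. _ * x"] cong: if_cong)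
  finally show ?thesis .
qed

lemma spectrum_eq: "spectrum \<phi> = range d"
proof
  show "range d \<subseteq> spectrum \<phi>"
  proof
    fix \<mu> assume "\<mu> \<in> range d"
    then obtain j where j: "\<mu> = d j" by blast
    define v where "v = (\<chi> i. U $ i $ j)"
    have "v \<noteq> 0"
    proof
      assume "v = 0"
      hence "U $ k $ j = 0" for k by (simp add: v_def vec_eq_iff)
      hence "(W ** U) $ j $ j = 0" by (simp add: matrix_matrix_mult_def)
      thus False unfolding WU by (simp add: mat_def)
    qed
    moreover have "complex_matrix \<phi> *v v = \<mu> *s v"
    proof -
      have "(complex_matrix \<phi> *v v) $ i = (complex_matrix \<phi> ** U) $ i $ j" for i
        by (simp add: v_def matrix_vector_mult_def matrix_matrix_mult_def)
      thus ?thesis unfolding matrix_U by (simp add: vec_eq_iff v_def j mult.commute)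
    qed
    ultimately show "\<mu> \<in> spectrum \<phi>" unfolding spectrum_def by blast
  qed
  show "spectrum \<phi> \<subseteq> range d"
  proof
    fix \<mu> assume "\<mu> \<in> spectrum \<phi>"
    then obtain v where v: "v \<noteq> 0" "complex_matrix \<phi> *v v = \<mu> *s v" unfolding spectrum_def by blast
    have "W *v v \<noteq> 0"
    proof
      assume "W *v v = 0"
      hence "(U ** W) *v v = 0" by (simp add: matrix_vector_mul_assoc[symmetric])
      thus False using v(1) unfolding UW by simp
    qed
    then obtain i where i: "(W *v v) $ i \<noteq> 0" by (auto simp: vec_eq_iff)
    have "(W ** complex_matrix \<phi>) *v v = W *v (\<mu> *s v)" by (simp add: matrix_vector_mul_assoc[symmetric] v(2))
    hence "((W ** complex_matrix \<phi>) *v v) $ i = (W *v (\<mu> *s v)) $ i" by simp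
    hence "d i * (W *v v) $ i = \<mu> * (W *v v) $ i"
      unfolding diagonal by (simp add: matrix_vector_mult_def vector_scalar_mult_def sum_distrib_left mult_ac)
    thus "\<mu> \<in> range d" using i by auto
  qed
qed

text \<open>
  The columns of \<open>U\<close> are right eigenvectors, so multiplying the characteristic matrix by \<open>U\<close> turns it
  into \<open>U\<close> times a diagonal matrix; compare determinants.
\<close>
lemma eigen_multiplicity_eq: "eigen_multiplicity \<phi> \<mu> = card {i. d i = \<mu>}"
proof -
  have const_sum: "(\<Sum>k\<in>A. [:f k:]) = [:\<Sum>k\<in>A. f k:]" for f :: "'n \<Rightarrow> complex" and A
    by (induction A rule: infinite_finite_induct) auto
  have X: "[:0, 1:] * [:c:] = smult c [:0, 1:]" for c :: complex by simp
  let ?c = "\<lambda>A :: complex ^ 'n ^ 'n. map_matrix (\<lambda>c. [:c:]) A"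
  let ?N = "mat [:0, 1:] - ?c (complex_matrix \<phi>)"
  let ?E = "\<chi> i j. if i = j then [:- d i, 1:] else (0 :: complex poly)"
  have hom: "?c (A ** B) = ?c A ** ?c B" for A B
    by (simp add: vec_eq_iff matrix_matrix_mult_def const_sum[symmetric] mult.commute)
  have "?c U ** ?c W = mat 1"
    unfolding hom[symmetric] UW by (simp add: vec_eq_iff mat_def)
  hence "det (?c U) * det (?c W) = 1" by (metis det_mul det_I)
  hence nz: "det (?c U) \<noteq> 0" by (metis mult_zero_left zero_neq_one)
  have "?N ** ?c U = ?c U ** ?E"
  proof (subst vec_eq_iff, intro allI, subst vec_eq_iff, intro allI)
    fix i j
    have "(?N ** ?c U) $ i $ j = (\<Sum>k\<in>UNIV. mat [:0, 1:] $ i $ k * [:U $ k $ j:]) - (?c (complex_matrix \<phi>) ** ?c U) $ i $ j"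
      by (simp add: matrix_matrix_mult_def left_diff_distrib sum_subtractf del: mult_pCons_left mult_pCons_right)
    also have "(\<Sum>k\<in>UNIV. mat [:0, 1:] $ i $ k * [:U $ k $ j:]) = [:0, 1:] * [:U $ i $ j:]"
      by (simp add: mat_def if_distrib[of "\<lambda>x. x * _"] del: mult_pCons_left mult_pCons_right cong: if_cong)
    also have "(?c (complex_matrix \<phi>) ** ?c U) $ i $ j = [:U $ i $ j * d j:]"
      unfolding hom[symmetric] matrix_U by simp
    also have "[:0, 1:] * [:U $ i $ j:] - [:U $ i $ j * d j:] = (?c U ** ?E) $ i $ j"
      by (simp add: matrix_matrix_mult_def if_distrib[of "\<lambda>x. _ * x"] cong: if_cong)
    finally show "(?N ** ?c U) $ i $ j = (?c U ** ?E) $ i $ j" .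
  qed
  hence "det (?N ** ?c U) = det (?c U ** ?E)" by (rule arg_cong)
  hence "det (?c U) * det ?N = det (?c U) * det ?E" by (simp only: det_mul mult.commute)
  hence "det ?N = det ?E" using nz by (simp only: mult_cancel_left) blast
  hence "charpoly \<phi> = det ?E" unfolding charpoly_def .
  also have "\<dots> = (\<Prod>i\<in>UNIV. [:- d i, 1:])" by (subst det_diagonal) auto
  finally have cp: "charpoly \<phi> = (\<Prod>i\<in>UNIV. [:- d i, 1:])" .
  have pos: "(\<Prod>i\<in>A. [:- d i, 1:]) \<noteq> 0" for A
    by (induction A rule: infinite_finite_induct) (auto simp del: mult_pCons_left)
  have "order \<mu> (\<Prod>i\<in>A. [:- d i, 1:]) = card {i\<in>A. d i = \<mu>}" for A
  proof (induction A rule: infinite_finite_induct)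
    case (insert i A)
    have "order \<mu> [:- d i, 1:] = (if d i = \<mu> then 1 else 0)"
      using order_power_n_n[of "d i" 1] by (auto intro: order_0I)
    moreover have "{k \<in> insert i A. d k = \<mu>} = (if d i = \<mu> then insert i {k\<in>A. d k = \<mu>} else {k\<in>A. d k = \<mu>})"
      by auto
    moreover have "[:- d i, 1:] * (\<Prod>i\<in>A. [:- d i, 1:]) \<noteq> 0" using pos[of A] by (simp only: mult_eq_0_iff) simp
    ultimately show ?case using insert by (simp add: order_mult del: mult_pCons_left)
  qed (auto simp: order_0I)
  thus ?thesis unfolding eigen_multiplicity_def cp by simp
qed

end

lemma (in eigencoordinates) linear_coordinate: "linear (eigenform i)"
proof (rule linearI)
  show "eigenform i (x + y) = eigenform i x + eigenform i y" for x y by (rule coordinate_add)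
  show "eigenform i (r *\<^sub>R x) = r *\<^sub>R eigenform i x" for r x
    unfolding coordinate_scale by (rule scaleR_conv_of_real[symmetric])
qed

lemma (in eigencoordinates) linear_combination: "linear (\<lambda>x. \<Sum>i\<in>I. c i * eigenform i x)"
proof (rule linearI)
  show "(\<Sum>i\<in>I. c i * eigenform i (x + y)) = (\<Sum>i\<in>I. c i * eigenform i x) + (\<Sum>i\<in>I. c i * eigenform i y)" for x y
    by (simp add: coordinate_add distrib_left sum.distrib)
  show "(\<Sum>i\<in>I. c i * eigenform i (r *\<^sub>R x)) = r *\<^sub>R (\<Sum>i\<in>I. c i * eigenform i x)" for r x
    unfolding coordinate_scale by (simp add: scaleR_conv_of_real sum_distrib_left mult.left_commute)
qed

lemma (in eigencoordinates) linear_eq_combination: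
  fixes h :: "real ^ 'n \<Rightarrow> complex"
  assumes h: "linear h"
  shows "\<exists>\<beta>. \<forall>x. h x = (\<Sum>i\<in>UNIV. \<beta> i * eigenform i x)"
proof (intro exI allI)
  fix x :: "real ^ 'n"
  have sc: "h (r *\<^sub>R v) = of_real r * h v" for r v
    unfolding linear_scale[OF h] by (rule scaleR_conv_of_real)
  have "x = (\<Sum>k\<in>UNIV. x $ k *\<^sub>R axis k 1)" by (simp add: basis_expansion scalar_mult_eq_scaleR[symmetric])
  hence "h x = h (\<Sum>k\<in>UNIV. x $ k *\<^sub>R axis k 1)" by (rule arg_cong)
  also have "\<dots> = (\<Sum>k\<in>UNIV. complex_of_real (x $ k) * h (axis k 1))"
    by (simp add: linear_sum[OF h] sc)
  also have "\<dots> = (\<Sum>k\<in>UNIV. \<Sum>i\<in>UNIV. U $ k $ i * h (axis k 1) * eigenform i x)"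
    unfolding inversion sum_distrib_right by (intro sum.cong refl) (simp only: mult_ac)
  also have "\<dots> = (\<Sum>i\<in>UNIV. (\<Sum>k\<in>UNIV. U $ k $ i * h (axis k 1)) * eigenform i x)"
    by (subst sum.swap) (simp add: sum_distrib_right)
  finally show "h x = (\<Sum>i\<in>UNIV. (\<Sum>k\<in>UNIV. U $ k $ i * h (axis k 1)) * eigenform i x)" .
qed

lemma diagonalizable_eigencoordinates:
  assumes "linear \<phi>" "diagonalizable_over_complex \<phi>"
  obtains U W d where "eigencoordinates \<phi> U W d"
proof -
  obtain U D :: "complex ^ 'a ^ 'a" where UD: "invertible U" "\<And>i j. i \<noteq> j \<Longrightarrow> D $ i $ j = 0"
      "complex_matrix \<phi> = U ** D ** matrix_inv U"
    using assms(2) unfolding diagonalizable_over_complex_def by blast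
  let ?W = "matrix_inv U"
  have inv: "U ** ?W = mat 1 \<and> ?W ** U = mat 1"
    using UD(1) unfolding invertible_def matrix_inv_def by (rule someI_ex)
  have "?W ** complex_matrix \<phi> = (?W ** U) ** D ** ?W" by (simp only: UD(3) matrix_mul_assoc)
  also have "\<dots> = D ** ?W" using inv by simp
  also have "\<dots> = (\<chi> i j. D $ i $ i * ?W $ i $ j)"
  proof (subst vec_eq_iff, intro allI, subst vec_eq_iff, intro allI)
    fix i j
    have "(\<Sum>k\<in>UNIV. D $ i $ k * ?W $ k $ j) = (\<Sum>k\<in>UNIV. if k = i then D $ i $ i * ?W $ i $ j else 0)"
      using UD(2) by (intro sum.cong) auto
    thus "(D ** ?W) $ i $ j = (\<chi> i j. D $ i $ i * ?W $ i $ j) $ i $ j" by (simp add: matrix_matrix_mult_def)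
  qed
  finally have "eigencoordinates \<phi> U ?W (\<lambda>i. D $ i $ i)" 
    unfolding eigencoordinates_def using assms(1) inv by blast
  thus ?thesis by (rule that)
qed

section \<open>Asymptotic characters\<close>

lemma Re_of_rat: "Re (of_rat r) = of_rat r"
  by (simp add: of_real_of_rat[symmetric])

lemma linear_functional_inner:
  fixes f :: "'a::euclidean_space \<Rightarrow> real"
  assumes "linear f"
  shows "\<exists>a. \<forall>x. f x = a \<bullet> x"
  using adjoint_works[OF assms, of _ 1] by (metis inner_commute inner_real_def mult.right_neutral)

lemma common_denominator:
  assumes "finite (S :: rat set)"
  shows "\<exists>q>0. \<forall>r\<in>S. of_nat q * r \<in> \<int>"
  using assms
proof (induction S rule: finite_induct)
  case empty
  show ?case by (intro exI[of _ 1]) simp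
next
  case (insert r S)
  then obtain q where q: "q > 0" "\<And>r. r \<in> S \<Longrightarrow> of_nat q * r \<in> \<int>" by blast
  obtain a b where ab: "r = of_int a / of_int b" "b > 0" by (cases r) (auto simp: Fract_of_int_quotient)
  have "of_nat (q * nat b) * s \<in> \<int>" if "s \<in> insert r S" for s
  proof (cases "s = r")
    case True
    have "of_nat (q * nat b) * r = of_int (int q * a)" using ab by simp
    thus ?thesis using True by (metis Ints_of_int)
  next
    case False
    hence "of_nat q * s \<in> \<int>" using q(2) that by blast
    hence "of_int b * (of_nat q * s) \<in> \<int>" by (rule Ints_mult[OF Ints_of_int])
    thus ?thesis using ab(2) by (simp add: mult_ac)
  qed
  thus ?case using q(1) ab(2) by (intro exI[of _ "q * nat b"]) auto
qed

text \<open>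
  Here \<open>p\<close> is the common minimal polynomial of the eigenvalues, and \<open>Pisot\<close> is the condition on the
  remaining conjugates.
\<close>
locale Pisot_inflation = inflation_set D \<phi> + eigencoordinates \<phi> U W d
  for D :: "(real ^ 'n::finite) set" and \<phi> U W d +
  fixes p :: "rat poly"
  assumes irreducible: "irreducible p"
    and eigenvalue_root: "poly (cpoly p) (d i) = 0"
    and eigenvalue_gt_1: "norm (d i) > 1"
    and equal_multiplicity: "card {j. d j = d i} = card {j. d j = d i'}"
    and Pisot: "poly (cpoly p) \<nu> = 0 \<Longrightarrow> \<nu> \<notin> range d \<Longrightarrow> norm \<nu> < 1"
begin

lemma annihilated: "(\<Sum>k\<le>degree p. of_rat (coeff p k) *\<^sub>R (\<phi> ^^ k) x) = 0"
proof (rule coordinates_eq_imp_eq)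
  fix i
  have lin: "linear (eigenform i)" by (rule linear_coordinate)
  have "eigenform i (\<Sum>k\<le>degree p. of_rat (coeff p k) *\<^sub>R (\<phi> ^^ k) x) = (\<Sum>k\<le>degree p. of_rat (coeff p k) * (d i ^ k * eigenform i x))"
    by (simp add: linear_sum[OF lin] coordinate_scale coordinate_eigen_pow of_real_of_rat)
  also have "\<dots> = poly (cpoly p) (d i) * eigenform i x"
    by (simp add: poly_altdef coeff_map_poly sum_distrib_right mult.assoc)
  also have "\<dots> = eigenform i 0" by (simp add: eigenvalue_root linear_0[OF lin])
  finally show "eigenform i (\<Sum>k\<le>degree p. of_rat (coeff p k) *\<^sub>R (\<phi> ^^ k) x) = eigenform i 0" .
qed

definition difference_basis :: "(real ^ 'n) set \<Rightarrow> bool" where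
  "difference_basis B \<longleftrightarrow> rational_action B \<phi> p \<and> (\<forall>x\<in>D. \<forall>y\<in>D. x - y \<in> rat_space.span B) \<and>
     (\<forall>b\<in>B. \<exists>x\<in>D. \<exists>y\<in>D. b = x - y)"

lemma difference_basisD:
  assumes "difference_basis B"
  shows "rational_action B \<phi> p" "\<And>x y. x \<in> D \<Longrightarrow> y \<in> D \<Longrightarrow> x - y \<in> rational_action.V B"
    "\<And>b. b \<in> B \<Longrightarrow> \<exists>x\<in>D. \<exists>y\<in>D. b = x - y"
  using assms rational_action.V_def[of B \<phi> p] unfolding difference_basis_def by auto

text \<open>
  Finitely many differences generate \<open>D - D\<close> additively.  So a rational basis can be chosen among
  them, and a common denominator for their coordinates serves for all of \<open>D - D\<close>.
\<close>
lemma rational_basis: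
  obtains B q where "difference_basis B" "q > (0 :: nat)"
    "\<And>b x y. b \<in> B \<Longrightarrow> x \<in> D \<Longrightarrow> y \<in> D \<Longrightarrow> of_nat q * rational_action.coord B b (x - y) \<in> \<int>"
proof -
  obtain G where G: "finite G" "\<And>v. v \<in> G \<Longrightarrow> \<exists>x\<in>D. \<exists>y\<in>D. v = x - y"
    "\<And>x y. x \<in> D \<Longrightarrow> y \<in> D \<Longrightarrow> \<exists>n c. c 0 = x \<and> c n = y \<and> (\<forall>i. c i \<in> D) \<and>
       (\<forall>i<n. c i - c (Suc i) \<in> G) \<and> real n \<le> norm (x - y) + 1"
    by (rule chain) (rule that)
  have sum_of_G: "\<exists>(n::nat) \<xi>. (\<forall>i<n. \<xi> i \<in> G) \<and> x - y = (\<Sum>i<n. \<xi> i)" if xy: "x \<in> D" "y \<in> D" for x y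
  proof -
    obtain n c where c: "c 0 = x" "c n = y" "\<forall>i<n. c i - c (Suc i) \<in> G" using G(3)[OF xy] by blast
    have "x - y = (\<Sum>i<n. c i - c (Suc i))" unfolding sum_lessThan_telescope' by (simp add: c)
    thus ?thesis using c(3) by (intro exI[of _ n] exI[of _ "\<lambda>i. c i - c (Suc i)"]) blast
  qed
  obtain B where B: "B \<subseteq> G" "rat_space.independent B" "G \<subseteq> rat_space.span B"
    by (rule rat_space.maximal_independent_subset[of G]) (rule that)
  have diff_span: "x - y \<in> rat_space.span B" if "x \<in> D" "y \<in> D" for x y
  proof -
    obtain n :: nat and \<xi> where n: "\<forall>i<n. \<xi> i \<in> G" "x - y = (\<Sum>i<n. \<xi> i)" using sum_of_G[OF \<open>x \<in> D\<close> \<open>y \<in> D\<close>] by blast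
    show ?thesis unfolding n(2) using n(1) B(3) by (intro rat_space.span_sum) auto
  qed
  have finB: "finite B" using B(1) G(1) by (rule finite_subset)
  have RA: "rational_action B \<phi> p"
  proof (rule rational_action.intro)
    show "finite B" "rat_space.independent B" "linear \<phi>" "irreducible p"
      by (rule finB B(2) linear_phi irreducible)+
    show "\<phi> b \<in> rat_space.span B" if b: "b \<in> B" for b
    proof -
      obtain x y where xy: "x \<in> D" "y \<in> D" "b = x - y" using G(2) B(1) b by blast
      have "\<phi> b = \<phi> x - \<phi> y" unfolding xy(3) by (rule linear_diff[OF linear_phi])
      thus ?thesis using diff_span[OF inflation_closed[OF xy(1)] inflation_closed[OF xy(2)]] by simp
    qed
    show "(\<Sum>k\<le>degree p. of_rat (coeff p k) *\<^sub>R (\<phi> ^^ k) x) = 0" for x by (rule annihilated)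
  qed
  interpret R: rational_action B \<phi> p by (rule RA)
  have "finite ((\<lambda>(b, v). R.coord b v) ` (B \<times> G))" using finB G(1) by blast
  then obtain q where q: "q > 0" "\<forall>r\<in>(\<lambda>(b, v). R.coord b v) ` (B \<times> G). of_nat q * r \<in> \<int>"
    using common_denominator by blast
  show ?thesis
  proof (rule that[OF _ q(1)])
    show "difference_basis B" unfolding difference_basis_def using RA diff_span B(1) G(2) by blast
    fix b x y assume b: "b \<in> B" and xy: "x \<in> D" "y \<in> D"
    obtain n :: nat and \<xi> where n: "\<forall>i<n. \<xi> i \<in> G" "x - y = (\<Sum>i<n. \<xi> i)" using sum_of_G[OF xy] by blast
    have "R.coord b (x - y) = (\<Sum>i<n. R.coord b (\<xi> i))"
      unfolding n(2) using n(1) B(3) by (intro R.coord_sum) (auto simp: R.V_def)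
    hence "of_nat q * R.coord b (x - y) = (\<Sum>i<n. of_nat q * R.coord b (\<xi> i))" by (simp add: sum_distrib_left)
    also have "\<dots> \<in> \<int>" using q(2) n(1) b by (intro Ints_sum) force
    finally show "of_nat q * R.coord b (x - y) \<in> \<int>" .
  qed
qed

definition near_integer :: "real ^ 'n \<Rightarrow> nat \<Rightarrow> real \<Rightarrow> bool" where
  "near_integer a m \<eta> \<longleftrightarrow> (\<forall>x\<in>D. \<forall>y\<in>D. \<exists>k::int. \<bar>a \<bullet> (\<phi> ^^ m) (x - y) - of_int k\<bar> < \<eta>)"

definition asymptotic_characters :: "(real ^ 'n) set" where
  "asymptotic_characters = {a. \<forall>\<eta>>0. \<forall>\<^sub>F m in sequentially. near_integer a m \<eta>}"

lemma near_integerE: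
  assumes "near_integer a m \<eta>" "x \<in> D" "y \<in> D"
  obtains k :: int where "\<bar>a \<bullet> (\<phi> ^^ m) (x - y) - of_int k\<bar> < \<eta>"
  using assms unfolding near_integer_def by blast

lemma eventually_near_integer:
  "a \<in> asymptotic_characters \<Longrightarrow> \<eta> > 0 \<Longrightarrow> \<forall>\<^sub>F m in sequentially. near_integer a m \<eta>"
  by (simp add: asymptotic_characters_def)

lemma component_cocycle:
  assumes B: "difference_basis B" and root: "poly (cpoly p) \<nu> = 0"
  shows "equivariant_cocycle D \<phi> (rational_action.component B \<phi> p \<nu> b) \<nu>"
proof -
  interpret R: rational_action B \<phi> p by (rule difference_basisD[OF B])
  let ?g = "R.component \<nu> b"
  note DV = difference_basisD(2)[OF B]
  have add: "?g (x + y) = ?g x + ?g y" if "x \<in> R.V" "y \<in> R.V" for x y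
    using R.component_rat_linear that unfolding R.rat_linear_def by blast
  show ?thesis
  proof unfold_locales
    fix x y z assume "x \<in> D" "y \<in> D" "z \<in> D"
    thus "?g (x - z) = ?g (x - y) + ?g (y - z)" using add[OF DV[of x y] DV[of y z]] by simp
  next
    fix x y assume xy: "x \<in> D" "y \<in> D"
    show "?g (\<phi> x - \<phi> y) = \<nu> * ?g (x - y)"
      using R.component_equivariant[OF root DV[OF xy]] by (simp add: linear_diff[OF linear_phi])
  qed
qed

text \<open>
  For an eigenvalue of largest modulus, rigidity makes each component linear, hence a combination of
  the eigenforms for this eigenvalue; so the trace of the components is its multiplicity.  By
  conjugacy and equality of multiplicities, the trace for any eigenvalue \<open>d i\<close> is the number of
  eigenforms for \<open>d i\<close>, which therefore span the components.
\<close>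
lemma components_linear:
  assumes B: "difference_basis B" and b: "b \<in> B"
  shows "\<exists>\<alpha>. \<forall>x\<in>rational_action.V B. rational_action.component B \<phi> p (d i) b x = (\<Sum>l | d l = d i. \<alpha> l * eigenform l x)"
proof -
  interpret R: rational_action B \<phi> p by (rule difference_basisD[OF B])
  note DV = difference_basisD(2)[OF B]
  have indep: "\<forall>l\<in>I. c l = 0" if c: "\<And>b. b \<in> B \<Longrightarrow> (\<Sum>l\<in>I. c l * eigenform l b) = 0" for I c
  proof -
    let ?h = "\<lambda>x. \<Sum>l\<in>I. c l * eigenform l x"
    have zero: "R.rat_linear (\<lambda>x. 0)" by (simp add: R.rat_linear_def)
    have zV: "?h x = 0" if "x \<in> R.V" for x
      by (rule R.rat_linear_eqI[where h = "\<lambda>x. 0", OF R.linear_imp_rat_linear[OF linear_combination] zero _ that]) (rule c)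
    have "?h x = 0" for x
      by (rule linear_zero_on_differences[OF linear_combination]) (rule zV[OF DV])
    moreover have "?h x = (\<Sum>l\<in>UNIV. (if l \<in> I then c l else 0) * eigenform l x)" for x
      by (intro sum.mono_neutral_cong_left) auto
    ultimately have "(if l \<in> I then c l else 0) = 0" for l
      by (intro coordinates_independent[where c = "\<lambda>l. if l \<in> I then c l else 0"]) simp
    thus ?thesis by meson
  qed
  obtain i\<^sub>1 where i\<^sub>1: "\<And>i. norm (d i) \<le> norm (d i\<^sub>1)"
  proof -
    have "Max (range (\<lambda>i. norm (d i))) \<in> range (\<lambda>i. norm (d i))" by (intro Max_in) auto
    then obtain i\<^sub>1 where "Max (range (\<lambda>i. norm (d i))) = norm (d i\<^sub>1)" by blast
    moreover have "norm (d i) \<le> Max (range (\<lambda>i. norm (d i)))" for i by (intro Max_ge) auto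
    ultimately show ?thesis using that[of i\<^sub>1] by simp
  qed
  let ?\<mu> = "d i\<^sub>1"
  obtain C where C: "C > 0" "\<And>n x. norm ((\<phi> ^^ n) x) \<le> C * norm ?\<mu> ^ n * norm x"
    using pow_growth[OF i\<^sub>1] by blast
  have dominant: "\<exists>\<alpha>. \<forall>x\<in>R.V. R.component ?\<mu> b x = (\<Sum>l | d l = ?\<mu>. \<alpha> l * eigenform l x)" if b: "b \<in> B" for b
  proof -
    let ?g = "R.component ?\<mu> b"
    have eq: "?g (\<phi> x) = ?\<mu> * ?g x" if "x \<in> R.V" for x
      by (rule R.component_equivariant[OF eigenvalue_root that])
    interpret E: equivariant_cocycle D \<phi> ?g ?\<mu>
      by (rule component_cocycle[OF B eigenvalue_root])
    obtain h where h: "linear h" "\<And>x y. x \<in> D \<Longrightarrow> y \<in> D \<Longrightarrow> ?g (x - y) = h (x - y)"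
      using E.dominant_cocycle_linear[OF eigenvalue_gt_1 C(2,1)] by blast
    have gh: "?g x = h x" if "x \<in> R.V" for x
      using h(2) difference_basisD(3)[OF B] by (intro R.rat_linear_eqI[OF R.component_rat_linear R.linear_imp_rat_linear[OF h(1)] _ that]) blast
    obtain \<beta> where \<beta>: "\<And>x. h x = (\<Sum>l\<in>UNIV. \<beta> l * eigenform l x)" using linear_eq_combination[OF h(1)] by blast
    have "\<beta> l * (d l - ?\<mu>) = 0" for l
    proof (rule coordinates_independent[where c = "\<lambda>l. \<beta> l * (d l - ?\<mu>)"], rule linear_zero_on_differences[OF linear_combination])
      fix x y assume xy: "x \<in> D" "y \<in> D"
      have "(\<Sum>l\<in>UNIV. \<beta> l * (d l - ?\<mu>) * eigenform l (x - y)) = h (\<phi> (x - y)) - ?\<mu> * h (x - y)"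
        unfolding \<beta> by (simp add: coordinate_eigen algebra_simps sum_subtractf sum_distrib_left)
      also have "\<dots> = 0" using gh[OF DV[OF xy]] gh[OF R.phi_V[OF DV[OF xy]]] eq[OF DV[OF xy]] by simp
      finally show "(\<Sum>l\<in>UNIV. \<beta> l * (d l - ?\<mu>) * eigenform l (x - y)) = 0" .
    qed
    hence "h x = (\<Sum>l | d l = ?\<mu>. \<beta> l * eigenform l x)" for x
      unfolding \<beta> by (intro sum.mono_neutral_right) auto
    thus ?thesis using gh by auto
  qed
  have eig: "eigenform l (\<phi> x) = d i * eigenform l x" if "l \<in> {l. d l = d i}" for l i x using that by (simp add: coordinate_eigen)
  have "(\<Sum>b\<in>B. R.component ?\<mu> b b) = of_nat (card {l. d l = ?\<mu>})"
    by (rule R.trace_eq_card_eigenfunctionals[where e = eigenform, OF eigenvalue_root _ R.linear_imp_rat_linear[OF linear_coordinate] eig indep dominant]) auto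
  hence "(\<Sum>b\<in>B. R.component (d i) b b) = of_nat (card {l. d l = ?\<mu>})"
    by (rule R.trace_conjugate[OF eigenvalue_root eigenvalue_root])
  hence "(\<Sum>b\<in>B. R.component (d i) b b) = of_nat (card {l. d l = d i})"
    unfolding equal_multiplicity[of i i\<^sub>1] .
  thus ?thesis
    by (intro R.components_spanned[where e = eigenform, OF eigenvalue_root _ R.linear_imp_rat_linear[OF linear_coordinate] eig indep _ b]) auto
qed

text \<open>
  The linear form \<open>A b\<close> is the sum of the components of \<open>coord b\<close> over all eigenvalues.  Its difference
  from \<open>coord b\<close> is made of components for roots inside the unit disk, and a suitable multiple of
  \<open>coord b\<close> is integral on \<open>D - D\<close>.
\<close>
lemma spanning_characters:
  "\<exists>(B :: (real ^ 'n) set) a v. finite B \<and> (\<forall>b\<in>B. a b \<in> asymptotic_characters) \<and>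
     (\<forall>x. x = (\<Sum>b\<in>B. (a b \<bullet> x) *\<^sub>R v b))"
proof -
  obtain B q where B: "difference_basis B" "q > (0 :: nat)"
    and integral: "\<And>b x y. b \<in> B \<Longrightarrow> x \<in> D \<Longrightarrow> y \<in> D \<Longrightarrow> of_nat q * rational_action.coord B b (x - y) \<in> \<int>"
    by (rule rational_basis) (rule that)
  interpret R: rational_action B \<phi> p by (rule difference_basisD[OF B(1)])
  note DV = difference_basisD(2)[OF B(1)]
  have "\<exists>\<alpha>. \<forall>x\<in>R.V. R.component \<nu> b x = (\<Sum>l | d l = \<nu>. \<alpha> l * eigenform l x)" if "b \<in> B" "\<nu> \<in> range d" for b \<nu>
    using components_linear[OF B(1) that(1)] that(2) by blast
  then obtain \<alpha> where \<alpha>: "\<And>b \<nu> x. b \<in> B \<Longrightarrow> \<nu> \<in> range d \<Longrightarrow> x \<in> R.V \<Longrightarrow>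
      R.component \<nu> b x = (\<Sum>l | d l = \<nu>. \<alpha> b \<nu> l * eigenform l x)" by metis
  define A where "A b x = (\<Sum>l\<in>UNIV. \<alpha> b (d l) l * eigenform l x)" for b x
  have A_linear: "linear (A b)" for b unfolding A_def by (rule linear_combination)
  define Z where "Z = {\<nu>. poly (cpoly p) \<nu> = 0} - range d"
  have p0: "p \<noteq> 0" using irreducible by auto
  have finZ: "finite Z" "finite {\<nu>. poly (cpoly p) \<nu> = 0}"
    using p0 poly_roots_finite[of "cpoly p"] by (simp_all add: Z_def)
  have Z_root: "poly (cpoly p) \<nu> = 0" and Z_small: "norm \<nu> < 1" and Z_d: "\<nu> \<noteq> d i" if "\<nu> \<in> Z" for \<nu> i
    using that Pisot[of \<nu>] by (auto simp: Z_def)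
  have A_V: "A b x = of_rat (R.coord b x) - (\<Sum>\<nu>\<in>Z. R.component \<nu> b x)" if b: "b \<in> B" and x: "x \<in> R.V" for b x
  proof -
    have "A b x = (\<Sum>\<nu>\<in>range d. \<Sum>l | d l = \<nu>. \<alpha> b (d l) l * eigenform l x)"
      unfolding A_def by (subst sum.image_gen[where g = d]) auto
    also have "\<dots> = (\<Sum>\<nu>\<in>range d. R.component \<nu> b x)"
      by (intro sum.cong refl) (simp add: \<alpha>[OF b _ x])
    also have "\<dots> = (\<Sum>\<nu> | poly (cpoly p) \<nu> = 0. R.component \<nu> b x) - (\<Sum>\<nu>\<in>Z. R.component \<nu> b x)"
      unfolding Z_def using finZ(2) eigenvalue_root by (subst sum.subset_diff[of "range d"]) auto
    finally show ?thesis by (simp add: R.component_sum[OF x])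
  qed
  (* The components for roots that are not eigenvalues cancel in sums against eigenforms, so the
     forms A b reproduce vectors as well as the rational coordinates do. *)
  have A_eigenform_V: "(\<Sum>b\<in>B. A b x * eigenform i b) = eigenform i x" if x: "x \<in> R.V" for x i
  proof -
    have rl: "R.rat_linear (eigenform i)" by (rule R.linear_imp_rat_linear[OF linear_coordinate])
    have "(\<Sum>b\<in>B. eigenform i b * R.component \<nu> b x) = 0" if "\<nu> \<in> Z" for \<nu>
      using R.reproduce[OF rl coordinate_eigen x, of \<nu>] Z_d[OF that, of i]
        poly_lagrange[OF irreducible Z_root[OF that] eigenvalue_root[of i]] by auto
    hence "(\<Sum>b\<in>B. \<Sum>\<nu>\<in>Z. R.component \<nu> b x * eigenform i b) = 0"
      by (subst sum.swap) (simp add: mult.commute)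
    moreover have "(\<Sum>b\<in>B. of_rat (R.coord b x) * eigenform i b) = eigenform i x"
      by (rule R.rat_linear_expand[OF rl x, symmetric])
    moreover have "(\<Sum>b\<in>B. A b x * eigenform i b) =
        (\<Sum>b\<in>B. of_rat (R.coord b x) * eigenform i b) - (\<Sum>b\<in>B. \<Sum>\<nu>\<in>Z. R.component \<nu> b x * eigenform i b)"
      using A_V[OF _ x] by (simp add: left_diff_distrib sum_subtractf sum_distrib_right)
    ultimately show ?thesis by simp
  qed
  have A_eigenform: "(\<Sum>b\<in>B. A b x * eigenform i b) - eigenform i x = 0" for x i
  proof (rule linear_zero_on_differences)
    have sc: "A b (r *\<^sub>R v) = of_real r * A b v" for b r v
      unfolding linear_scale[OF A_linear] by (rule scaleR_conv_of_real)
    show "linear (\<lambda>x. (\<Sum>b\<in>B. A b x * eigenform i b) - eigenform i x)"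
    proof (rule linearI)
      show "(\<Sum>b\<in>B. A b (x + y) * eigenform i b) - eigenform i (x + y) =
          ((\<Sum>b\<in>B. A b x * eigenform i b) - eigenform i x) + ((\<Sum>b\<in>B. A b y * eigenform i b) - eigenform i y)" for x y
        by (simp add: linear_add[OF A_linear] coordinate_add distrib_right sum.distrib)
      show "(\<Sum>b\<in>B. A b (r *\<^sub>R x) * eigenform i b) - eigenform i (r *\<^sub>R x) = r *\<^sub>R ((\<Sum>b\<in>B. A b x * eigenform i b) - eigenform i x)" for r x
        unfolding sc coordinate_scale by (simp add: scaleR_conv_of_real sum_distrib_left right_diff_distrib mult.assoc)
    qed
    show "(\<Sum>b\<in>B. A b (x - y) * eigenform i b) - eigenform i (x - y) = 0" if "x \<in> D" "y \<in> D" for x y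
      using A_eigenform_V[OF DV[OF that]] by simp
  qed
  have expand: "x = (\<Sum>b\<in>B. Re (A b x) *\<^sub>R b)" for x
  proof -
    have "x $ k = (\<Sum>b\<in>B. Re (A b x) * b $ k)" for k
    proof -
      have "complex_of_real (x $ k) = (\<Sum>i\<in>UNIV. U $ k $ i * (\<Sum>b\<in>B. A b x * eigenform i b))"
        using A_eigenform[of x] by (subst inversion) simp
      also have "\<dots> = (\<Sum>b\<in>B. A b x * (\<Sum>i\<in>UNIV. U $ k $ i * eigenform i b))"
        unfolding sum_distrib_left by (subst sum.swap) (simp add: mult.left_commute)
      also have "\<dots> = (\<Sum>b\<in>B. A b x * of_real (b $ k))" by (simp add: inversion[symmetric])
      finally have "Re (complex_of_real (x $ k)) = Re (\<Sum>b\<in>B. A b x * of_real (b $ k))" by simp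
      thus ?thesis by simp
    qed
    thus ?thesis by (simp add: vec_eq_iff)
  qed
  have "linear (\<lambda>x. real q * Re (A b x))" for b
    by (rule linearI) (simp_all add: linear_add[OF A_linear] linear_scale[OF A_linear] algebra_simps)
  hence "\<exists>a. \<forall>x. real q * Re (A b x) = a \<bullet> x" for b by (rule linear_functional_inner)
  then obtain a where "\<And>b. \<forall>x. real q * Re (A b x) = a b \<bullet> x" by metis
  hence a: "real q * Re (A b x) = a b \<bullet> x" for b x by blast
  have "a b \<in> asymptotic_characters" if b: "b \<in> B" for b
    unfolding asymptotic_characters_def
  proof (intro CollectI allI impI)
    fix \<eta> :: real assume \<eta>: "\<eta> > 0"
    have "\<exists>K. \<forall>x\<in>D. \<forall>y\<in>D. norm (R.component \<nu> b (x - y)) \<le> K" if "\<nu> \<in> Z" for \<nu>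
      by (rule equivariant_cocycle.bounded_if_contracted[OF component_cocycle[OF B(1) Z_root[OF that]] Z_small[OF that]])
    then obtain K where K: "\<And>\<nu> x y. \<nu> \<in> Z \<Longrightarrow> x \<in> D \<Longrightarrow> y \<in> D \<Longrightarrow> norm (R.component \<nu> b (x - y)) \<le> K \<nu>"
      by metis
    have "(\<lambda>m. real q * (\<Sum>\<nu>\<in>Z. norm \<nu> ^ m * K \<nu>)) \<longlonglongrightarrow> real q * (\<Sum>\<nu>\<in>Z. 0 * K \<nu>)"
      by (intro tendsto_mult tendsto_sum tendsto_const LIMSEQ_realpow_zero) (auto intro: Z_small)
    hence "\<forall>\<^sub>F m in sequentially. real q * (\<Sum>\<nu>\<in>Z. norm \<nu> ^ m * K \<nu>) < \<eta>"
      using \<eta> by (intro order_tendstoD) auto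
    thus "\<forall>\<^sub>F m in sequentially. near_integer (a b) m \<eta>"
    proof (rule eventually_mono, unfold near_integer_def, intro ballI)
      fix m x y assume m: "real q * (\<Sum>\<nu>\<in>Z. norm \<nu> ^ m * K \<nu>) < \<eta>" and xy: "x \<in> D" "y \<in> D"
      let ?x = "(\<phi> ^^ m) x" and ?y = "(\<phi> ^^ m) y"
      have diff_pow: "(\<phi> ^^ m) (x - y) = ?x - ?y" by (rule linear_diff[OF linear_pow])
      have D': "?x \<in> D" "?y \<in> D" using pow_closed xy by auto
      obtain k where "of_nat q * R.coord b (?x - ?y) = of_int k" using integral[OF b D'] by (auto elim: Ints_cases)
      hence "(of_rat (of_nat q * R.coord b (?x - ?y)) :: real) = of_rat (of_int k)" by simp
      hence k: "real q * of_rat (R.coord b (?x - ?y)) = of_int k" by (simp add: of_rat_mult)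
      have "a b \<bullet> (?x - ?y) - of_int k = - (real q * Re (\<Sum>\<nu>\<in>Z. R.component \<nu> b (?x - ?y)))"
        unfolding a[symmetric] A_V[OF b DV[OF D']] k[symmetric] by (simp add: Re_of_rat right_diff_distrib)
      also have "\<bar>\<dots>\<bar> = real q * \<bar>Re (\<Sum>\<nu>\<in>Z. R.component \<nu> b (?x - ?y))\<bar>" by (simp add: abs_mult)
      also have "\<dots> \<le> real q * (\<Sum>\<nu>\<in>Z. norm \<nu> ^ m * K \<nu>)"
      proof (rule mult_left_mono)
        have "\<bar>Re (\<Sum>\<nu>\<in>Z. R.component \<nu> b (?x - ?y))\<bar> \<le> norm (\<Sum>\<nu>\<in>Z. R.component \<nu> b (?x - ?y))"
          by (rule abs_Re_le_cmod)
        also have "\<dots> \<le> (\<Sum>\<nu>\<in>Z. norm \<nu> ^ m * K \<nu>)"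
        proof (rule sum_norm_le)
          fix \<nu> assume \<nu>: "\<nu> \<in> Z"
          have "R.component \<nu> b (?x - ?y) = \<nu> ^ m * R.component \<nu> b (x - y)"
            by (rule equivariant_cocycle.equivariant_pow[OF component_cocycle[OF B(1) Z_root[OF \<nu>]] xy])
          thus "norm (R.component \<nu> b (?x - ?y)) \<le> norm \<nu> ^ m * K \<nu>"
            using K[OF \<nu> xy] by (simp add: norm_mult norm_power mult_left_mono)
        qed
        finally show "\<bar>Re (\<Sum>\<nu>\<in>Z. R.component \<nu> b (?x - ?y))\<bar> \<le> (\<Sum>\<nu>\<in>Z. norm \<nu> ^ m * K \<nu>)" .
      qed simp
      finally have "\<bar>a b \<bullet> (?x - ?y) - of_int k\<bar> < \<eta>" using m by linarith
      thus "\<exists>k::int. \<bar>a b \<bullet> (\<phi> ^^ m) (x - y) - of_int k\<bar> < \<eta>" unfolding diff_pow by blast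
    qed
  qed
  moreover have "x = (\<Sum>b\<in>B. (a b \<bullet> x) *\<^sub>R ((1 / real q) *\<^sub>R b))" for x
    using expand[of x] B(2) by (simp add: a[symmetric])
  ultimately show ?thesis using R.finite_B by (intro exI[of _ B] exI[of _ a] exI[of _ "\<lambda>b. (1 / real q) *\<^sub>R b"]) blast
qed

lemma asymptotic_characters_add:
  assumes "a \<in> asymptotic_characters" "b \<in> asymptotic_characters"
  shows "a + b \<in> asymptotic_characters"
  unfolding asymptotic_characters_def
proof (intro CollectI allI impI)
  fix \<eta> :: real assume "\<eta> > 0"
  hence \<eta>: "\<eta> / 2 > 0" by simp
  show "\<forall>\<^sub>F m in sequentially. near_integer (a + b) m \<eta>"
    using eventually_near_integer[OF assms(1) \<eta>] eventually_near_integer[OF assms(2) \<eta>]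
  proof eventually_elim
    case (elim m)
    show ?case
      unfolding near_integer_def
    proof (intro ballI)
      fix x y assume xy: "x \<in> D" "y \<in> D"
      obtain k :: int where k: "\<bar>a \<bullet> (\<phi> ^^ m) (x - y) - of_int k\<bar> < \<eta> / 2" by (rule near_integerE[OF elim(1) xy])
      obtain l :: int where l: "\<bar>b \<bullet> (\<phi> ^^ m) (x - y) - of_int l\<bar> < \<eta> / 2" by (rule near_integerE[OF elim(2) xy])
      have "\<bar>(a + b) \<bullet> (\<phi> ^^ m) (x - y) - of_int (k + l)\<bar> < \<eta>"
        using k l unfolding inner_add_left of_int_add by linarith
      thus "\<exists>k::int. \<bar>(a + b) \<bullet> (\<phi> ^^ m) (x - y) - of_int k\<bar> < \<eta>" by blast
    qed
  qed
qed

lemma asymptotic_characters_int_multiple: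
  assumes "a \<in> asymptotic_characters"
  shows "of_int n *\<^sub>R a \<in> asymptotic_characters"
  unfolding asymptotic_characters_def
proof (intro CollectI allI impI)
  fix \<eta> :: real assume "\<eta> > 0"
  let ?N = "\<bar>of_int n\<bar> + 1 :: real"
  have \<eta>: "\<eta> / ?N > 0" using \<open>\<eta> > 0\<close> by (intro divide_pos_pos) auto
  show "\<forall>\<^sub>F m in sequentially. near_integer (of_int n *\<^sub>R a) m \<eta>"
    using eventually_near_integer[OF assms \<eta>]
  proof eventually_elim
    case (elim m)
    show ?case
      unfolding near_integer_def
    proof (intro ballI)
      fix x y assume xy: "x \<in> D" "y \<in> D"
      obtain k :: int where k: "\<bar>a \<bullet> (\<phi> ^^ m) (x - y) - of_int k\<bar> < \<eta> / ?N" by (rule near_integerE[OF elim xy])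
      have "\<bar>(of_int n *\<^sub>R a) \<bullet> (\<phi> ^^ m) (x - y) - of_int (n * k)\<bar> = \<bar>of_int n\<bar> * \<bar>a \<bullet> (\<phi> ^^ m) (x - y) - of_int k\<bar>"
        by (simp add: abs_mult[symmetric] right_diff_distrib)
      also have "\<dots> \<le> ?N * \<bar>a \<bullet> (\<phi> ^^ m) (x - y) - of_int k\<bar>" by (intro mult_right_mono) auto
      also have "\<dots> < ?N * (\<eta> / ?N)" using k by (intro mult_strict_left_mono) auto
      also have "\<dots> = \<eta>" by simp
      finally show "\<exists>k::int. \<bar>(of_int n *\<^sub>R a) \<bullet> (\<phi> ^^ m) (x - y) - of_int k\<bar> < \<eta>" by blast
    qed
  qed
qed

lemma asymptotic_characters_sum:
  assumes "finite I" "\<And>i. i \<in> I \<Longrightarrow> a i \<in> asymptotic_characters"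
  shows "(\<Sum>i\<in>I. a i) \<in> asymptotic_characters"
  using assms
proof (induction I rule: finite_induct)
  case empty
  have "(0 :: real ^ 'n) \<in> asymptotic_characters"
    unfolding asymptotic_characters_def near_integer_def by (auto intro!: exI[of _ "0::int"])
  thus ?case by simp
next
  case (insert i I)
  thus ?case using asymptotic_characters_add by simp
qed

text \<open>
  The vector \<open>b\<close> is the image of \<open>a\<close> under the \<open>n\<close>-th power of the inverse transpose of \<open>\<phi>\<close>.
\<close>
lemma asymptotic_characters_pull_back:
  assumes a: "a \<in> asymptotic_characters" and b: "\<And>x. b \<bullet> (\<phi> ^^ n) x = a \<bullet> x"
  shows "b \<in> asymptotic_characters"
  unfolding asymptotic_characters_def
proof (intro CollectI allI impI)
  fix \<eta> :: real assume \<eta>: "\<eta> > 0"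
  obtain m\<^sub>1 where m\<^sub>1: "\<And>m. m \<ge> m\<^sub>1 \<Longrightarrow> near_integer a m \<eta>"
    using eventually_near_integer[OF a \<eta>] unfolding eventually_sequentially by blast
  have "near_integer b m \<eta>" if m: "m \<ge> m\<^sub>1 + n" for m
  proof -
    have "(\<phi> ^^ m) v = (\<phi> ^^ n) ((\<phi> ^^ (m - n)) v)" for v
      using m funpow_add[of n "m - n" \<phi>] by (simp add: o_def)
    thus ?thesis using m\<^sub>1[of "m - n"] m by (simp add: near_integer_def b)
  qed
  thus "\<forall>\<^sub>F m in sequentially. near_integer b m \<eta>" unfolding eventually_sequentially by blast
qed

text \<open>
  Move \<open>b\<close> out by the transpose of \<open>\<phi>^n\<close>, round its coefficients with respect to the spanning
  characters to integers, and move back.  The rounding error is bounded independently of \<open>n\<close>, and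
  moving back contracts it.
\<close>
lemma dense_characters:
  assumes \<eta>: "\<eta> > 0"
  shows "\<exists>a\<in>asymptotic_characters. norm (a - b) < \<eta>"
proof -
  obtain B :: "(real ^ 'n) set" and a v where B: "finite B" "\<And>b. b \<in> B \<Longrightarrow> a b \<in> asymptotic_characters"
      and span: "\<And>x. x = (\<Sum>b\<in>B. (a b \<bullet> x) *\<^sub>R v b)"
    using spanning_characters by blast
  define S where "S = (\<Sum>b\<in>B. norm (a b))"
  have S: "S \<ge> 0" by (simp add: S_def sum_nonneg)
  obtain C r where C: "C > 0" "r > 0" "r < 1" "\<And>n x. norm x \<le> C * r ^ n * norm ((\<phi> ^^ n) x)"
    using expansion by blast
  have "(\<lambda>n. S * (C * r ^ n)) \<longlonglongrightarrow> S * (C * 0)"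
    using C by (intro tendsto_mult tendsto_const LIMSEQ_realpow_zero) auto
  hence "\<forall>\<^sub>F n in sequentially. S * (C * r ^ n) < \<eta>" using \<eta> by (intro order_tendstoD) auto
  then obtain n where n: "S * (C * r ^ n) < \<eta>" unfolding eventually_sequentially by blast
  define c where "c = adjoint (\<phi> ^^ n) b"
  have c: "c \<bullet> x = b \<bullet> (\<phi> ^^ n) x" for x
    unfolding c_def using adjoint_works[OF linear_pow[of n], of x b] by (simp add: inner_commute)
  define c' where "c' = (\<Sum>e\<in>B. of_int \<lfloor>c \<bullet> v e\<rfloor> *\<^sub>R a e)"
  have c'_char: "c' \<in> asymptotic_characters"
    unfolding c'_def using B by (intro asymptotic_characters_sum asymptotic_characters_int_multiple)
  have c_eq: "c = (\<Sum>e\<in>B. (c \<bullet> v e) *\<^sub>R a e)"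
  proof (rule vector_eq_rdot[THEN iffD1], rule allI)
    fix x
    have "c \<bullet> x = c \<bullet> (\<Sum>e\<in>B. (a e \<bullet> x) *\<^sub>R v e)" using span[of x] by simp
    thus "c \<bullet> x = (\<Sum>e\<in>B. (c \<bullet> v e) *\<^sub>R a e) \<bullet> x" by (simp add: inner_sum_right inner_sum_left mult.commute)
  qed
  have "norm (c' - c) \<le> S"
  proof -
    have "c' - c = (\<Sum>e\<in>B. (of_int \<lfloor>c \<bullet> v e\<rfloor> - c \<bullet> v e) *\<^sub>R a e)"
      by (subst c_eq) (simp add: c'_def sum_subtractf scaleR_left_diff_distrib)
    also have "norm \<dots> \<le> S"
      unfolding S_def
    proof (rule sum_norm_le)
      fix e
      have "\<bar>of_int \<lfloor>c \<bullet> v e\<rfloor> - c \<bullet> v e\<bar> \<le> 1" by linarith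
      hence "\<bar>of_int \<lfloor>c \<bullet> v e\<rfloor> - c \<bullet> v e\<bar> * norm (a e) \<le> 1 * norm (a e)" by (intro mult_right_mono) auto
      thus "norm ((of_int \<lfloor>c \<bullet> v e\<rfloor> - c \<bullet> v e) *\<^sub>R a e) \<le> norm (a e)" by simp
    qed
    finally show ?thesis .
  qed
  have "inj (\<phi> ^^ n)"
  proof -
    have "x = 0" if "(\<phi> ^^ n) x = 0" for x using C(4)[of x n] that by simp
    thus ?thesis using linear_injective_0[OF linear_pow] by blast
  qed
  then obtain \<psi> where \<psi>: "linear \<psi>" "\<And>x. \<psi> ((\<phi> ^^ n) x) = x" "\<And>y. (\<phi> ^^ n) (\<psi> y) = y"
    using linear_injective_isomorphism[OF linear_pow] by blast
  have "linear (\<lambda>y. c' \<bullet> \<psi> y)"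
    by (rule linearI) (simp_all add: linear_add[OF \<psi>(1)] linear_scale[OF \<psi>(1)] inner_add_right)
  then obtain b' where b': "\<And>y. c' \<bullet> \<psi> y = b' \<bullet> y" using linear_functional_inner by blast
  have b'_n: "b' \<bullet> (\<phi> ^^ n) x = c' \<bullet> x" for x using b'[of "(\<phi> ^^ n) x"] \<psi>(2) by simp
  have "norm (b' - b) \<le> S * (C * r ^ n)"
  proof -
    let ?w = "b' - b"
    have "(norm ?w)\<^sup>2 = ?w \<bullet> (\<phi> ^^ n) (\<psi> ?w)" by (simp add: \<psi>(3) power2_norm_eq_inner)
    also have "\<dots> = (c' - c) \<bullet> \<psi> ?w" by (simp add: inner_diff_left b'_n c)
    also have "\<dots> \<le> norm (c' - c) * norm (\<psi> ?w)" by (rule norm_cauchy_schwarz)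
    also have "\<dots> \<le> S * (C * r ^ n * norm ?w)"
      using \<open>norm (c' - c) \<le> S\<close> C(4)[of "\<psi> ?w" n] S by (intro mult_mono) (auto simp: \<psi>(3))
    finally have "norm ?w * norm ?w \<le> (S * (C * r ^ n)) * norm ?w" by (simp add: power2_eq_square mult_ac)
    thus ?thesis
      by (cases "norm ?w = 0") (use S C in auto)
  qed
  hence "norm (b' - b) < \<eta>" using n by linarith
  thus ?thesis using asymptotic_characters_pull_back[OF c'_char b'_n] by blast
qed

end

section \<open>Approximation by asymptotic characters\<close>

lemma common_minimal_polynomial:
  assumes "\<mu>\<^sub>0 \<in> S" and conj: "\<And>\<mu> \<nu>. \<mu> \<in> S \<Longrightarrow> \<nu> \<in> S \<Longrightarrow> algebraic_conjugates \<mu> \<nu>"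
  obtains p where "irreducible p" "\<And>\<mu>. \<mu> \<in> S \<Longrightarrow> poly (cpoly p) \<mu> = 0"
proof -
  obtain p where p: "irreducible p" "poly (cpoly p) \<mu>\<^sub>0 = 0"
    using conj[OF assms(1,1)] unfolding algebraic_conjugates_def by blast
  have "poly (cpoly p) \<mu> = 0" if \<mu>: "\<mu> \<in> S" for \<mu>
  proof -
    obtain q where q: "irreducible q" "poly (cpoly q) \<mu>\<^sub>0 = 0" "poly (cpoly q) \<mu> = 0"
      using conj[OF assms(1) \<mu>] unfolding algebraic_conjugates_def by blast
    show ?thesis by (rule conjugate_root[OF q p(2)])
  qed
  thus ?thesis using that p(1) by blast
qed

lemma eps_close_image:
  assumes "\<And>u. u \<in> F \<Longrightarrow> norm (u - f u) < \<eta>" "\<eta> \<le> e"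
    and "\<And>u v. u \<in> F \<Longrightarrow> v \<in> F \<Longrightarrow> u \<noteq> v \<Longrightarrow> e + \<eta> \<le> norm (u - v)"
  shows "eps_close e F (f ` F)"
proof -
  have close: "norm (u - f u) < e" if "u \<in> F" for u using assms(1)[OF that] assms(2) by linarith
  have far: "u = v" if uv: "u \<in> F" "v \<in> F" "norm (u - f v) < e" for u v
  proof (rule ccontr)
    assume "u \<noteq> v"
    hence "e + \<eta> \<le> norm (u - v)" by (rule assms(3)[OF uv(1,2)])
    moreover have "norm (u - v) \<le> norm (u - f v) + norm (v - f v)"
      using norm_triangle_ineq4[of "u - f v" "v - f v"] by simp
    ultimately show False using uv(3) assms(1)[OF uv(2)] by linarith
  qed
  show ?thesis
    unfolding eps_close_def
  proof (intro conjI ballI)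
    fix u assume u: "u \<in> F"
    show "\<exists>!y. y \<in> f ` F \<and> norm (u - y) < e"
    proof (rule ex1I[of _ "f u"])
      show "f u \<in> f ` F \<and> norm (u - f u) < e" using u close by blast
      fix y assume "y \<in> f ` F \<and> norm (u - y) < e"
      thus "y = f u" using far[OF u] by blast
    qed
  next
    fix y assume "y \<in> f ` F"
    then obtain v where v: "v \<in> F" "y = f v" by blast
    show "\<exists>!x. x \<in> F \<and> norm (x - y) < e"
      unfolding v(2) by (rule ex1I[of _ v]) (use v(1) close far in blast)+
  qed
qed

lemma positive_lower_bound:
  assumes "finite S" "\<And>s. s \<in> S \<Longrightarrow> (0 :: real) < s"
  shows "\<exists>\<eta>>0. \<forall>s\<in>S. \<eta> \<le> s"
proof (intro exI conjI)
  show "0 < Min (insert 1 S)" using assms by (subst Min_gr_iff) auto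
  show "\<forall>s\<in>S. Min (insert 1 S) \<le> s" using assms by auto
qed

text \<open>
  At a scale \<open>\<eta>\<close> below half of the smallest distance in \<open>F\<close>, and below the excess over \<open>\<epsilon>\<close> of the
  distances that exceed \<open>\<epsilon>\<close>, an \<open>\<eta>\<close>-approximation of \<open>F\<close> can be recognized at both scales \<open>\<eta>\<close> and \<open>\<epsilon>\<close>.
\<close>
lemma approximation_scale:
  fixes F :: "'a::real_normed_vector set"
  assumes "finite F" "\<epsilon> > 0" "c > 0"
  obtains \<eta> where "\<eta> > 0" "\<eta> \<le> \<epsilon>" "\<eta> \<le> c"
    "\<And>u v. u \<in> F \<Longrightarrow> v \<in> F \<Longrightarrow> u \<noteq> v \<Longrightarrow> \<eta> + \<eta> \<le> norm (u - v)"
    "\<And>u v. u \<in> F \<Longrightarrow> v \<in> F \<Longrightarrow> \<epsilon> < norm (u - v) \<Longrightarrow> \<epsilon> + \<eta> \<le> norm (u - v)"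
proof -
  let ?S\<^sub>1 = "(\<lambda>(u, v). norm (u - v) / 2) ` {(u, v) \<in> F \<times> F. u \<noteq> v}"
  let ?S\<^sub>2 = "(\<lambda>(u, v). norm (u - v) - \<epsilon>) ` {(u, v) \<in> F \<times> F. \<epsilon> < norm (u - v)}"
  have fin: "finite {(u, v) \<in> F \<times> F. Q u v}" for Q
    by (rule finite_subset[of _ "F \<times> F"]) (use assms(1) in auto)
  define S where "S = {\<epsilon>, c} \<union> ?S\<^sub>1 \<union> ?S\<^sub>2"
  have "finite S" unfolding S_def by (intro finite_UnI finite_imageI fin) simp
  moreover have "0 < s" if "s \<in> S" for s using that assms(2,3) by (auto simp: S_def)
  ultimately have "\<exists>\<eta>>0. \<forall>s\<in>S. \<eta> \<le> s" by (rule positive_lower_bound)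
  then obtain \<eta> where "\<eta> > 0" "\<forall>s\<in>S. \<eta> \<le> s" by blast
  hence \<eta>: "\<eta> > 0" "\<And>s. s \<in> S \<Longrightarrow> \<eta> \<le> s" by auto
  show ?thesis
  proof (rule that[OF \<eta>(1)])
    show "\<eta> \<le> \<epsilon>" "\<eta> \<le> c" using \<eta>(2)[of \<epsilon>] \<eta>(2)[of c] by (simp_all add: S_def)
    fix u v assume uv: "u \<in> F" "v \<in> F"
    show "\<eta> + \<eta> \<le> norm (u - v)" if "u \<noteq> v"
    proof -
      have "\<eta> \<le> norm (u - v) / 2" using uv that by (intro \<eta>(2)) (force simp: S_def)
      thus ?thesis by simp
    qed
    show "\<epsilon> + \<eta> \<le> norm (u - v)" if "\<epsilon> < norm (u - v)"
    proof -
      have "\<eta> \<le> norm (u - v) - \<epsilon>" using uv that by (intro \<eta>(2)) (force simp: S_def)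
      thus ?thesis by simp
    qed
  qed
qed

text \<open>
  The vector on the right pairs with \<open>a\<close> to a number at distance more than \<open>1/4\<close> from the integers.
\<close>
lemma (in Pisot_inflation) half_integer_gap:
  assumes a: "a \<noteq> 0" "norm a * R\<^sub>0 \<le> 1 / 4"
    and near: "near_integer a m (1 / 4)"
    and y: "y \<in> Ker_character a" and z: "norm z < R\<^sub>0" and xx: "x \<in> D" "x' \<in> D"
  shows "(\<phi> ^^ m) (x - x') \<noteq> (1 / (2 * (norm a)\<^sup>2)) *\<^sub>R a + y + z"
proof
  assume eq: "(\<phi> ^^ m) (x - x') = (1 / (2 * (norm a)\<^sup>2)) *\<^sub>R a + y + z"
  obtain k :: int where k: "\<bar>a \<bullet> (\<phi> ^^ m) (x - x') - of_int k\<bar> < 1 / 4" by (rule near_integerE[OF near xx])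
  obtain l :: int where l: "a \<bullet> y = of_int l" using y unfolding Ker_character_iff by (auto elim: Ints_cases)
  have "a \<bullet> a = (norm a)\<^sup>2" by (simp add: power2_norm_eq_inner)
  hence "a \<bullet> (\<phi> ^^ m) (x - x') = 1 / 2 + of_int l + a \<bullet> z"
    unfolding eq using a(1) by (simp add: inner_add_right l)
  moreover have "\<bar>a \<bullet> z\<bar> < 1 / 4"
  proof -
    have "\<bar>a \<bullet> z\<bar> \<le> norm a * norm z" by (rule Cauchy_Schwarz_ineq2)
    also have "\<dots> < norm a * R\<^sub>0" using a(1) z by (intro mult_strict_left_mono) auto
    finally show ?thesis using a(2) by linarith
  qed
  ultimately have "\<bar>1 / 2 + real_of_int l - real_of_int k\<bar> < 1 / 2" using k by linarith
  hence "real_of_int l < real_of_int k" "real_of_int k < real_of_int (l + 1)" unfolding of_int_add of_int_1 by linarith+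
  thus False unfolding of_int_less_iff by simp
qed

theorem theorem4p31:
  fixes \<A> \<T> :: "(real ^ 'n) set set"
    and \<phi> :: "real ^ 'n \<Rightarrow> real ^ 'n"
    and \<omega> :: "(real ^ 'n) set \<Rightarrow> (real ^ 'n) set set"
    and R\<^sub>0 \<epsilon> :: real
    and F :: "(real ^ 'n) set"
  assumes "pseudo_substitution \<A> \<phi> \<omega>"
    and "iteratable \<A> \<phi> \<omega>"
    and "primitive_rule \<A> \<phi> \<omega>"
    and "expanding_rule \<A> \<phi> \<omega>"
    and "rule_FLC \<A> \<phi> \<omega>"
    and "fixed_point \<A> \<phi> \<omega> \<T>"
    and "repetitive \<T>"
    and "non_periodic \<T>"
    and "tiling_FLC \<T>"
    and "diagonalizable_over_complex \<phi>"
    and "\<forall>\<mu>\<in>spectrum \<phi>. \<forall>\<nu>\<in>spectrum \<phi>.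
           algebraic_conjugates \<mu> \<nu> \<and> eigen_multiplicity \<phi> \<mu> = eigen_multiplicity \<phi> \<nu>"
    and "Pisot_family (spectrum \<phi>)"
    and "R\<^sub>0 > 0"
    and "\<epsilon> > 0"
    and "finite F"
    and "F \<subseteq> ball 0 (1 / (8 * R\<^sub>0))"
  shows "\<exists>m>0. \<exists>F'. \<exists>x :: real ^ 'n \<Rightarrow> (real ^ 'n) set set \<Rightarrow> real ^ 'n.
           finite F' \<and> 0 \<notin> F' \<and>
           (\<forall>a\<in>F'. \<forall>\<P>\<^sub>1\<in>\<Pi>\<^sub>p \<T> \<A>. \<forall>\<P>\<^sub>2\<in>\<Pi>\<^sub>p \<T> \<A>. \<forall>y\<in>Ker_character a. \<forall>z\<in>ball 0 R\<^sub>0.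
              \<not> legal \<T> ((\<P>\<^sub>1 +\<^sub>p x a \<P>\<^sub>1) \<union>
                  (\<P>\<^sub>2 +\<^sub>p (x a \<P>\<^sub>2 + (inv \<phi> ^^ m) ((1 / (2 * (norm a)\<^sup>2)) *\<^sub>R a + y + z))))) \<and>
           ((\<forall>u\<in>F. \<forall>v\<in>F. u \<noteq> v \<longrightarrow> \<epsilon> < norm (u - v)) \<longrightarrow> eps_close \<epsilon> F F') \<and>
           (\<exists>\<delta>. 0 < \<delta> \<and> \<delta> \<le> \<epsilon> \<and> eps_close \<delta> F F')"
proof -
  have lin: "linear \<phi>" and expansive: "\<And>\<mu>. \<mu> \<in> spectrum \<phi> \<Longrightarrow> norm \<mu> > 1"
    using assms(1) unfolding pseudo_substitution_def expansive_def by blast+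
  obtain U W d where "eigencoordinates \<phi> U W d"
    by (rule diagonalizable_eigencoordinates[OF lin assms(10)]) (rule that)
  then interpret E: eigencoordinates \<phi> U W d .
  have gt1: "norm (d i) > 1" for i using expansive E.spectrum_eq by blast
  obtain C r where Cr: "C > 0" "r > 0" "r < 1" "\<And>n x. norm x \<le> C * r ^ n * norm ((\<phi> ^^ n) x)"
  proof -
    define s where "s = Min (range (\<lambda>i. norm (d i)))"
    have s_le: "s \<le> norm (d i)" for i unfolding s_def by (intro Min_le) auto
    have "s \<in> range (\<lambda>i. norm (d i))" unfolding s_def by (intro Min_in) auto
    hence "s > 1" using gt1 by auto
    moreover from this obtain C where "C > 0" "\<And>n x. norm x \<le> C * (1 / s) ^ n * norm ((\<phi> ^^ n) x)"
      using E.pow_expansion[of s] s_le by auto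
    ultimately show ?thesis using that[of C "1 / s"] by simp
  qed
  obtain c where "inflation_set {c P + x | P x. P \<in> \<A> \<and> P +\<^sub>t x \<in> \<T>} \<phi>"
    by (rule control_points[OF assms(1,3,6,7,9) Cr]) (rule that)
  define D where "D = {c P + x | P x. P \<in> \<A> \<and> P +\<^sub>t x \<in> \<T>}"
  have infl: "inflation_set D \<phi>" unfolding D_def by fact
  obtain p where p: "irreducible p" "\<And>\<mu>. \<mu> \<in> spectrum \<phi> \<Longrightarrow> poly (cpoly p) \<mu> = 0"
    by (rule common_minimal_polynomial[of "d undefined" "spectrum \<phi>"])
      (use assms(11) E.spectrum_eq in auto)
  have "Pisot_inflation D \<phi> U W d p"
  proof (intro Pisot_inflation.intro Pisot_inflation_axioms.intro)
    show "inflation_set D \<phi>" "eigencoordinates \<phi> U W d" "irreducible p" by (rule infl E.eigencoordinates_axioms p)+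
    fix i i'
    show "poly (cpoly p) (d i) = 0" using p(2) E.spectrum_eq by blast
    show "norm (d i) > 1" by (rule gt1)
    show "card {j. d j = d i} = card {j. d j = d i'}"
      using assms(11) E.spectrum_eq unfolding E.eigen_multiplicity_eq by blast
  next
    fix \<nu> assume \<nu>: "poly (cpoly p) \<nu> = 0" "\<nu> \<notin> range d"
    have "algebraic_conjugates (d undefined) \<nu>"
      unfolding algebraic_conjugates_def using p \<nu>(1) E.spectrum_eq by blast
    thus "norm \<nu> < 1" using assms(12) \<nu>(2) E.spectrum_eq unfolding Pisot_family_def by blast
  qed
  then interpret P: Pisot_inflation D \<phi> U W d p .
  obtain \<eta> where \<eta>: "\<eta> > 0" "\<eta> \<le> \<epsilon>" "\<eta> \<le> 1 / (8 * R\<^sub>0)"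
      and sep: "\<And>u v. u \<in> F \<Longrightarrow> v \<in> F \<Longrightarrow> u \<noteq> v \<Longrightarrow> \<eta> + \<eta> \<le> norm (u - v)"
        "\<And>u v. u \<in> F \<Longrightarrow> v \<in> F \<Longrightarrow> \<epsilon> < norm (u - v) \<Longrightarrow> \<epsilon> + \<eta> \<le> norm (u - v)"
    by (rule approximation_scale[OF assms(15,14), of "1 / (8 * R\<^sub>0)"]) (use assms(13) in auto)
  have "\<exists>a\<in>P.asymptotic_characters. a \<noteq> 0 \<and> norm (u - a) < \<eta>" for u
  proof -
    obtain u' :: "real ^ 'n" where u': "u' \<noteq> 0" "norm (u' - u) < \<eta> / 2"
    proof (cases "u = 0")
      case True
      obtain w :: "real ^ 'n" where "norm w = \<eta> / 4" using vector_choose_size[of "\<eta> / 4"] \<eta>(1) by auto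
      thus ?thesis using that[of w] True \<eta>(1) by auto
    next
      case False
      thus ?thesis using that[of u] \<eta>(1) by simp
    qed
    have "min (\<eta> / 2) (norm u') > 0" using u'(1) \<eta>(1) by simp
    then obtain a where a: "a \<in> P.asymptotic_characters" "norm (a - u') < min (\<eta> / 2) (norm u')"
      using P.dense_characters by blast
    have "a \<noteq> 0" using a(2) by auto
    moreover have "norm (u - a) < \<eta>"
    proof -
      have "norm (u - a) \<le> norm (u' - u) + norm (a - u')"
        using norm_triangle_ineq[of "u' - u" "a - u'"] by (simp add: norm_minus_commute)
      thus ?thesis using u'(2) a(2) by linarith
    qed
    ultimately show ?thesis using a(1) by blast
  qed
  then obtain f where f: "\<And>u. f u \<in> P.asymptotic_characters" "\<And>u. f u \<noteq> 0" "\<And>u. norm (u - f u) < \<eta>" by metis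
  have "\<exists>m\<^sub>0. \<forall>m\<ge>m\<^sub>0. P.near_integer (f u) m (1 / 4)" for u
    using P.eventually_near_integer[OF f(1)[of u], of "1 / 4"] by (simp add: eventually_sequentially)
  then obtain m\<^sub>0 where m\<^sub>0: "\<And>u. \<forall>m\<ge>m\<^sub>0 u. P.near_integer (f u) m (1 / 4)" by metis
  define m where "m = Suc (Max (insert 0 (m\<^sub>0 ` F)))"
  have m_ge: "m\<^sub>0 u \<le> m" if "u \<in> F" for u
    unfolding m_def using that assms(15) by (intro le_SucI Max_ge) auto
  have pow_inv: "(\<phi> ^^ n) ((inv \<phi> ^^ n) v) = v" for n v
    using P.surj_pow[of 1] by (induction n arbitrary: v) (simp_all add: funpow_swap1[of \<phi>] surj_f_inv_f)
  define pt where "pt \<P> = (SOME P. P \<in> \<P> \<inter> \<A>)" for \<P>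
  have pt: "pt \<P> \<in> \<P>" "pt \<P> \<in> \<A>" if "\<P> \<in> \<Pi>\<^sub>p \<T> \<A>" for \<P>
  proof -
    have "\<exists>P. P \<in> \<P> \<inter> \<A>" using that unfolding legal_patches_def by blast
    hence "pt \<P> \<in> \<P> \<inter> \<A>" unfolding pt_def by (rule someI_ex)
    thus "pt \<P> \<in> \<P>" "pt \<P> \<in> \<A>" by auto
  qed
  define x where "x a \<P> = - c (pt \<P>)" for a :: "real ^ 'n" and \<P>
  have in_D: "v + s \<in> D" if "\<P> \<in> \<Pi>\<^sub>p \<T> \<A>" "((\<P> +\<^sub>p (x a \<P> + s)) +\<^sub>p v) \<subseteq> \<T>" for \<P> a s v
  proof -
    have "(pt \<P> +\<^sub>t (x a \<P> + s)) +\<^sub>t v \<in> \<T>"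
      using that(2) shift_tile_mem[OF shift_tile_mem[OF pt(1)[OF that(1)]]] by blast
    hence "c (pt \<P>) + ((x a \<P> + s) + v) \<in> D"
      unfolding D_def shift_tile_shift_tile using pt(2)[OF that(1)] by blast
    thus ?thesis by (simp add: x_def add.commute)
  qed
  have not_legal: "\<not> legal \<T> ((\<P>\<^sub>1 +\<^sub>p x a \<P>\<^sub>1) \<union> (\<P>\<^sub>2 +\<^sub>p (x a \<P>\<^sub>2 + (inv \<phi> ^^ m) ((1 / (2 * (norm a)\<^sup>2)) *\<^sub>R a + y + z))))"
    if a: "a \<in> f ` F" and P12: "\<P>\<^sub>1 \<in> \<Pi>\<^sub>p \<T> \<A>" "\<P>\<^sub>2 \<in> \<Pi>\<^sub>p \<T> \<A>" and y: "y \<in> Ker_character a" and z: "z \<in> ball 0 R\<^sub>0"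
    for a \<P>\<^sub>1 \<P>\<^sub>2 y z
  proof
    let ?t = "(1 / (2 * (norm a)\<^sup>2)) *\<^sub>R a + y + z"
    assume "legal \<T> ((\<P>\<^sub>1 +\<^sub>p x a \<P>\<^sub>1) \<union> (\<P>\<^sub>2 +\<^sub>p (x a \<P>\<^sub>2 + (inv \<phi> ^^ m) ?t)))"
    then obtain v where v: "((\<P>\<^sub>1 +\<^sub>p (x a \<P>\<^sub>1 + 0)) +\<^sub>p v) \<subseteq> \<T>" "((\<P>\<^sub>2 +\<^sub>p (x a \<P>\<^sub>2 + (inv \<phi> ^^ m) ?t)) +\<^sub>p v) \<subseteq> \<T>"
      unfolding legal_def by (auto simp: shift_tiles_def image_Un)
    have D12: "v + (inv \<phi> ^^ m) ?t \<in> D" "v \<in> D" using in_D[OF P12(2) v(2)] in_D[OF P12(1) v(1)] by simp_all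
    obtain u where u: "u \<in> F" "a = f u" using a by blast
    have "norm a * R\<^sub>0 \<le> 1 / 4"
    proof -
      have "norm a \<le> norm u + norm (u - f u)"
        using norm_triangle_ineq4[of u "u - f u"] by (simp add: u(2))
      moreover have "norm u < 1 / (8 * R\<^sub>0)" using u(1) assms(16) by auto
      ultimately have "norm a \<le> 1 / (8 * R\<^sub>0) + 1 / (8 * R\<^sub>0)" using f(3)[of u] \<eta>(3) by linarith
      hence "norm a * R\<^sub>0 \<le> (1 / (8 * R\<^sub>0) + 1 / (8 * R\<^sub>0)) * R\<^sub>0" using assms(13) by (intro mult_right_mono) auto
      thus ?thesis using assms(13) by (simp add: field_simps)
    qed
    moreover have "P.near_integer a m (1 / 4)" using m\<^sub>0[of u] m_ge[OF u(1)] unfolding u(2) by blast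
    ultimately have "(\<phi> ^^ m) ((v + (inv \<phi> ^^ m) ?t) - v) \<noteq> ?t"
      using f(2)[of u] y z D12 by (intro P.half_integer_gap[where R\<^sub>0 = R\<^sub>0]) (auto simp: u(2))
    thus False by (simp add: pow_inv)
  qed
  have "eps_close \<eta> F (f ` F)" using sep(1) by (intro eps_close_image[where \<eta> = \<eta>] f(3)) auto
  moreover have "eps_close \<epsilon> F (f ` F)" if "\<forall>u\<in>F. \<forall>v\<in>F. u \<noteq> v \<longrightarrow> \<epsilon> < norm (u - v)"
    using sep(2) that \<eta>(2) by (intro eps_close_image[where \<eta> = \<eta>] f(3)) auto
  moreover have "finite (f ` F)" "0 \<notin> f ` F" "m > 0" using assms(15) f(2) by (auto simp: m_def)
  ultimately show ?thesis
    using not_legal \<eta>(1,2) by (intro exI[of _ m] exI[of _ "f ` F"] exI[of _ x] conjI) blast+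
qed

end
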